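(* Let $N\ge1$ and $\gamma\neq0$, and let the parameters be generic. Suppose the complex numbers $u_1,\dots,u_N,v_1,\dots,v_N$ satisfy the admissibility condition: there is $\varepsilon>0$ such that $$\left|\frac{\xi_x u_i-s_x}{1-s_x\xi_x u_i}\cdot\frac{v_j/\xi_x-s_x}{1-s_x v_j/\xi_x}\right|\le 1-\varepsilon\quad\text{for all } i,j\in\{1,\dots,N\}\text{ and all } x\in\mathbb Z_{\ge0}.$$ Then the series below converges and $$\sum_{\lambda\in\mathrm{Sign}_N}\frac{(\gamma q;q)_{m_0(\lambda)}(\gamma^{-1}s_0^2;q)_{m_0(\lambda)}}{(q;q)_{m_0(\lambda)}(s_0^2;q)_{m_0(\lambda)}}\,\mathsf F_\lambda(u_1,\dots,u_N)\,\mathsf F^*_\lambda(v_1,\dots,v_N)$$ $$=\prod_{j=1}^N\frac{1}{(1-s_0\xi_0u_j)(1-\xi_0^{-1}s_0v_j)}\cdot\frac{\prod_{i,j=1}^N(1-qu_iv_j)}{\prod_{1\le i<j\le N}(u_i-u_j)(v_i-v_j)}\det\left[\frac{(1-\gamma)(q-\gamma^{-1}s_0^2)(1-u_iv_j)+(1-q)(1-\xi_0s_0u_i)(1-\xi_0^{-1}s_0v_j)}{(1-u_iv_j)(1-qu_iv_j)}\right]_{i,j=1}^N.$$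
   Context: Fix $q\in(0,1)$ and complex parameters $s_x,\xi_x$ ($x\in\mathbb Z_{\ge0}$, $\xi_x\ne0$). A signature of length $N$ is an integer sequence $\lambda=(\lambda_1\ge\lambda_2\ge\dots\ge\lambda_N\ge0)$; $\mathrm{Sign}_N$ is the set of these. $m_r(\lambda)$ is the number of $i$ with $\lambda_i=r$, and $\ell(\lambda)=N-m_0(\lambda)$ is the number of nonzero parts. $(a;q)_k=\prod_{i=0}^{k-1}(1-aq^i)$, $(a;q)_0=1$. For $k\ge0$ let $\varphi_k(u)=\frac{1-q}{1-s_k\xi_ku}\prod_{j=0}^{k-1}\frac{\xi_ju-s_j}{1-s_j\xi_ju}$, and let $\hat\varphi_k$ denote $\varphi_k$ with every $\xi_x$ replaced by $\xi_x^{-1}$. The spin Hall--Littlewood function is $\mathsf F_\lambda(u_1,\dots,u_N)=\sum_{\sigma\in S_N}\sigma\Big(\prod_{1\le i<j\le N}\frac{u_i-qu_j}{u_i-u_j}\prod_{i=1}^N\varphi_{\lambda_i}(u_i)\Big)$, where $\sigma$ permutes the variables $u_1,\dots,u_N$ (not the $\lambda_i$). The dual function is $\mathsf F^*_\lambda(v_1,\dots,v_N)=\prod_{r\ge0}\frac{(s_r^2;q)_{m_r(\lambda)}}{(q;q)_{m_r(\lambda)}}\sum_{\sigma\in S_N}\sigma\Big(\prod_{1\le i<j\le N}\frac{v_i-qv_j}{v_i-v_j}\prod_{i=1}^N\hat\varphi_{\lambda_i}(v_i)\Big)$, with $\sigma$ permuting the $v$'s. *)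

theory Defs
  imports "HOL-Analysis.Infinite_Sum" "Jordan_Normal_Form.Determinant"
begin

definition qpoch :: "complex \<Rightarrow> complex \<Rightarrow> nat \<Rightarrow> complex" where
  "qpoch a q k = (\<Prod>i<k. 1 - a * q ^ i)"

text \<open>phi_k(u); the hatted version is obtained by passing (\<lambda>x. inverse (xi x)).\<close>
definition phi :: "real \<Rightarrow> (nat \<Rightarrow> complex) \<Rightarrow> (nat \<Rightarrow> complex) \<Rightarrow> nat \<Rightarrow> complex \<Rightarrow> complex" where
  "phi q s xi k u = (1 - of_real q) / (1 - s k * xi k * u) *
     (\<Prod>j<k. (xi j * u - s j) / (1 - s j * xi j * u))"

text \<open>Signatures of length N, as weakly decreasing lists of naturals
  (list index 0..N-1 corresponds to lambda_1..lambda_N).\<close>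
definition Sign :: "nat \<Rightarrow> nat list set" where
  "Sign N = {l. length l = N \<and> sorted_wrt (\<lambda>a b. a \<ge> b) l}"

definition symmetrize :: "real \<Rightarrow> nat \<Rightarrow> (nat \<Rightarrow> complex \<Rightarrow> complex) \<Rightarrow> (nat \<Rightarrow> complex) \<Rightarrow> complex" where
  "symmetrize q N f u = (\<Sum>\<sigma> | \<sigma> permutes {..<N}.
     (\<Prod>i<N. \<Prod>j\<in>{i<..<N}. (u (\<sigma> i) - of_real q * u (\<sigma> j)) / (u (\<sigma> i) - u (\<sigma> j))) *
     (\<Prod>i<N. f i (u (\<sigma> i))))"

definition spinHL :: "real \<Rightarrow> (nat \<Rightarrow> complex) \<Rightarrow> (nat \<Rightarrow> complex) \<Rightarrow> nat list \<Rightarrow> (nat \<Rightarrow> complex) \<Rightarrow> complex" where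
  "spinHL q s xi l u = symmetrize q (length l) (\<lambda>i. phi q s xi (l ! i)) u"

text \<open>Dual function F^*_lambda(v_1..v_N). The product over r \<ge> 0 is restricted to
  r occurring in lambda; all other factors equal 1 (m_r = 0).\<close>
definition spinHL_dual :: "real \<Rightarrow> (nat \<Rightarrow> complex) \<Rightarrow> (nat \<Rightarrow> complex) \<Rightarrow> nat list \<Rightarrow> (nat \<Rightarrow> complex) \<Rightarrow> complex" where
  "spinHL_dual q s xi l v =
     (\<Prod>r\<in>set l. qpoch ((s r)\<^sup>2) (of_real q) (count_list l r) / qpoch (of_real q) (of_real q) (count_list l r)) *
     symmetrize q (length l) (\<lambda>i. phi q s (\<lambda>x. inverse (xi x)) (l ! i)) v"

end

theory Submission
  imports Defs "HOL-Combinatorics.Multiset_Permutations"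
begin

text \<open>
  Splitting off the \<open>m\<close> zero parts of a signature turns the sum over signatures into a finite sum over
  subsets \<open>I\<close>, \<open>J\<close> of the two sets of variables, whose terms contain the same kind of sum, without
  refinement and with shifted parameters, in the variables \<open>u\<^sub>I\<close>, \<open>v\<^sub>J\<close>. The unrefined sum does not depend on
  the parameters: it equals \<open>D(u, v)\<close>, the determinantal expression at \<open>\<gamma> = 1\<close>. Indeed, if \<open>\<delta>\<^sub>x\<close> is the
  difference of the two with the first \<open>x\<close> columns removed, then the splitting gives
  \<open>\<delta>\<^sub>x = (\<Prod> P\<^sub>x) \<delta>\<^sub>x\<^sub>+\<^sub>1\<close> with \<open>\<bar>\<Prod> P\<^sub>x\<bar> \<le> 1 - \<epsilon>\<close>, and \<open>\<delta>\<close> is bounded uniformly in \<open>x\<close>.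

  What remains is a finite identity between rational functions, \<open>E = R\<close>, where \<open>E\<close> is the sum over
  \<open>I\<close>, \<open>J\<close> with inner terms \<open>D(u\<^sub>I, v\<^sub>J)\<close> and \<open>R\<close> is the determinant, expanded along its rows into
  Cauchy determinants. As a function of a single variable \<open>u\<^sub>k\<close> the difference \<open>E - R\<close> has no poles: those at
  \<open>u\<^sub>k = u\<^sub>i\<close> cancel by symmetry, and at \<open>u\<^sub>k v\<^sub>l = 1\<close> both residues reduce to the same multiple of the
  identity with one variable less. It is also bounded, hence constant in each \<open>u\<^sub>k\<close>. At \<open>u\<^sub>i = s q\<^sup>i\<close> only
  \<open>I = J = {}\<close> survives in \<open>E\<close> and a single term in \<open>R\<close>, and these two agree.
\<close>

subsection \<open>Polynomial functions with a bounded degree\<close>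

text \<open>The finite identity \<open>E = R\<close> is used twice. At \<gamma> = 1 the summand with
  1 - \<gamma> drops out of the entries, the factors 1 - s * u i and 1 - s * v j leave the
  determinant, and what remains says that \<open>D\<close> obeys the same splitting as the unrefined
  sum. Together with induction on the number of variables, which settles all proper subsets, this
  leaves a single term in the recursion for \<delta>. For general \<gamma> the identity is applied
  once, to the first column, because the refinement sees only the number of zero parts. Scaling u by
  \<xi> and v by its inverse changes neither \<open>D\<close> nor the cross factors, so the identity
  needs no \<xi>.

  Boundedness of \<open>E - R\<close> is not visible term by term: the coefficients in
  \<open>R\<close> grow linearly in the variable, and the two kinds of rows must cancel at infinity.
  The points s q^i are distinct only for s \<noteq> 0, so the remaining values of the parameters are
  reached by continuity.

  The bound on \<delta> is the analytic obstacle, since no assumption keeps the denominators away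
  from 0 uniformly in x; the weight of the dual function has to compensate for them.\<close>

text \<open>\<open>c\<close> is the coefficient of \<open>z ^ d\<close> and may vanish.\<close>

definition polyb :: "nat \<Rightarrow> complex \<Rightarrow> (complex \<Rightarrow> complex) \<Rightarrow> bool" where
  "polyb d c f \<longleftrightarrow> (\<exists>p. degree p \<le> d \<and> coeff p d = c \<and> f = poly p)"

lemma polyb_const: "polyb 0 c (\<lambda>_. c)"
  unfolding polyb_def by (rule exI[of _ "[:c:]"]) auto

lemma polyb_linear: "polyb 1 a (\<lambda>z. a * z + b)"
  unfolding polyb_def by (rule exI[of _ "[:b, a:]"]) (auto simp: algebra_simps)

lemma polyb_mult:
  assumes "polyb d c f" "polyb e c' g"
  shows "polyb (d + e) (c * c') (\<lambda>z. f z * g z)"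
proof -
  obtain p r where p: "degree p \<le> d" "coeff p d = c" "f = poly p"
    and r: "degree r \<le> e" "coeff r e = c'" "g = poly r"
    using assms unfolding polyb_def by blast
  have "coeff (p * r) (d + e) = c * c'"
  proof (cases "degree p = d \<and> degree r = e")
    case True
    then show ?thesis using coeff_mult_degree_sum[of p r] p r by simp
  next
    case False
    then have "degree p + degree r < d + e" using p r by linarith
    then have "degree (p * r) < d + e" using degree_mult_le[of p r] by linarith
    moreover have "c * c' = 0" using False p r by (auto simp: coeff_eq_0)
    ultimately show ?thesis by (simp add: coeff_eq_0)
  qed
  moreover have "degree (p * r) \<le> d + e" using degree_mult_le[of p r] p r by linarith
  ultimately show ?thesis unfolding polyb_def using p r by (intro exI[of _ "p * r"]) auto
qed

lemma polyb_add:
  assumes "polyb d c f" "polyb d c' g"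
  shows "polyb d (c + c') (\<lambda>z. f z + g z)"
proof -
  obtain p r where p: "degree p \<le> d" "coeff p d = c" "f = poly p"
    and r: "degree r \<le> d" "coeff r d = c'" "g = poly r"
    using assms unfolding polyb_def by blast
  show ?thesis unfolding polyb_def using p r
    by (intro exI[of _ "p + r"]) (auto intro: degree_add_le)
qed

lemma polyb_weaken:
  assumes "polyb d c f" "d < e"
  shows "polyb e 0 f"
proof -
  obtain p where "degree p \<le> d" "f = poly p" using assms unfolding polyb_def by blast
  then show ?thesis unfolding polyb_def using assms(2)
    by (intro exI[of _ p]) (auto simp: coeff_eq_0)
qed

lemma polyb_lower:
  assumes "polyb (Suc d) 0 f"
  obtains c where "polyb d c f"
proof -
  obtain p where p: "degree p \<le> Suc d" "coeff p (Suc d) = 0" "f = poly p"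
    using assms unfolding polyb_def by blast
  have "degree p \<le> d"
    using p by (metis le_Suc_eq leading_coeff_0_iff degree_0 le0)
  then show ?thesis using that p unfolding polyb_def by blast
qed

lemma polyb_sum:
  assumes "\<And>i. i \<in> X \<Longrightarrow> polyb d (c i) (f i)"
  shows "polyb d (\<Sum>i\<in>X. c i) (\<lambda>z. \<Sum>i\<in>X. f i z)"
  using assms
proof (induction X rule: infinite_finite_induct)
  case (insert x F)
  then show ?case using polyb_add[of d "c x" "f x"] by simp
qed (use polyb_const[of 0] in \<open>cases d; auto intro: polyb_weaken\<close>)+

lemma polyb_prod:
  assumes "finite X" "\<And>i. i \<in> X \<Longrightarrow> polyb 1 (c i) (f i)"
  shows "polyb (card X) (\<Prod>i\<in>X. c i) (\<lambda>z. \<Prod>i\<in>X. f i z)"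
  using assms
proof (induction X rule: finite_induct)
  case (insert x F)
  then show ?case using polyb_mult[of 1 "c x" "f x" "card F"] by simp
qed (use polyb_const[of 1] in simp)

lemma polyb_eq_zero:
  assumes "polyb d c f" "finite X" "card X > d" "\<And>x. x \<in> X \<Longrightarrow> f x = 0"
  shows "f z = 0"
proof -
  obtain p where p: "degree p \<le> d" "f = poly p"
    using assms unfolding polyb_def by blast
  have "p = 0"
  proof (rule ccontr)
    assume "p \<noteq> 0"
    then have "finite {x. poly p x = 0}" "card {x. poly p x = 0} \<le> degree p"
      using poly_roots_finite card_poly_roots_bound by auto
    moreover have "X \<subseteq> {x. poly p x = 0}" using assms p by auto
    ultimately have "card X \<le> degree p" using card_mono order.trans by metis
    then show False using assms p by linarith
  qed
  then show ?thesis using p by simp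
qed

lemma polyb_prod_linear:
  assumes "finite X"
  shows "polyb (card X) (\<Prod>i\<in>X. a i) (\<lambda>z. \<Prod>i\<in>X. a i * z + b i)"
  by (rule polyb_prod[OF assms polyb_linear])

text \<open>The top coefficient matters only for the cancellation in \<open>Rnum_polyb\<close>; all
  other degree counts forget it.\<close>

definition polyd :: "nat \<Rightarrow> (complex \<Rightarrow> complex) \<Rightarrow> bool" where
  "polyd d f \<longleftrightarrow> (\<exists>c. polyb d c f)"

lemma polyd_const: "polyd 0 (\<lambda>_. c)"
  unfolding polyd_def using polyb_const by blast

lemma polyd_mult: "polyd d f \<Longrightarrow> polyd e g \<Longrightarrow> polyd (d + e) (\<lambda>z. f z * g z)"
  unfolding polyd_def using polyb_mult by blast

lemma polyd_cmult: "polyd d f \<Longrightarrow> polyd d (\<lambda>z. c * f z)"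
  using polyd_mult[OF polyd_const, of d f c] by simp

lemma polyd_add: "polyd d f \<Longrightarrow> polyd d g \<Longrightarrow> polyd d (\<lambda>z. f z + g z)"
  unfolding polyd_def using polyb_add by blast

lemma polyd_zero: "polyd d (\<lambda>_. 0)"
  unfolding polyd_def polyb_def by (rule exI[of _ 0], rule exI[of _ 0]) auto

lemma polyd_if: "(P \<Longrightarrow> polyd d f) \<Longrightarrow> polyd d (\<lambda>z. if P then f z else 0)"
  using polyd_zero by (cases P) auto

lemma polyd_sum: "(\<And>i. i \<in> X \<Longrightarrow> polyd d (f i)) \<Longrightarrow> polyd d (\<lambda>z. \<Sum>i\<in>X. f i z)"
  by (induction X rule: infinite_finite_induct) (auto intro: polyd_add simp: polyd_zero)

lemma polyd_linear: "polyd 1 (\<lambda>z. a * z + b)"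
  unfolding polyd_def using polyb_linear by blast

lemma polyd_prod_linear: "finite X \<Longrightarrow> polyd (card X) (\<lambda>z. \<Prod>i\<in>X. a i * z + b i)"
  unfolding polyd_def using polyb_prod_linear by blast

subsection \<open>The subset expansion of the determinant\<close>

text \<open>The part of the symmetrizing product that couples two blocks of variables. It has two
  sources: splitting a symmetrization into blocks (\<open>symm_append\<close>), and the quotient of
  Vandermonde products when some variables are multiplied by \<open>q\<close>
  (\<open>vandermonde_ratio\<close>). This common form makes the sums over subsets comparable with a
  determinant.\<close>

definition cross :: "complex \<Rightarrow> ('i \<Rightarrow> complex) \<Rightarrow> 'i set \<Rightarrow> 'i set \<Rightarrow> complex" where
  "cross q u X Y = (\<Prod>i\<in>X. \<Prod>j\<in>Y. (u i - q * u j) / (u i - u j))"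

definition ratio :: "complex \<Rightarrow> complex \<Rightarrow> complex \<Rightarrow> complex" where
  "ratio q x y = (1 - q * x * y) / (1 - x * y)"

text \<open>
  The row expansion of the determinant with entries \<open>a i / (1 - u i * v j) + b i / (1 - q * u i * v j)\<close>,
  normalized as in \<open>det_eq_Rsum\<close>; \<open>K\<close> is the set of rows from which the first summand is taken.
\<close>

definition Rsum :: "complex \<Rightarrow> ('i \<Rightarrow> complex) \<Rightarrow> ('j \<Rightarrow> complex) \<Rightarrow> ('i \<Rightarrow> complex) \<Rightarrow> ('i \<Rightarrow> complex)
    \<Rightarrow> 'i set \<Rightarrow> 'j set \<Rightarrow> complex" where
  "Rsum q u v a b A B = (\<Sum>K\<in>Pow A. cross q u K (A - K) * (\<Prod>i\<in>K. a i) * (\<Prod>i\<in>A - K. b i) *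
     q ^ (card (A - K) choose 2) * (\<Prod>i\<in>K. \<Prod>j\<in>B. ratio q (u i) (v j)))"

text \<open>
  \<open>Rsum\<close> over \<open>insert k A\<close> with its denominators in \<open>z = u k\<close> cleared, where \<open>\<alpha>\<close>, \<open>\<beta>\<close> stand for
  \<open>a k\<close>, \<open>b k\<close>; see \<open>Rsum_insert\<close>.
\<close>

definition Rnum :: "complex \<Rightarrow> ('i \<Rightarrow> complex) \<Rightarrow> ('j \<Rightarrow> complex) \<Rightarrow> ('i \<Rightarrow> complex) \<Rightarrow> ('i \<Rightarrow> complex)
    \<Rightarrow> 'i set \<Rightarrow> 'j set \<Rightarrow> complex \<Rightarrow> complex \<Rightarrow> complex \<Rightarrow> complex" where
  "Rnum q u v a b A B \<alpha> \<beta> z = (\<Sum>K\<in>Pow A. cross q u K (A - K) * (\<Prod>i\<in>K. a i) * (\<Prod>i\<in>A - K. b i) *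
     q ^ (card (A - K) choose 2) * (\<Prod>i\<in>K. \<Prod>j\<in>B. ratio q (u i) (v j)) *
     (\<alpha> * ((\<Prod>i\<in>A - K. z - q * u i) * (\<Prod>i\<in>K. z - u i) * (\<Prod>j\<in>B. 1 - q * z * v j)) +
      \<beta> * (q ^ card (A - K) * (\<Prod>i\<in>K. q * z - u i) * (\<Prod>i\<in>A - K. z - u i) * (\<Prod>j\<in>B. 1 - z * v j))))"

lemma sum_Pow_insert:
  assumes "finite A" "k \<notin> A"
  shows "(\<Sum>K\<in>Pow (insert k A). f K) = (\<Sum>K\<in>Pow A. f (insert k K) + f K)"
proof -
  have inj: "inj_on (insert k) (Pow A)"
    using assms(2) by (auto simp: inj_on_def)
  have "(\<Sum>K\<in>Pow (insert k A). f K) = (\<Sum>K\<in>Pow A. f K) + (\<Sum>K\<in>insert k ` Pow A. f K)"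
    unfolding Pow_insert using assms by (intro sum.union_disjoint) auto
  also have "(\<Sum>K\<in>insert k ` Pow A. f K) = (\<Sum>K\<in>Pow A. f (insert k K))"
    using inj by (simp add: sum.reindex)
  finally show ?thesis by (simp add: sum.distrib add.commute)
qed

lemma cross_insert_left:
  assumes "finite X" "k \<notin> X"
  shows "cross q u (insert k X) Y = (\<Prod>j\<in>Y. u k - q * u j) / (\<Prod>j\<in>Y. u k - u j) * cross q u X Y"
  unfolding cross_def using assms by (simp add: prod_dividef)

lemma cross_insert_right:
  assumes "finite Y" "k \<notin> Y"
  shows "cross q u X (insert k Y) = (\<Prod>i\<in>X. q * u k - u i) / (\<Prod>i\<in>X. u k - u i) * cross q u X Y"
proof -
  have *: "(u i - q * u k) / (u i - u k) = (q * u k - u i) / (u k - u i)" for i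
    by (metis minus_diff_eq minus_divide_divide)
  show ?thesis
    unfolding cross_def prod.insert[OF assms] prod.distrib * by (simp add: prod_dividef)
qed

lemma prod_ratio: "(\<Prod>j\<in>B. ratio q x (v j)) = (\<Prod>j\<in>B. 1 - q * x * v j) / (\<Prod>j\<in>B. 1 - x * v j)"
  unfolding ratio_def by (simp add: prod_dividef)

lemma insert_Diff_insert:
  assumes "k \<notin> A" "K \<subseteq> A"
  shows "insert k A - insert k K = A - K" "insert k A - K = insert k (A - K)"
  using assms by auto

lemma Suc_choose_two: "Suc n choose 2 = n + (n choose 2)"
  by (simp add: numeral_2_eq_2)

lemma zero_choose_two [simp]: "(0 :: nat) choose 2 = 0"
  by (simp add: numeral_2_eq_2)

lemma Rsum_insert:
  assumes fin: "finite A" and k: "k \<notin> A"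
    and u: "\<And>i. i \<in> A \<Longrightarrow> u i \<noteq> u k" and v: "\<And>j. j \<in> B \<Longrightarrow> 1 - u k * v j \<noteq> 0"
  shows "Rsum q u v a b (insert k A) B * ((\<Prod>i\<in>A. u k - u i) * (\<Prod>j\<in>B. 1 - u k * v j)) =
    Rnum q u v a b A B (a k) (b k) (u k)"
  unfolding Rsum_def Rnum_def sum_Pow_insert[OF fin k] sum_distrib_right
proof (rule sum.cong[OF refl], goal_cases)
  case (1 K)
  then have K: "K \<subseteq> A" and finK: "finite K" and kK: "k \<notin> K" "k \<notin> A - K"
    using fin k by (auto intro: finite_subset)
  have finC: "finite (A - K)" using fin by simp
  have nK: "(\<Prod>i\<in>K. u k - u i) \<noteq> 0" using u K finK by (fastforce simp: prod_zero_iff)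
  have nC: "(\<Prod>i\<in>A - K. u k - u i) \<noteq> 0" using u finC by (fastforce simp: prod_zero_iff)
  have nB: "(\<Prod>j\<in>B. 1 - u k * v j) \<noteq> 0"
    using v by (cases "finite B") (auto simp: prod_zero_iff)
  have PA: "(\<Prod>i\<in>A. u k - u i) = (\<Prod>i\<in>A - K. u k - u i) * (\<Prod>i\<in>K. u k - u i)"
    by (rule prod.subset_diff[OF K fin])
  show ?case
    unfolding insert_Diff_insert[OF k K] PA prod.insert[OF finK kK(1)] prod.insert[OF finC kK(2)]
      card_insert_disjoint[OF finC kK(2)] Suc_choose_two power_add
      cross_insert_left[OF finK kK(1)] cross_insert_right[OF finC kK(2)] prod_ratio[of q "u k"]
    using nK nC nB by (simp add: field_simps)
qed

text \<open>The leading coefficients cancel because \<open>card B = Suc (card A)\<close>.\<close>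

lemma Rnum_polyb:
  assumes fin: "finite A" "finite B" and card: "card B = Suc (card A)"
    and p: "polyb d c p" and r: "polyb d (- q * c) r"
  obtains c' where "polyb (d + 2 * card A) c' (\<lambda>z. Rnum q u v a b A B (p z) (r z) z)"
proof -
  have "polyb (d + (card A + card B)) (\<Sum>K\<in>Pow A. 0) (\<lambda>z. Rnum q u v a b A B (p z) (r z) z)"
    unfolding Rnum_def
  proof (rule polyb_sum, goal_cases)
    case (1 K)
    then have K: "K \<subseteq> A" and finK: "finite K" using fin by (auto intro: finite_subset)
    have finC: "finite (A - K)" using fin by simp
    have cA: "card (A - K) + card K = card A"
      using K fin finK by (simp add: card_Diff_subset card_mono)
    define W where "W = cross q u K (A - K) * prod a K * prod b (A - K) * q ^ (card (A - K) choose 2) *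
      (\<Prod>i\<in>K. \<Prod>j\<in>B. ratio q (u i) (v j))"
    have 1: "polyb (card (A - K)) 1 (\<lambda>z. \<Prod>i\<in>A - K. z - q * u i)"
      using polyb_prod_linear[OF finC, of "\<lambda>_. 1" "\<lambda>i. - q * u i"] by simp
    have 2: "polyb (card K) 1 (\<lambda>z. \<Prod>i\<in>K. z - u i)"
      using polyb_prod_linear[OF finK, of "\<lambda>_. 1" "\<lambda>i. - u i"] by simp
    have 3: "polyb (card B) (q ^ card B * (\<Prod>j\<in>B. - v j)) (\<lambda>z. \<Prod>j\<in>B. 1 - q * z * v j)"
      using polyb_prod_linear[OF fin(2), of "\<lambda>j. q * - v j" "\<lambda>i. 1"]
      unfolding prod.distrib prod_constant by (simp add: algebra_simps)
    have 4: "polyb (card K) (q ^ card K) (\<lambda>z. \<Prod>i\<in>K. q * z - u i)"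
      using polyb_prod_linear[OF finK, of "\<lambda>_. q" "\<lambda>i. - u i"] by simp
    have 5: "polyb (card (A - K)) 1 (\<lambda>z. \<Prod>i\<in>A - K. z - u i)"
      using polyb_prod_linear[OF finC, of "\<lambda>_. 1" "\<lambda>i. - u i"] by simp
    have 6: "polyb (card B) (\<Prod>j\<in>B. - v j) (\<lambda>z. \<Prod>j\<in>B. 1 - z * v j)"
      using polyb_prod_linear[OF fin(2), of "\<lambda>j. - v j" "\<lambda>i. 1"] by (simp add: algebra_simps)
    let ?f = "\<lambda>z. p z * ((\<Prod>i\<in>A - K. z - q * u i) * (\<Prod>i\<in>K. z - u i) * (\<Prod>j\<in>B. 1 - q * z * v j))"
    let ?g = "\<lambda>z. r z * (q ^ card (A - K) * (\<Prod>i\<in>K. q * z - u i) * (\<Prod>i\<in>A - K. z - u i) * (\<Prod>j\<in>B. 1 - z * v j))"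
    let ?cf = "c * (1 * 1 * (q ^ card B * (\<Prod>j\<in>B. - v j)))"
    let ?cg = "- q * c * (q ^ card (A - K) * q ^ card K * 1 * (\<Prod>j\<in>B. - v j))"
    have "polyb (d + (card (A - K) + card K + card B)) ?cf ?f"
      by (intro polyb_mult p 1 2 3)
    moreover have "polyb (d + (0 + card K + card (A - K) + card B)) ?cg ?g"
      by (intro polyb_mult r polyb_const 4 5 6)
    moreover have "d + (card (A - K) + card K + card B) = d + (card A + card B)"
      "d + (0 + card K + card (A - K) + card B) = d + (card A + card B)" using cA by auto
    ultimately have "polyb (d + (card A + card B)) (?cf + ?cg) (\<lambda>z. ?f z + ?g z)"
      by (intro polyb_add) (simp_all only:)
    from polyb_mult[OF polyb_const[of W] this]
    have "polyb (d + (card A + card B)) (W * (?cf + ?cg)) (\<lambda>z. W * (?f z + ?g z))"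
      by (simp only: add_0)
    moreover have "q ^ card B = q * (q ^ card (A - K) * q ^ card K)"
      unfolding card cA[symmetric] by (simp add: power_add)
    ultimately show ?case
      unfolding W_def[symmetric] by (simp add: algebra_simps)
  qed
  then have "polyb (Suc (d + 2 * card A)) 0 (\<lambda>z. Rnum q u v a b A B (p z) (r z) z)"
    by (simp add: card mult_2)
  then show ?thesis using polyb_lower that by blast
qed

text \<open>The terms of \<open>K\<close> and \<open>insert i K\<close> cancel.\<close>

lemma Rnum_at_node:
  assumes fin: "finite A" and i: "i \<in> A" and inj: "inj_on u A"
    and v: "\<And>j. j \<in> B \<Longrightarrow> 1 - u i * v j \<noteq> 0" and ab: "\<alpha> * b i = \<beta> * a i"
  shows "Rnum q u v a b A B \<alpha> \<beta> (u i) = 0"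
proof -
  define A' where "A' = A - {i}"
  have A: "A = insert i A'" and iA: "i \<notin> A'" and fin': "finite A'"
    using i fin by (auto simp: A'_def)
  have ne: "u i \<noteq> u j" if "j \<in> A'" for j
    using inj that iA unfolding A inj_on_def by auto
  show ?thesis
    unfolding A Rnum_def sum_Pow_insert[OF fin' iA]
  proof (rule sum.neutral, rule ballI, goal_cases)
    case (1 K)
    then have K: "K \<subseteq> A'" and finK: "finite K" and kK: "i \<notin> K" "i \<notin> A' - K"
      using fin' iA by (auto intro: finite_subset)
    have finC: "finite (A' - K)" using fin' by simp
    have nK: "(\<Prod>j\<in>K. u i - u j) \<noteq> 0" using ne K finK by (auto simp: prod_zero_iff)
    have nC: "(\<Prod>j\<in>A' - K. u i - u j) \<noteq> 0" using ne finC by (auto simp: prod_zero_iff)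
    have nB: "(\<Prod>j\<in>B. 1 - u i * v j) \<noteq> 0"
      using v by (cases "finite B") (auto simp: prod_zero_iff)
    define X where "X = cross q u K (A' - K) * prod a K * prod b (A' - K) *
      q ^ (card (A' - K) choose 2) * q ^ card (A' - K) * (\<Prod>i\<in>K. \<Prod>j\<in>B. ratio q (u i) (v j)) *
      (\<Prod>j\<in>K. q * u i - u j) * (\<Prod>j\<in>A' - K. u i - q * u j) * (\<Prod>j\<in>B. 1 - q * u i * v j) * (u i - q * u i)"
    define t where "t K = cross q u K (insert i A' - K) * prod a K * prod b (insert i A' - K) *
      q ^ (card (insert i A' - K) choose 2) * (\<Prod>i\<in>K. \<Prod>j\<in>B. ratio q (u i) (v j)) *
      (\<alpha> * ((\<Prod>j\<in>insert i A' - K. u i - q * u j) * (\<Prod>j\<in>K. u i - u j) * (\<Prod>j\<in>B. 1 - q * u i * v j)) +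
       \<beta> * (q ^ card (insert i A' - K) * (\<Prod>j\<in>K. q * u i - u j) * (\<Prod>j\<in>insert i A' - K. u i - u j) * (\<Prod>j\<in>B. 1 - u i * v j)))" for K
    have 1: "t (insert i K) = - (a i * \<beta>) * X"
      unfolding t_def insert_Diff_insert[OF iA K] prod.insert[OF finK kK(1)] X_def
        cross_insert_left[OF finK kK(1)] prod_ratio[of q "u i"]
      using nC nB by (simp add: field_simps)
    have 2: "t K = b i * \<alpha> * X"
      unfolding t_def insert_Diff_insert[OF iA K] prod.insert[OF finC kK(2)] X_def
        card_insert_disjoint[OF finC kK(2)] Suc_choose_two power_add cross_insert_right[OF finC kK(2)]
      using nK by (simp add: field_simps)
    have "t (insert i K) + t K = 0" unfolding 1 2 using ab by (simp add: algebra_simps)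
    then show ?case unfolding t_def .
  qed
qed

text \<open>Only the half with \<open>\<alpha>\<close> survives, the other one contains 1 - z * v l
  = 0. In it \<open>ratio q (u i) (v l)\<close> turns z - u i into z - q * u i, so the product over
  all of \<open>A\<close> comes out of the sum and \<open>Rsum\<close> with the column
  \<open>l\<close> removed remains.\<close>

lemma Rnum_at_pole:
  assumes fin: "finite A" "finite B" and l: "l \<notin> B" and z: "z * v l = 1"
    and u: "\<And>i. i \<in> A \<Longrightarrow> u i \<noteq> z"
  shows "Rnum q u v a b A (insert l B) \<alpha> \<beta> z =
    \<alpha> * (1 - q) * (\<Prod>j\<in>B. 1 - q * z * v j) * (\<Prod>i\<in>A. z - q * u i) * Rsum q u v a b A B"
  unfolding Rnum_def Rsum_def sum_distrib_left
proof (rule sum.cong[OF refl], goal_cases)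
  case (1 K)
  then have K: "K \<subseteq> A" and finK: "finite K" using fin by (auto intro: finite_subset)
  have z0: "z \<noteq> 0" using z by auto
  have vl: "v l = 1 / z" using z z0 by (simp add: field_simps)
  have "ratio q (u i) (v l) * (z - u i) = z - q * u i" if "i \<in> K" for i
  proof -
    have "z - u i \<noteq> 0" using u[of i] that K by auto
    then show ?thesis using z0 unfolding ratio_def vl by (simp add: field_simps)
  qed
  then have r: "(\<Prod>i\<in>K. ratio q (u i) (v l)) * (\<Prod>i\<in>K. z - u i) = (\<Prod>i\<in>K. z - q * u i)"
    unfolding prod.distrib[symmetric] by (intro prod.cong) auto
  have PA: "(\<Prod>i\<in>A. z - q * u i) = (\<Prod>i\<in>A - K. z - q * u i) * ((\<Prod>i\<in>K. ratio q (u i) (v l)) * (\<Prod>i\<in>K. z - u i))"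
    unfolding r by (rule prod.subset_diff[OF K fin(1)])
  have 1: "(1 - q * z * v l) = 1 - q" "1 - z * v l = 0" using z by (simp_all add: mult.assoc)
  show ?case
    unfolding prod.insert[OF fin(2) l] prod.distrib PA 1 by (simp add: mult_ac)
qed

text \<open>At 0 the products next to \<open>\<alpha>\<close> and \<open>\<beta>\<close> both equal
  \<open>q ^ card (A - K)\<close> times the product of all - u i, so they cancel for each
  \<open>K\<close> separately. This disposes of the poles of \<open>acoef\<close> and
  \<open>bcoef\<close> at 0, whose residues are opposite.\<close>

lemma Rnum_at_zero: "finite A \<Longrightarrow> Rnum q u v a b A B \<alpha> (- \<alpha>) 0 = 0"
proof -
  have "(\<Prod>i\<in>X. - (q * u i)) = q ^ card X * (\<Prod>i\<in>X. - u i)" for X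
    unfolding mult_minus_right[symmetric] prod.distrib prod_constant ..
  then show ?thesis
    unfolding Rnum_def by (intro sum.neutral ballI) (simp add: mult_ac del: prod_uminus)
qed

section \<open>The sum over pairs of subsets\<close>

text \<open>By (1 - q) / ((1 - x) * (1 - q * x)) = 1 / (1 - x) - q / (1 - q * x) this is the row
  expansion of the determinant at \<gamma> = 1 without its row and column factors: the
  \<open>D\<close> of the overview.\<close>

definition Dsum :: "complex \<Rightarrow> ('i \<Rightarrow> complex) \<Rightarrow> ('j \<Rightarrow> complex) \<Rightarrow> 'i set \<Rightarrow> 'j set \<Rightarrow> complex" where
  "Dsum q u v A B = Rsum q u v (\<lambda>_. 1) (\<lambda>_. - q) A B"

definition Dnum :: "complex \<Rightarrow> ('i \<Rightarrow> complex) \<Rightarrow> ('j \<Rightarrow> complex) \<Rightarrow> 'i set \<Rightarrow> 'j set \<Rightarrow> complex \<Rightarrow> complex" where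
  "Dnum q u v A B z = Rnum q u v (\<lambda>_. 1) (\<lambda>_. - q) A B 1 (- q) z"

text \<open>The \<open>E\<close> of the overview after scaling by \<xi>, without the denominators 1
  - s * u i and 1 - s * v j, which are common to all terms (\<open>sum_columns_eq_Esum\<close>). The
  argument of \<open>c\<close> is the number of zero parts.\<close>

definition Esum :: "complex \<Rightarrow> complex \<Rightarrow> (nat \<Rightarrow> complex) \<Rightarrow> ('i \<Rightarrow> complex) \<Rightarrow> ('j \<Rightarrow> complex)
    \<Rightarrow> 'i set \<Rightarrow> 'j set \<Rightarrow> complex" where
  "Esum q s c u v A B = (\<Sum>I\<in>Pow A. \<Sum>J\<in>Pow B. if card J = card I then
     c (card (A - I)) * (cross q u I (A - I) * (\<Prod>i\<in>I. u i - s)) *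
     (cross q v J (B - J) * (\<Prod>j\<in>J. v j - s)) * Dsum q u v I J else 0)"

text \<open>The analogue of \<open>Rnum\<close> for \<open>Esum\<close>. The first alternative stems
  from the sets that contain the new index, hence \<open>card J = Suc (card I)\<close>, and replaces
  \<open>Dsum\<close> by its own numerator \<open>Dnum\<close>; the second stems from the sets
  without it.\<close>

definition Enum :: "complex \<Rightarrow> complex \<Rightarrow> (nat \<Rightarrow> complex) \<Rightarrow> ('i \<Rightarrow> complex) \<Rightarrow> ('j \<Rightarrow> complex)
    \<Rightarrow> 'i set \<Rightarrow> 'j set \<Rightarrow> complex \<Rightarrow> complex" where
  "Enum q s c u v A B z = (\<Sum>I\<in>Pow A. \<Sum>J\<in>Pow B.
     (cross q u I (A - I) * (\<Prod>i\<in>I. u i - s)) * (cross q v J (B - J) * (\<Prod>j\<in>J. v j - s)) *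
     ((if card J = Suc (card I) then c (card (A - I)) * ((z - s) * (\<Prod>i\<in>A - I. z - q * u i) *
         Dnum q u v I J z * (\<Prod>j\<in>B - J. 1 - z * v j)) else 0) +
      (if card J = card I then c (Suc (card (A - I))) * ((\<Prod>i\<in>I. q * z - u i) * (\<Prod>i\<in>A - I. z - u i) *
         (\<Prod>j\<in>B. 1 - z * v j) * Dsum q u v I J) else 0)))"

lemma Esum_insert:
  assumes fin: "finite A" "finite B" and k: "k \<notin> A"
    and u: "\<And>i. i \<in> A \<Longrightarrow> u i \<noteq> u k" and v: "\<And>j. j \<in> B \<Longrightarrow> 1 - u k * v j \<noteq> 0"
  shows "Esum q s c u v (insert k A) B * ((\<Prod>i\<in>A. u k - u i) * (\<Prod>j\<in>B. 1 - u k * v j)) =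
    Enum q s c u v A B (u k)"
  unfolding Esum_def Enum_def sum_Pow_insert[OF fin(1) k] sum.distrib[symmetric] sum_distrib_right
proof (intro sum.cong refl, goal_cases)
  case (1 I J)
  then have I: "I \<subseteq> A" and finI: "finite I" and kI: "k \<notin> I" "k \<notin> A - I" and J: "J \<subseteq> B" and finJ: "finite J"
    using fin k by (auto intro: finite_subset)
  have finC: "finite (A - I)" using fin by simp
  have nI: "(\<Prod>i\<in>I. u k - u i) \<noteq> 0" using u I finI by (fastforce simp: prod_zero_iff)
  have nC: "(\<Prod>i\<in>A - I. u k - u i) \<noteq> 0" using u finC by (fastforce simp: prod_zero_iff)
  have PA: "(\<Prod>i\<in>A. u k - u i) = (\<Prod>i\<in>A - I. u k - u i) * (\<Prod>i\<in>I. u k - u i)"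
    by (rule prod.subset_diff[OF I fin(1)])
  have PB: "(\<Prod>j\<in>B. 1 - u k * v j) = (\<Prod>j\<in>B - J. 1 - u k * v j) * (\<Prod>j\<in>J. 1 - u k * v j)"
    by (rule prod.subset_diff[OF J fin(2)])
  define PI where "PI = (\<Prod>i\<in>I. u k - u i)"
  define PC where "PC = (\<Prod>i\<in>A - I. u k - u i)"
  define B1 where "B1 = (\<Prod>j\<in>B - J. 1 - u k * v j)"
  define B2 where "B2 = (\<Prod>j\<in>J. 1 - u k * v j)"
  define NC where "NC = (\<Prod>i\<in>A - I. u k - q * u i)"
  define NI where "NI = (\<Prod>i\<in>I. q * u k - u i)"
  have D: "Dnum q u v I J (u k) = Dsum q u v (insert k I) J * (PI * B2)"
    unfolding Dnum_def Dsum_def PI_def B2_def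
    by (rule Rsum_insert[symmetric]) (use finI kI u v I J in auto)
  show ?case
    unfolding insert_Diff_insert[OF k I] PA PB prod.insert[OF finI kI(1)] D
      card_insert_disjoint[OF finC kI(2)] card_insert_disjoint[OF finI kI(1)]
      cross_insert_left[OF finI kI(1)] cross_insert_right[OF finC kI(2)]
      PI_def[symmetric] PC_def[symmetric] B1_def[symmetric] B2_def[symmetric] NC_def[symmetric] NI_def[symmetric]
    using nI nC unfolding PI_def[symmetric] PC_def[symmetric] by simp
qed

text \<open>The bound is the degree of the cleared denominators, so \<open>Esum\<close> stays
  bounded at infinity in each variable. The count closes because the degree of \<open>Dnum\<close>
  is at most \<open>2 * card I\<close>, owing to the cancellation in
  \<open>Rnum_polyb\<close>.\<close>

lemma Enum_polyd:
  assumes fin: "finite A" "finite B" and card: "card B = Suc (card A)"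
  shows "polyd (2 * card A + 1) (\<lambda>z. Enum q s c u v A B z)"
  unfolding Enum_def
proof (intro polyd_sum, goal_cases)
  case (1 I J)
  then have I: "I \<subseteq> A" and finI: "finite I" and J: "J \<subseteq> B" and finJ: "finite J"
    using fin by (auto intro: finite_subset)
  have finC: "finite (A - I)" "finite (B - J)" using fin by auto
  have cA: "card (A - I) + card I = card A" using I fin finI by (simp add: card_Diff_subset card_mono)
  have cB: "card (B - J) + card J = card B" using J fin finJ by (simp add: card_Diff_subset card_mono)
  have F: "polyd (2 * card A + 1) (\<lambda>z. c (card (A - I)) * ((z - s) * (\<Prod>i\<in>A - I. z - q * u i) *
         Dnum q u v I J z * (\<Prod>j\<in>B - J. 1 - z * v j)))" if "card J = Suc (card I)"
  proof -
    have "polyd (2 * card I) (Dnum q u v I J)"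
      using Rnum_polyb[OF finI finJ that polyb_const[of 1], of "q" "\<lambda>_. - q" u v "\<lambda>_. 1" "\<lambda>_. - q"] polyb_const[of "- q"]
      unfolding polyd_def Dnum_def by auto
    moreover have "polyd 1 (\<lambda>z. z - s)" using polyd_linear[of 1 "- s"] by simp
    moreover have "polyd (card (A - I)) (\<lambda>z. \<Prod>i\<in>A - I. z - q * u i)"
      using polyd_prod_linear[OF finC(1), of "\<lambda>_. 1" "\<lambda>i. - q * u i"] by simp
    moreover have "polyd (card (B - J)) (\<lambda>z. \<Prod>j\<in>B - J. 1 - z * v j)"
      using polyd_prod_linear[OF finC(2), of "\<lambda>j. - v j" "\<lambda>i. 1"] by (simp add: algebra_simps)
    ultimately have "polyd (0 + (1 + card (A - I) + 2 * card I + card (B - J)))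
      (\<lambda>z. c (card (A - I)) * ((z - s) * (\<Prod>i\<in>A - I. z - q * u i) *
         Dnum q u v I J z * (\<Prod>j\<in>B - J. 1 - z * v j)))"
      by (intro polyd_mult polyd_const)
    moreover have "0 + (1 + card (A - I) + 2 * card I + card (B - J)) = 2 * card A + 1"
      using cA cB that card by linarith
    ultimately show ?thesis by (simp only:)
  qed
  have G: "polyd (2 * card A + 1) (\<lambda>z. c (Suc (card (A - I))) * ((\<Prod>i\<in>I. q * z - u i) * (\<Prod>i\<in>A - I. z - u i) *
         (\<Prod>j\<in>B. 1 - z * v j) * Dsum q u v I J))"
  proof -
    have "polyd (card I) (\<lambda>z. \<Prod>i\<in>I. q * z - u i)"
      using polyd_prod_linear[OF finI, of "\<lambda>_. q" "\<lambda>i. - u i"] by simp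
    moreover have "polyd (card (A - I)) (\<lambda>z. \<Prod>i\<in>A - I. z - u i)"
      using polyd_prod_linear[OF finC(1), of "\<lambda>_. 1" "\<lambda>i. - u i"] by simp
    moreover have "polyd (card B) (\<lambda>z. \<Prod>j\<in>B. 1 - z * v j)"
      using polyd_prod_linear[OF fin(2), of "\<lambda>j. - v j" "\<lambda>i. 1"] by (simp add: algebra_simps)
    ultimately have "polyd (0 + (card I + card (A - I) + card B + 0))
      (\<lambda>z. c (Suc (card (A - I))) * ((\<Prod>i\<in>I. q * z - u i) * (\<Prod>i\<in>A - I. z - u i) *
         (\<Prod>j\<in>B. 1 - z * v j) * Dsum q u v I J))"
      by (intro polyd_mult polyd_const)
    moreover have "0 + (card I + card (A - I) + card B + 0) = 2 * card A + 1"
      using cA card by linarith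
    ultimately show ?thesis by (simp only:)
  qed
  show ?case
    by (rule polyd_cmult, rule polyd_add; rule polyd_if; (erule F | rule G))
qed

text \<open>Let z be the value at the new index k. Sets containing both i and k contribute 0 because
  \<open>Dnum\<close> vanishes there (\<open>Rnum_at_node\<close>), sets containing neither because
  of a factor z - u i. Those containing exactly one of them cancel in pairs when i and k are
  exchanged.\<close>

lemma Enum_at_node:
  assumes fin: "finite A" "finite B" and i: "i \<in> A" and inj: "inj_on u A"
    and v: "\<And>j. j \<in> B \<Longrightarrow> 1 - u i * v j \<noteq> 0"
  shows "Enum q s c u v A B (u i) = 0"
proof -
  define A' where "A' = A - {i}"
  have A: "A = insert i A'" and iA: "i \<notin> A'" and fin': "finite A'"
    using i fin by (auto simp: A'_def)
  have ne: "u j \<noteq> u i" if "j \<in> A'" for j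
    using inj that iA unfolding A inj_on_def by auto
  show ?thesis
    unfolding A Enum_def sum_Pow_insert[OF fin' iA] sum.distrib[symmetric]
  proof (intro sum.neutral ballI, goal_cases)
    case (1 I J)
    then have I: "I \<subseteq> A'" and finI: "finite I" and kI: "i \<notin> I" "i \<notin> A' - I" and J: "J \<subseteq> B" and finJ: "finite J"
      using fin fin' iA by (auto intro: finite_subset)
    have finC: "finite (A' - I)" using fin' by simp
    have nI: "(\<Prod>j\<in>I. u i - u j) \<noteq> 0" using ne I finI by (fastforce simp: prod_zero_iff)
    have nC: "(\<Prod>j\<in>A' - I. u i - u j) \<noteq> 0" using ne finC by (fastforce simp: prod_zero_iff)
    have D0: "Dnum q u v (insert i I) J (u i) = 0"
      unfolding Dnum_def
      by (rule Rnum_at_node) (use finI v J I inj in \<open>auto simp: A intro: inj_on_subset\<close>)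
    have D: "Dnum q u v I J (u i) = Dsum q u v (insert i I) J * ((\<Prod>j\<in>I. u i - u j) * (\<Prod>j\<in>J. 1 - u i * v j))"
      unfolding Dnum_def Dsum_def
      by (rule Rsum_insert[symmetric]) (use finI kI ne v I J in auto)
    have PB: "(\<Prod>j\<in>B. 1 - u i * v j) = (\<Prod>j\<in>B - J. 1 - u i * v j) * (\<Prod>j\<in>J. 1 - u i * v j)"
      by (rule prod.subset_diff[OF J fin(2)])
    show ?case
      unfolding insert_Diff_insert[OF iA I] prod.insert[OF finI kI(1)] prod.insert[OF finC kI(2)] D0 D PB
        card_insert_disjoint[OF finC kI(2)] card_insert_disjoint[OF finI kI(1)]
        cross_insert_left[OF finI kI(1)] cross_insert_right[OF finC kI(2)]
      using nI nC by (simp add: field_simps)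
  qed
qed

text \<open>Every term whose row set omits the new index or whose column set omits \<open>l\<close>
  contains 1 - z * v l = 0. In the others \<open>Dnum\<close> reduces by
  \<open>Rnum_at_pole\<close>, and the cross factors of \<open>l\<close> turn 1 - z * v j into 1 - q
  * z * v j for the j left out, which completes the product over \<open>B\<close>.\<close>

lemma Enum_at_pole:
  assumes fin: "finite A" "finite B" and l: "l \<notin> B" and z: "z * v l = 1"
    and u: "\<And>i. i \<in> A \<Longrightarrow> u i \<noteq> z" and v: "\<And>j. j \<in> B \<Longrightarrow> v j \<noteq> v l"
  shows "Enum q s c u v A (insert l B) z =
    (1 - q) * (z - s) * (v l - s) * (\<Prod>j\<in>B. 1 - q * z * v j) * (\<Prod>i\<in>A. z - q * u i) * Esum q s c u v A B"
  unfolding Enum_def Esum_def sum_Pow_insert[OF fin(2) l] sum_distrib_left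
proof (intro sum.cong refl, goal_cases)
  case (1 I J)
  then have I: "I \<subseteq> A" and finI: "finite I" and J: "J \<subseteq> B" and finJ: "finite J" and kJ: "l \<notin> J" "l \<notin> B - J"
    using fin l by (auto intro: finite_subset)
  have finC: "finite (B - J)" using fin by simp
  have z0: "z \<noteq> 0" using z by auto
  have "(v l - q * v j) / (v l - v j) * (1 - z * v j) = 1 - q * z * v j" if "j \<in> B - J" for j
  proof -
    have "v l - v j \<noteq> 0" using v[of j] that by auto
    moreover have "1 - z * v j = z * (v l - v j)" "1 - q * z * v j = z * (v l - q * v j)"
      using z by (auto simp: algebra_simps)
    ultimately show ?thesis by simp
  qed
  then have "(\<Prod>j\<in>B - J. (v l - q * v j) / (v l - v j)) * (\<Prod>j\<in>B - J. 1 - z * v j) = (\<Prod>j\<in>B - J. 1 - q * z * v j)"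
    unfolding prod.distrib[symmetric] by (intro prod.cong) auto
  then have r: "(\<Prod>j\<in>B - J. v l - q * v j) / (\<Prod>j\<in>B - J. v l - v j) * (\<Prod>j\<in>B - J. 1 - z * v j) = (\<Prod>j\<in>B - J. 1 - q * z * v j)"
    by (simp add: prod_dividef)
  have PB: "(\<Prod>j\<in>B. 1 - q * z * v j) = ((\<Prod>j\<in>B - J. v l - q * v j) / (\<Prod>j\<in>B - J. v l - v j) * (\<Prod>j\<in>B - J. 1 - z * v j)) * (\<Prod>j\<in>J. 1 - q * z * v j)"
    unfolding r by (rule prod.subset_diff[OF J fin(2)])
  have PA: "(\<Prod>i\<in>A. z - q * u i) = (\<Prod>i\<in>A - I. z - q * u i) * (\<Prod>i\<in>I. z - q * u i)"
    by (rule prod.subset_diff[OF I fin(1)])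
  have D: "Dnum q u v I (insert l J) z =
    1 * (1 - q) * (\<Prod>j\<in>J. 1 - q * z * v j) * (\<Prod>i\<in>I. z - q * u i) * Dsum q u v I J"
    unfolding Dnum_def Dsum_def by (rule Rnum_at_pole) (use finI finJ kJ z u I in auto)
  have 1: "1 - z * v l = 0" using z by simp
  show ?case
    unfolding insert_Diff_insert[OF l J] prod.insert[OF finJ kJ(1)] prod.insert[OF finC kJ(2)] prod.insert[OF fin(2) l]
      D 1 PB PA card_insert_disjoint[OF finJ kJ(1)] cross_insert_left[OF finJ kJ(1)]
    by simp
qed

section \<open>Dependence on the row variables in the index set only\<close>

lemma cross_cong:
  assumes "\<And>i. i \<in> X \<union> Y \<Longrightarrow> u i = w i"
  shows "cross q u X Y = cross q w X Y"
  unfolding cross_def using assms by (intro prod.cong refl) auto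

lemma Rsum_cong:
  assumes "\<And>i. i \<in> A \<Longrightarrow> u i = w i" "\<And>i. i \<in> A \<Longrightarrow> a i = a' i" "\<And>i. i \<in> A \<Longrightarrow> b i = b' i"
  shows "Rsum q u v a b A B = Rsum q w v a' b' A B"
  unfolding Rsum_def
proof (rule sum.cong[OF refl], goal_cases)
  case (1 K)
  then have K: "K \<subseteq> A" by auto
  have "cross q u K (A - K) = cross q w K (A - K)" by (rule cross_cong) (use K assms in auto)
  moreover have "prod a K = prod a' K" "prod b (A - K) = prod b' (A - K)"
    by (rule prod.cong; use K assms in auto)+
  moreover have "(\<Prod>i\<in>K. \<Prod>j\<in>B. ratio q (u i) (v j)) = (\<Prod>i\<in>K. \<Prod>j\<in>B. ratio q (w i) (v j))"
    by (rule prod.cong; use K assms in auto)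
  ultimately show ?case
    by simp
qed

lemma Rnum_cong:
  assumes "\<And>i. i \<in> A \<Longrightarrow> u i = w i" "\<And>i. i \<in> A \<Longrightarrow> a i = a' i" "\<And>i. i \<in> A \<Longrightarrow> b i = b' i"
  shows "Rnum q u v a b A B \<alpha> \<beta> z = Rnum q w v a' b' A B \<alpha> \<beta> z"
  unfolding Rnum_def
proof (rule sum.cong[OF refl], goal_cases)
  case (1 K)
  then have K: "K \<subseteq> A" by auto
  have 1: "cross q u K (A - K) = cross q w K (A - K)" by (rule cross_cong) (use K assms in auto)
  have 2: "prod a K = prod a' K" "prod b (A - K) = prod b' (A - K)"
    "(\<Prod>i\<in>A - K. z - q * u i) = (\<Prod>i\<in>A - K. z - q * w i)" "(\<Prod>i\<in>K. z - u i) = (\<Prod>i\<in>K. z - w i)"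
    "(\<Prod>i\<in>K. q * z - u i) = (\<Prod>i\<in>K. q * z - w i)" "(\<Prod>i\<in>A - K. z - u i) = (\<Prod>i\<in>A - K. z - w i)"
    by (rule prod.cong; use K assms in auto)+
  have 3: "(\<Prod>i\<in>K. \<Prod>j\<in>B. ratio q (u i) (v j)) = (\<Prod>i\<in>K. \<Prod>j\<in>B. ratio q (w i) (v j))"
    by (rule prod.cong; use K assms in auto)
  show ?case
    unfolding 1 2 3 ..
qed

lemma Dsum_cong: "(\<And>i. i \<in> A \<Longrightarrow> u i = w i) \<Longrightarrow> Dsum q u v A B = Dsum q w v A B"
  unfolding Dsum_def by (rule Rsum_cong) auto

lemma Dnum_cong: "(\<And>i. i \<in> A \<Longrightarrow> u i = w i) \<Longrightarrow> Dnum q u v A B z = Dnum q w v A B z"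
  unfolding Dnum_def by (rule Rnum_cong) auto

lemma Esum_cong:
  assumes "\<And>i. i \<in> A \<Longrightarrow> u i = w i"
  shows "Esum q s c u v A B = Esum q s c w v A B"
  unfolding Esum_def
proof (intro sum.cong refl, goal_cases)
  case (1 I J)
  then have I: "I \<subseteq> A" by auto
  have "cross q u I (A - I) = cross q w I (A - I)" by (rule cross_cong) (use I assms in auto)
  moreover have "(\<Prod>i\<in>I. u i - s) = (\<Prod>i\<in>I. w i - s)" by (rule prod.cong; use I assms in auto)
  moreover have "Dsum q u v I J = Dsum q w v I J" by (rule Dsum_cong) (use I assms in auto)
  ultimately show ?case
    by simp
qed

lemma Enum_cong:
  assumes "\<And>i. i \<in> A \<Longrightarrow> u i = w i"
  shows "Enum q s c u v A B z = Enum q s c w v A B z"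
  unfolding Enum_def
proof (intro sum.cong refl, goal_cases)
  case (1 I J)
  then have I: "I \<subseteq> A" by auto
  have 1: "cross q u I (A - I) = cross q w I (A - I)" by (rule cross_cong) (use I assms in auto)
  have 2: "(\<Prod>i\<in>I. u i - s) = (\<Prod>i\<in>I. w i - s)" "(\<Prod>i\<in>A - I. z - q * u i) = (\<Prod>i\<in>A - I. z - q * w i)"
    "(\<Prod>i\<in>I. q * z - u i) = (\<Prod>i\<in>I. q * z - w i)" "(\<Prod>i\<in>A - I. z - u i) = (\<Prod>i\<in>A - I. z - w i)"
    by (rule prod.cong; use I assms in auto)+
  have 3: "Dsum q u v I J = Dsum q w v I J" by (rule Dsum_cong) (use I assms in auto)
  have 4: "Dnum q u v I J z = Dnum q w v I J z" by (rule Dnum_cong) (use I assms in auto)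
  show ?case
    unfolding 1 2 3 4 ..
qed

text \<open>
  The entry of the determinant in the theorem is \<open>acoef s (u i) / (1 - u i * v j) + bcoef q s \<alpha> (u i) / (1 - q * u i * v j)\<close>
  with \<open>\<alpha> = (1 - \<gamma>) * (q - s\<^sup>2 / \<gamma>)\<close>, provided \<open>u i \<noteq> 0\<close>.
\<close>

definition acoef :: "complex \<Rightarrow> complex \<Rightarrow> complex" where
  "acoef s z = (1 - s * z) * (1 - s / z)"

definition bcoef :: "complex \<Rightarrow> complex \<Rightarrow> complex \<Rightarrow> complex \<Rightarrow> complex" where
  "bcoef q s \<alpha> z = \<alpha> - (1 - s * z) * (q - s / z)"

text \<open>\<open>c\<close> and \<open>\<alpha>\<close> are unrelated here, and
  \<open>gap_move\<close> holds for any choice of them once the smaller gaps vanish. That they fit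
  together enters only at the staircase, through \<open>cweight_eq_prod_bcoef\<close>.\<close>

definition gap :: "complex \<Rightarrow> complex \<Rightarrow> (nat \<Rightarrow> complex) \<Rightarrow> complex \<Rightarrow> ('j \<Rightarrow> complex) \<Rightarrow> 'i set \<Rightarrow> 'j set
    \<Rightarrow> ('i \<Rightarrow> complex) \<Rightarrow> complex" where
  "gap q s c \<alpha> v A B u = Esum q s c u v A B -
     Rsum q u v (\<lambda>i. acoef s (u i)) (\<lambda>i. bcoef q s \<alpha> (u i)) A B"

lemma gap_cong: "(\<And>i. i \<in> A \<Longrightarrow> u i = w i) \<Longrightarrow> gap q s c \<alpha> v A B u = gap q s c \<alpha> v A B w"
  unfolding gap_def by (intro arg_cong2[where f="(-)"] Esum_cong Rsum_cong) auto

lemma polyb_quadratic: "polyb 2 c2 (\<lambda>z. c0 + c1 * z + c2 * z ^ 2)"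
  unfolding polyb_def
  by (rule exI[of _ "[:c0, c1, c2:]"]) (auto simp: algebra_simps power2_eq_square numeral_2_eq_2)

text \<open>
  Multiplied by \<open>z\<close> and its denominators, the gap is a polynomial in \<open>z = u k\<close> of degree at most \<open>2 * card A + 2\<close>
  that vanishes at \<open>0\<close>, at the \<open>u i\<close> and at the \<open>1 / v j\<close>; so it is a multiple of \<open>z\<close> times the denominators.
\<close>

lemma gap_move:
  fixes u :: "'i \<Rightarrow> complex" and v :: "'j \<Rightarrow> complex"
  assumes fin: "finite A" "finite B" and card: "card B = Suc (card A)" and k: "k \<notin> A"
    and inj: "inj_on u A" "inj_on v B"
    and u0: "\<And>i. i \<in> A \<Longrightarrow> u i \<noteq> 0" and v0: "\<And>j. j \<in> B \<Longrightarrow> v j \<noteq> 0"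
    and uv: "\<And>i j. i \<in> A \<Longrightarrow> j \<in> B \<Longrightarrow> 1 - u i * v j \<noteq> 0"
    and IH: "\<And>l. l \<in> B \<Longrightarrow> gap q s c \<alpha> v A (B - {l}) u = 0"
    and x: "x \<noteq> 0" "x \<notin> u ` A" "\<And>j. j \<in> B \<Longrightarrow> 1 - x * v j \<noteq> 0"
    and y: "y \<noteq> 0" "y \<notin> u ` A" "\<And>j. j \<in> B \<Longrightarrow> 1 - y * v j \<noteq> 0"
  shows "gap q s c \<alpha> v (insert k A) B (u(k := x)) = gap q s c \<alpha> v (insert k A) B (u(k := y))"
proof -
  \<comment> \<open>\<open>p\<close> and \<open>r\<close> are \<open>acoef\<close> and
    \<open>bcoef\<close> times z. Their top coefficients - s and q * s stand in the ratio 1 : - q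
    that \<open>Rnum_polyb\<close> asks for.\<close>
  define p where "p z = (1 - s * z) * (z - s)" for z
  define r where "r z = \<alpha> * z - (1 - s * z) * (q * z - s)" for z
  define Q where "Q z = (\<Prod>i\<in>A. z - u i) * (\<Prod>j\<in>B. 1 - z * v j)" for z
  define a where "a i = acoef s (u i)" for i
  define b where "b i = bcoef q s \<alpha> (u i)" for i
  define H where "H z = z * Enum q s c u v A B z - Rnum q u v a b A B (p z) (r z) z" for z
  have polyE: "polyd (2 * card A + 2) (\<lambda>z. z * Enum q s c u v A B z)"
    using polyd_mult[OF polyd_linear[of 1 0] Enum_polyd[OF fin card]] by (simp add: add.commute)
  have "polyb 2 (- s) p"
    using polyb_quadratic[of "- s" "- s" "1 + s\<^sup>2"] unfolding p_def
    by (simp add: algebra_simps power2_eq_square)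
  moreover have "polyb 2 (- q * - s) r"
    using polyb_quadratic[of "q * s" "s" "\<alpha> - q - s\<^sup>2"] unfolding r_def
    by (simp add: algebra_simps power2_eq_square)
  ultimately have "polyd (2 + 2 * card A) (\<lambda>z. Rnum q u v a b A B (p z) (r z) z)"
    using Rnum_polyb[OF fin card, of 2 "- s" p q r] unfolding polyd_def by blast
  from polyd_add[OF polyE, of "\<lambda>z. (- 1) * Rnum q u v a b A B (p z) (r z) z"]
    polyd_mult[OF polyd_const[of "-1"] this]
  have polyH: "polyd (2 * card A + 2) H"
    unfolding H_def by (simp add: add.commute)
  have polyQ: "polyd (2 * card A + 2) (\<lambda>z. z * Q z)"
  proof -
    have "polyd (1 + (card A + card B)) (\<lambda>z. (1 * z + 0) * ((\<Prod>i\<in>A. 1 * z + - u i) * (\<Prod>j\<in>B. - v j * z + 1)))"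
      by (intro polyd_mult polyd_linear polyd_prod_linear fin)
    then show ?thesis unfolding Q_def card by (simp add: algebra_simps mult_2_right)
  qed
  have key: "H z = z * Q z * gap q s c \<alpha> v (insert k A) B (u(k := z))"
    if z: "z \<noteq> 0" "z \<notin> u ` A" "\<And>j. j \<in> B \<Longrightarrow> 1 - z * v j \<noteq> 0" for z
  proof -
    let ?w = "u(k := z)"
    have w: "?w i = u i" if "i \<in> A" for i using that k by auto
    have Qw: "Q z = (\<Prod>i\<in>A. ?w k - ?w i) * (\<Prod>j\<in>B. 1 - ?w k * v j)"
      unfolding Q_def using k by (auto intro!: arg_cong2[where f="(*)"] prod.cong)
    have ne: "\<And>i. i \<in> A \<Longrightarrow> ?w i \<noteq> ?w k" using z(2) k by auto
    have vv: "\<And>j. j \<in> B \<Longrightarrow> 1 - ?w k * v j \<noteq> 0" using z(3) by simp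
    have "Esum q s c ?w v (insert k A) B * Q z = Enum q s c ?w v A B (?w k)"
      unfolding Qw by (rule Esum_insert[OF fin k]) (erule ne, erule vv)
    also have "\<dots> = Enum q s c u v A B z"
      using Enum_cong[of A ?w u, OF w] by simp
    finally have 1: "Esum q s c ?w v (insert k A) B * Q z = Enum q s c u v A B z" .
    have "Rsum q ?w v (\<lambda>i. acoef s (?w i)) (\<lambda>i. bcoef q s \<alpha> (?w i)) (insert k A) B * Q z =
      Rnum q ?w v (\<lambda>i. acoef s (?w i)) (\<lambda>i. bcoef q s \<alpha> (?w i)) A B (acoef s (?w k)) (bcoef q s \<alpha> (?w k)) (?w k)"
      unfolding Qw by (rule Rsum_insert[OF fin(1) k]) (erule ne, erule vv)
    also have "\<dots> = Rnum q u v a b A B (acoef s (?w k)) (bcoef q s \<alpha> (?w k)) (?w k)"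
      unfolding a_def b_def by (rule Rnum_cong) (simp_all only: w)
    finally have "Rsum q ?w v (\<lambda>i. acoef s (?w i)) (\<lambda>i. bcoef q s \<alpha> (?w i)) (insert k A) B * Q z =
      Rnum q u v a b A B (acoef s z) (bcoef q s \<alpha> z) z" by (simp only: fun_upd_same)
    moreover have "z * Rnum q u v a b A B (acoef s z) (bcoef q s \<alpha> z) z =
      Rnum q u v a b A B (z * acoef s z) (z * bcoef q s \<alpha> z) z"
      unfolding Rnum_def sum_distrib_left by (intro sum.cong refl) (simp add: algebra_simps)
    moreover have "z * acoef s z = p z" "z * bcoef q s \<alpha> z = r z"
      using z(1) unfolding acoef_def bcoef_def p_def r_def by (simp_all add: field_simps)
    ultimately show ?thesis
      unfolding H_def gap_def 1[symmetric] by (simp add: algebra_simps)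
  qed
  have H0: "H 0 = 0"
    unfolding H_def p_def r_def using Rnum_at_zero[OF fin(1), of q u v a b B "- s"] by simp
  have Hu: "H (u i) = 0" if i: "i \<in> A" for i
  proof -
    have "Rnum q u v a b A B (p (u i)) (r (u i)) (u i) = 0"
    proof (rule Rnum_at_node[OF fin(1) i inj(1) uv[OF i]])
      show "p (u i) * b i = r (u i) * a i"
        using u0[OF i] unfolding p_def r_def a_def b_def acoef_def bcoef_def by (simp add: field_simps)
    qed
    then show ?thesis unfolding H_def using Enum_at_node[OF fin i inj(1) uv[OF i]] by simp
  qed
  have Hv: "H (1 / v l) = 0" if l: "l \<in> B" for l
  proof -
    define B' where "B' = B - {l}"
    have B: "B = insert l B'" and lB: "l \<notin> B'" and finB: "finite B'" using l fin by (auto simp: B'_def)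
    define z where "z = 1 / v l"
    have z: "z * v l = 1" using v0[OF l] by (simp add: z_def)
    have uz: "\<And>i. i \<in> A \<Longrightarrow> u i \<noteq> z" using uv[OF _ l] z by auto
    have vl: "\<And>j. j \<in> B' \<Longrightarrow> v j \<noteq> v l" using inj(2) lB unfolding B inj_on_def by auto
    have g: "Esum q s c u v A B' = Rsum q u v a b A B'"
      using IH[OF l] unfolding gap_def B'_def a_def b_def by simp
    \<comment> \<open>A consequence of z * v l = 1; it brings \<open>p z\<close> into the form of
      the factors (z - s) * (v l - s) that \<open>Enum_at_pole\<close> produces.\<close>
    have "1 - s * z = z * (v l - s)" using z by (simp add: algebra_simps)
    then have "p z = z * ((z - s) * (v l - s))" unfolding p_def by simp
    moreover have "Enum q s c u v A (insert l B') z =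
      (1 - q) * (z - s) * (v l - s) * (\<Prod>j\<in>B'. 1 - q * z * v j) * (\<Prod>i\<in>A. z - q * u i) * Esum q s c u v A B'"
      by (rule Enum_at_pole) (use fin finB lB z uz vl in auto)
    moreover have "Rnum q u v a b A (insert l B') (p z) (r z) z =
      p z * (1 - q) * (\<Prod>j\<in>B'. 1 - q * z * v j) * (\<Prod>i\<in>A. z - q * u i) * Rsum q u v a b A B'"
      by (rule Rnum_at_pole) (use fin finB lB z uz in auto)
    ultimately show ?thesis unfolding H_def z_def[symmetric] B g by simp
  qed
  \<comment> \<open>Besides the common zeros of \<open>H\<close> and \<open>z * Q z\<close> this set
    contains \<open>y\<close>, where the combination of the two formed below vanishes by
    construction. That makes one zero more than the degree allows.\<close>
  define S where "S = insert y (insert 0 (u ` A \<union> (\<lambda>j. 1 / v j) ` B))"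
  have cardS: "card S = 2 * card A + 3"
  proof -
    have "inj_on (\<lambda>j. 1 / v j) B" using inj(2) v0 unfolding inj_on_def by auto
    moreover have "u ` A \<inter> (\<lambda>j. 1 / v j) ` B = {}" using uv v0 by (auto simp: field_simps)
    ultimately have "card (u ` A \<union> (\<lambda>j. 1 / v j) ` B) = 2 * card A + 1"
      using fin inj card by (simp add: card_Un_disjoint card_image)
    moreover have "0 \<notin> u ` A \<union> (\<lambda>j. 1 / v j) ` B" using u0 v0 by auto
    moreover have "y \<notin> insert 0 (u ` A \<union> (\<lambda>j. 1 / v j) ` B)" using y v0 by fastforce
    ultimately show ?thesis unfolding S_def using fin by simp
  qed
  have Q0: "Q (u i) = 0" if "i \<in> A" for i unfolding Q_def using that fin by (auto simp: prod_zero_iff)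
  have Q1: "Q (1 / v j) = 0" if "j \<in> B" for j unfolding Q_def using that fin v0 by (auto simp: prod_zero_iff)
  have Qnz: "Q z \<noteq> 0" if z: "z \<notin> u ` A" "\<And>j. j \<in> B \<Longrightarrow> 1 - z * v j \<noteq> 0" for z
    unfolding Q_def using fin that by (auto simp: prod_zero_iff)
  have "polyd (2 * card A + 2) (\<lambda>z. (y * Q y) * H z + (- H y) * (z * Q z))"
    using polyd_add[OF polyd_mult[OF polyd_const[of "y * Q y"] polyH] polyd_mult[OF polyd_const[of "- H y"] polyQ]]
    by (simp only: add_0)
  then obtain cc where cc: "polyb (2 * card A + 2) cc (\<lambda>z. (y * Q y) * H z + (- H y) * (z * Q z))"
    unfolding polyd_def by blast
  have "(y * Q y) * H x + (- H y) * (x * Q x) = 0"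
  proof (rule polyb_eq_zero[OF cc])
    show "finite S" unfolding S_def using fin by simp
    show "2 * card A + 2 < card S" using cardS by simp
    show "(y * Q y) * H z + (- H y) * (z * Q z) = 0" if "z \<in> S" for z
      using that H0 Hu Hv Q0 Q1 unfolding S_def by auto
  qed
  moreover have "H x = x * Q x * gap q s c \<alpha> v (insert k A) B (u(k := x))"
    "H y = y * Q y * gap q s c \<alpha> v (insert k A) B (u(k := y))"
    by (rule key; use x y in blast)+
  ultimately have "(y * Q y * (x * Q x)) * (gap q s c \<alpha> v (insert k A) B (u(k := x)) - gap q s c \<alpha> v (insert k A) B (u(k := y))) = 0"
    by (simp only: right_diff_distrib mult_ac mult_minus_left mult_minus_right add_uminus_conv_diff)
  then show ?thesis using Qnz[OF x(2,3)] Qnz[OF y(2,3)] x y by simp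
qed

section \<open>Moving the variables to the staircase\<close>

text \<open>Values are replaced one index at a time. Disjoint ranges keep every intermediate
  function injective and ensure that the new value is not yet taken.\<close>

lemma inj_move_disjoint:
  fixes G :: "('i \<Rightarrow> 'a) \<Rightarrow> 'b"
  assumes fin: "finite A"
    and cong: "\<And>u w. (\<And>i. i \<in> A \<Longrightarrow> u i = w i) \<Longrightarrow> G u = G w"
    and move: "\<And>u k x. inj_on u A \<Longrightarrow> u ` A \<subseteq> X \<Longrightarrow> k \<in> A \<Longrightarrow> x \<in> X \<Longrightarrow> x \<notin> u ` A \<Longrightarrow> G (u(k := x)) = G u"
    and u: "inj_on u A" "u ` A \<subseteq> X" and w: "inj_on w A" "w ` A \<subseteq> X" and disj: "u ` A \<inter> w ` A = {}"
  shows "G u = G w"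
proof -
  have "G (override_on u w S) = G u" if "S \<subseteq> A" for S
    using finite_subset[OF that fin] that
  proof (induction S rule: finite_induct)
    case (insert k S)
    let ?h = "override_on u w S"
    have S: "S \<subseteq> A" "k \<in> A" using insert by auto
    have uw: "u i \<noteq> w j" if "i \<in> A" "j \<in> A" for i j using disj that by auto
    have "inj_on ?h A"
    proof (rule inj_onI)
      fix i j assume ij: "i \<in> A" "j \<in> A" "?h i = ?h j"
      show "i = j"
        using ij uw[of i j] uw[of j i] inj_onD[OF u(1), of i j] inj_onD[OF w(1), of i j]
        by (cases "i \<in> S"; cases "j \<in> S") (simp_all add: override_on_def)
    qed
    moreover have "?h ` A \<subseteq> X" using u(2) w(2) S by (auto simp: override_on_def)
    moreover have "w k \<notin> ?h ` A"
    proof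
      assume "w k \<in> ?h ` A"
      then obtain i where i: "i \<in> A" "w k = ?h i" by auto
      show False
      proof (cases "i \<in> S")
        case True
        then have "w k = w i" using i by (simp add: override_on_def)
        then have "k = i" using inj_onD[OF w(1)] i S by simp
        then show False using True insert.hyps(2) by simp
      next
        case False
        then show False using i S uw[of i k] by (simp add: override_on_def)
      qed
    qed
    moreover have "w k \<in> X" using w(2) S by auto
    ultimately have "G (?h(k := w k)) = G ?h" using S by (intro move)
    moreover have "?h(k := w k) = override_on u w (insert k S)" by (auto simp: override_on_def)
    ultimately show ?case using insert by simp
  qed simp
  from this[of A] have "G (override_on u w A) = G u" by simp
  moreover have "G (override_on u w A) = G w" by (rule cong) simp
  ultimately show ?thesis by simp
qed

text \<open>If the ranges overlap, a replacement may collide with a value still in use. Both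
  functions are therefore moved to a third one whose range avoids theirs; it exists because
  \<open>X\<close> is infinite.\<close>

lemma inj_move:
  fixes G :: "('i \<Rightarrow> 'a) \<Rightarrow> 'b"
  assumes fin: "finite A" and inf: "infinite X"
    and cong: "\<And>u w. (\<And>i. i \<in> A \<Longrightarrow> u i = w i) \<Longrightarrow> G u = G w"
    and move: "\<And>u k x. inj_on u A \<Longrightarrow> u ` A \<subseteq> X \<Longrightarrow> k \<in> A \<Longrightarrow> x \<in> X \<Longrightarrow> x \<notin> u ` A \<Longrightarrow> G (u(k := x)) = G u"
    and u: "inj_on u A" "u ` A \<subseteq> X" and w: "inj_on w A" "w ` A \<subseteq> X"
  shows "G u = G w"
proof -
  have "infinite (X - (u ` A \<union> w ` A))" using inf fin by (simp add: Diff_infinite_finite)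
  then obtain T where T: "finite T" "card T = card A" "T \<subseteq> X - (u ` A \<union> w ` A)"
    using infinite_arbitrarily_large[of "X - (u ` A \<union> w ` A)" "card A"] by auto
  obtain h where h: "bij_betw h A T" using finite_same_card_bij[OF fin T(1)] T(2) by auto
  have h': "inj_on h A" "h ` A \<subseteq> X" "u ` A \<inter> h ` A = {}" "h ` A \<inter> w ` A = {}"
    using h T(3) unfolding bij_betw_def by auto
  have "G u = G h" by (rule inj_move_disjoint[OF fin cong move u h'(1-3)])
  also have "G h = G w" by (rule inj_move_disjoint[OF fin cong move h'(1,2) w h'(4)])
  finally show ?thesis .
qed

text \<open>Take \<open>i\<close> in \<open>I\<close> with the smallest exponent. If the exponent is
  0 then u i = s; otherwise the index j with the next smaller exponent lies outside
  \<open>I\<close>, and u i = q * u j kills a factor of \<open>cross\<close>.\<close>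

lemma staircase_vanishes:
  fixes e :: "'i \<Rightarrow> nat"
  assumes e: "bij_betw e A {..<n}" and u: "\<And>i. i \<in> A \<Longrightarrow> u i = s * q ^ e i"
    and I: "I \<subseteq> A" "I \<noteq> {}" "finite A"
  shows "cross q u I (A - I) = 0 \<or> (\<exists>i\<in>I. u i = s)"
proof -
  have finI: "finite I" using I by (auto intro: finite_subset)
  obtain i where i: "i \<in> I" "\<And>j. j \<in> I \<Longrightarrow> e i \<le> e j"
    using arg_min_if_finite[OF finI I(2), of e] by (metis linorder_not_less)
  have iA: "i \<in> A" using i I by auto
  show ?thesis
  proof (cases "e i")
    case 0
    then show ?thesis using i u[OF iA] by auto
  next
    case (Suc m)
    have "e i < n" using e iA unfolding bij_betw_def by auto
    then have "m \<in> e ` A" using Suc e unfolding bij_betw_def by auto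
    then obtain j where j: "j \<in> A" "e j = m" by auto
    have jI: "j \<notin> I" using i(2)[of j] j Suc by auto
    have "u i - q * u j = 0" using u[OF iA] u[OF j(1)] j Suc by simp
    then have "(\<Prod>j\<in>A - I. (u i - q * u j) / (u i - u j)) = 0"
      using j jI I(3) by (auto simp: prod_zero_iff)
    then show ?thesis unfolding cross_def using i finI by (auto simp: prod_zero_iff)
  qed
qed

lemma Dsum_empty [simp]: "Dsum q u v {} B = 1"
  unfolding Dsum_def Rsum_def by (simp add: cross_def)

lemma Esum_staircase:
  fixes e :: "'i \<Rightarrow> nat"
  assumes e: "bij_betw e A {..<n}" and u: "\<And>i. i \<in> A \<Longrightarrow> u i = s * q ^ e i"
    and fin: "finite A" "finite B"
  shows "Esum q s c u v A B = c (card A)"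
proof -
  have "(\<Sum>J\<in>Pow B. if card J = card I then c (card (A - I)) * (cross q u I (A - I) * (\<Prod>i\<in>I. u i - s)) *
     (cross q v J (B - J) * (\<Prod>j\<in>J. v j - s)) * Dsum q u v I J else 0) = (if I = {} then c (card A) else 0)" (is "?S I = _") if "I \<in> Pow A" for I
  proof (cases "I = {}")
    case True
    have "?S I = (\<Sum>J\<in>Pow B. if J = {} then c (card A) else 0)"
      by (rule sum.cong[OF refl]) (use fin in \<open>auto simp: True cross_def dest: finite_subset\<close>)
    also have "\<dots> = c (card A)" using fin by simp
    finally show ?thesis using True by simp
  next
    case False
    have "cross q u I (A - I) * (\<Prod>i\<in>I. u i - s) = 0"
      using staircase_vanishes[OF e u _ False fin(1)] that fin finite_subset[of I A]
      by (auto simp: prod_zero_iff)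
    then show ?thesis using False by (simp only: mult_zero_left mult_zero_right if_False) simp
  qed
  note * = this
  have "Esum q s c u v A B = (\<Sum>I\<in>Pow A. if I = {} then c (card A) else 0)"
    unfolding Esum_def by (rule sum.cong[OF refl *])
  then show ?thesis using fin by simp
qed

text \<open>By \<open>staircase_vanishes\<close> only \<open>K = {}\<close> survives. The condition
  on \<open>a\<close> is met by \<open>acoef\<close>, which has a zero at s.\<close>

lemma Rsum_staircase:
  fixes e :: "'i \<Rightarrow> nat"
  assumes e: "bij_betw e A {..<n}" and u: "\<And>i. i \<in> A \<Longrightarrow> u i = s * q ^ e i"
    and fin: "finite A" and a: "\<And>i. i \<in> A \<Longrightarrow> u i = s \<Longrightarrow> a i = 0"
  shows "Rsum q u v a b A B = (\<Prod>i\<in>A. b i) * q ^ (card A choose 2)"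
proof -
  have "cross q u K (A - K) * prod a K * prod b (A - K) * q ^ (card (A - K) choose 2) *
      (\<Prod>i\<in>K. \<Prod>j\<in>B. ratio q (u i) (v j)) = (if K = {} then prod b A * q ^ (card A choose 2) else 0)"
    if "K \<in> Pow A" for K
  proof (cases "K = {}")
    case False
    have "cross q u K (A - K) * prod a K = 0"
      using staircase_vanishes[OF e u _ False fin(1)] that fin finite_subset[of K A] a
      by (auto simp: prod_zero_iff)
    then show ?thesis using False by simp
  qed (simp add: cross_def)
  note * = this
  have "Rsum q u v a b A B = (\<Sum>K\<in>Pow A. if K = {} then prod b A * q ^ (card A choose 2) else 0)"
    unfolding Rsum_def by (rule sum.cong[OF refl *])
  then show ?thesis using fin by simp
qed

text \<open>What remains of the weight of \<open>m\<close> zero parts after (q;q)_m and (s^2;q)_m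
  have cancelled against the factors that come from removing the column. At \<gamma> = 1 it is the
  corresponding factor of the unrefined sum.\<close>

definition cweight :: "complex \<Rightarrow> complex \<Rightarrow> complex \<Rightarrow> nat \<Rightarrow> complex" where
  "cweight q s \<gamma> m = qpoch (\<gamma> * q) q m * qpoch (s\<^sup>2 / \<gamma>) q m"

text \<open>At a staircase node \<open>q ^ k\<close> times \<open>bcoef\<close> factors as (1 -
  \<gamma> * q * q ^ k) * (1 - s^2 / \<gamma> * q ^ k); this explains the value (1 - \<gamma>) * (q
  - s^2 / \<gamma>) in the determinant. The powers of \<open>q\<close> collect to
  \<open>q ^ (n choose 2)\<close>.\<close>

lemma cweight_eq_prod_bcoef:
  assumes "s \<noteq> 0" "q \<noteq> 0" "\<gamma> \<noteq> 0"
  shows "cweight q s \<gamma> n = (\<Prod>k<n. bcoef q s ((1 - \<gamma>) * (q - s\<^sup>2 / \<gamma>)) (s * q ^ k)) * q ^ (n choose 2)"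
proof (induction n)
  case (Suc n)
  have "q ^ n * bcoef q s ((1 - \<gamma>) * (q - s\<^sup>2 / \<gamma>)) (s * q ^ n) =
     (1 - \<gamma> * q * q ^ n) * (1 - s\<^sup>2 / \<gamma> * q ^ n)"
    using assms unfolding bcoef_def by (simp add: field_simps power2_eq_square)
  moreover have "cweight q s \<gamma> (Suc n) = cweight q s \<gamma> n * ((1 - \<gamma> * q * q ^ n) * (1 - s\<^sup>2 / \<gamma> * q ^ n))"
    unfolding cweight_def qpoch_def by (simp add: mult_ac)
  ultimately show ?case unfolding Suc.IH Suc_choose_two power_add by (simp add: mult_ac)
qed (simp add: cweight_def qpoch_def)

text \<open>Induction on the number of variables; \<open>gap_move\<close> consumes the smaller
  cases, one for each column. The hypotheses on \<open>s\<close> and on the powers of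
  \<open>q\<close> make the staircase injective, and the last one keeps it off the poles.\<close>

lemma gap_generic:
  fixes v :: "'j \<Rightarrow> complex" and u :: "'i \<Rightarrow> complex"
  assumes q0: "q \<noteq> 0" and qinj: "inj (\<lambda>k. q ^ k)" and s0: "s \<noteq> 0" and g0: "\<gamma> \<noteq> 0"
  defines "\<alpha> \<equiv> (1 - \<gamma>) * (q - s\<^sup>2 / \<gamma>)"
  shows "finite A \<Longrightarrow> finite B \<Longrightarrow> card A = n \<Longrightarrow> card B = n \<Longrightarrow> inj_on u A \<Longrightarrow> inj_on v B \<Longrightarrow>
    (\<And>i. i \<in> A \<Longrightarrow> u i \<noteq> 0) \<Longrightarrow> (\<And>j. j \<in> B \<Longrightarrow> v j \<noteq> 0) \<Longrightarrow>
    (\<And>i j. i \<in> A \<Longrightarrow> j \<in> B \<Longrightarrow> 1 - u i * v j \<noteq> 0) \<Longrightarrow>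
    (\<And>k j. k < n \<Longrightarrow> j \<in> B \<Longrightarrow> 1 - s * q ^ k * v j \<noteq> 0) \<Longrightarrow>
    gap q s (cweight q s \<gamma>) \<alpha> v A B u = 0"
proof (induction n arbitrary: A B u)
  case 0
  then have "A = {}" "B = {}" by auto
  then show ?case unfolding gap_def Esum_def Rsum_def by (simp add: cross_def cweight_def qpoch_def)
next
  case (Suc n)
  note fin = Suc.prems(1,2) and card = Suc.prems(3,4) and inj = Suc.prems(5,6)
    and u0 = Suc.prems(7) and v0 = Suc.prems(8) and uv = Suc.prems(9) and sv = Suc.prems(10)
  \<comment> \<open>The values at which \<open>gap_move\<close> applies. The set is cofinite, hence
    infinite as \<open>inj_move\<close> requires.\<close>
  define X where "X = {z. z \<noteq> 0 \<and> (\<forall>j\<in>B. 1 - z * v j \<noteq> 0)}"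
  have "x = 1 / v j" if "1 - x * v j = 0" for x j
    using that by (cases "v j = 0") (auto simp: field_simps)
  then have "- X \<subseteq> insert 0 ((\<lambda>j. 1 / v j) ` B)" unfolding X_def by auto
  then have finX: "finite (- X)" using fin by (meson finite_imageI finite_insert finite_subset)
  have infX: "infinite X"
    using finX infinite_UNIV_char_0[where 'a=complex] finite_compl by metis
  obtain e where e: "bij_betw e A {..<Suc n}"
    using ex_bij_betw_finite_nat[OF fin(1)] card by (auto simp: atLeast0LessThan)
  define w where "w i = s * q ^ e i" for i
  have "gap q s (cweight q s \<gamma>) \<alpha> v A B u = gap q s (cweight q s \<gamma>) \<alpha> v A B w"
  proof (rule inj_move[where G="gap q s (cweight q s \<gamma>) \<alpha> v A B" and u=u and w=w, OF fin(1) infX])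
    show "gap q s (cweight q s \<gamma>) \<alpha> v A B u' = gap q s (cweight q s \<gamma>) \<alpha> v A B w'"
      if "\<And>i. i \<in> A \<Longrightarrow> u' i = w' i" for u' w' by (rule gap_cong) (rule that)
    show "inj_on u A" by (rule inj)
    show "u ` A \<subseteq> X" using u0 uv unfolding X_def by auto
    show "inj_on w A"
      using e qinj s0 unfolding w_def inj_on_def bij_betw_def by auto
    show "w ` A \<subseteq> X"
    proof
      fix z assume "z \<in> w ` A"
      then obtain i where i: "i \<in> A" "z = s * q ^ e i" unfolding w_def by auto
      have "e i < Suc n" using e i unfolding bij_betw_def by auto
      then show "z \<in> X" unfolding X_def using i sv s0 q0 by auto
    qed
    show "gap q s (cweight q s \<gamma>) \<alpha> v A B (f(k := x)) = gap q s (cweight q s \<gamma>) \<alpha> v A B f"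
      if f: "inj_on f A" "f ` A \<subseteq> X" and k: "k \<in> A" and x: "x \<in> X" "x \<notin> f ` A" for f k x
    proof -
      define A' where "A' = A - {k}"
      have A: "A = insert k A'" and kA: "k \<notin> A'" and finA: "finite A'" using k fin by (auto simp: A'_def)
      have cA: "card A' = n" using card fin k by (simp add: A'_def)
      have fX: "f i \<in> X" if "i \<in> A" for i using f(2) that by auto
      have fk: "f k \<notin> f ` A'" using f(1) kA unfolding A by (auto simp: inj_on_def)
      \<comment> \<open>\<open>gap_move\<close> compares two updates at \<open>k\<close>; with the
        old value \<open>f k\<close> as the second one, that update is \<open>f\<close>
        itself.\<close>
      have "gap q s (cweight q s \<gamma>) \<alpha> v (insert k A') B (f(k := x)) = gap q s (cweight q s \<gamma>) \<alpha> v (insert k A') B (f(k := f k))"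
      proof (rule gap_move[OF finA fin(2) _ kA])
        show "card B = Suc (card A')" using card cA by simp
        show "inj_on f A'" using f(1) unfolding A by (simp add: inj_on_def)
        show "inj_on v B" by (rule inj)
        show "gap q s (cweight q s \<gamma>) \<alpha> v A' (B - {l}) f = 0" if l: "l \<in> B" for l
        proof (rule Suc.IH)
          show "finite A'" "finite (B - {l})" using finA fin by auto
          show "card A' = n" "card (B - {l}) = n" using cA card fin l by auto
          show "inj_on f A'" using f(1) unfolding A by (simp add: inj_on_def)
          show "inj_on v (B - {l})" using inj(2) by (rule inj_on_diff)
          show "\<And>i. i \<in> A' \<Longrightarrow> f i \<noteq> 0" using fX unfolding X_def A by auto
          show "\<And>j. j \<in> B - {l} \<Longrightarrow> v j \<noteq> 0" using v0 by auto
          show "\<And>i j. i \<in> A' \<Longrightarrow> j \<in> B - {l} \<Longrightarrow> 1 - f i * v j \<noteq> 0" using fX unfolding X_def A by blast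
          show "\<And>k j. k < n \<Longrightarrow> j \<in> B - {l} \<Longrightarrow> 1 - s * q ^ k * v j \<noteq> 0" using sv by auto
        qed
        show "\<And>i. i \<in> A' \<Longrightarrow> f i \<noteq> 0" using fX unfolding X_def A by auto
        show "\<And>j. j \<in> B \<Longrightarrow> v j \<noteq> 0" using v0 by auto
        show "\<And>i j. i \<in> A' \<Longrightarrow> j \<in> B \<Longrightarrow> 1 - f i * v j \<noteq> 0" using fX unfolding X_def A by blast
        show "x \<noteq> 0" "\<And>j. j \<in> B \<Longrightarrow> 1 - x * v j \<noteq> 0" using x unfolding X_def by auto
        show "x \<notin> f ` A'" using x unfolding A by auto
        show "f k \<notin> f ` A'" by (rule fk)
        show "f k \<noteq> 0" "\<And>j. j \<in> B \<Longrightarrow> 1 - f k * v j \<noteq> 0" using fX[OF k] unfolding X_def by auto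
      qed
      then show ?thesis unfolding A by simp
    qed
  qed
  also have "\<dots> = 0"
  proof -
    have 1: "Esum q s (cweight q s \<gamma>) w v A B = cweight q s \<gamma> (Suc n)"
      using Esum_staircase[OF e _ fin, of w s q] card unfolding w_def by simp
    have 2: "Rsum q w v (\<lambda>i. acoef s (w i)) (\<lambda>i. bcoef q s \<alpha> (w i)) A B = (\<Prod>i\<in>A. bcoef q s \<alpha> (w i)) * q ^ (Suc n choose 2)"
      unfolding card(1)[symmetric]
      by (rule Rsum_staircase[OF e _ fin(1), where s=s]) (use s0 in \<open>auto simp: acoef_def w_def\<close>)
    have "(\<Prod>i\<in>A. bcoef q s \<alpha> (w i)) = (\<Prod>k<Suc n. bcoef q s \<alpha> (s * q ^ k))"
      unfolding w_def by (rule prod.reindex_bij_betw[OF e])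
    then show ?thesis unfolding gap_def 1 2 cweight_eq_prod_bcoef[OF s0 q0 g0] \<alpha>_def[symmetric] by simp
  qed
  finally show ?case .
qed

subsection \<open>The determinant\<close>

lemma det_scale_rows_cols:
  fixes r c :: "nat \<Rightarrow> complex"
  shows "det (mat n n (\<lambda>(i, j). r i * c j * M i j)) = (\<Prod>i<n. r i) * (\<Prod>j<n. c j) * det (mat n n (\<lambda>(i, j). M i j))"
proof -
  have "(\<Prod>i = 0..<n. r i * c (p i) * M i (p i)) = (\<Prod>i<n. r i) * (\<Prod>j<n. c j) * (\<Prod>i = 0..<n. M i (p i))"
    if "p permutes {0..<n}" for p
    using prod.permute[OF that, of c] by (simp add: prod.distrib atLeast0LessThan comp_def)
  moreover have "(\<Prod>i = 0..<n. mat n n (\<lambda>(i, j). f i j) $$ (i, p i)) = (\<Prod>i = 0..<n. f i (p i))"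
    if "p permutes {0..<n}" for p and f :: "nat \<Rightarrow> nat \<Rightarrow> complex"
    using permutes_in_image[OF that] by (intro prod.cong) auto
  ultimately show ?thesis
    unfolding det_def'[OF mat_carrier] sum_distrib_left by (intro sum.cong refl) simp
qed

text \<open>One step of Gaussian elimination: \<open>L\<close> has determinant 1 and clears the
  first column below the pivot, which leaves the Schur complement.\<close>

lemma det_pivot:
  fixes M :: "nat \<Rightarrow> nat \<Rightarrow> complex"
  assumes "M 0 0 \<noteq> 0"
  shows "det (mat (Suc n) (Suc n) (\<lambda>(i, j). M i j)) =
    M 0 0 * det (mat n n (\<lambda>(i, j). M (Suc i) (Suc j) - M (Suc i) 0 * M 0 (Suc j) / M 0 0))"
proof -
  define A where "A = mat (Suc n) (Suc n) (\<lambda>(i, j). M i j)"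
  define L where "L = mat (Suc n) (Suc n) (\<lambda>(i, j). if i = j then 1 else if j = 0 then - M i 0 / M 0 0 else 0)"
  have A: "A \<in> carrier_mat (Suc n) (Suc n)" and L: "L \<in> carrier_mat (Suc n) (Suc n)"
    unfolding A_def L_def by auto
  have LA: "L * A \<in> carrier_mat (Suc n) (Suc n)" using A L by auto
  have "det L = 1"
  proof -
    have "det L = prod_list (diag_mat L)"
      by (rule det_lower_triangular[OF _ L]) (auto simp: L_def)
    also have "\<dots> = 1" unfolding prod_list_diag_prod by (simp add: L_def)
    finally show ?thesis .
  qed
  have entry: "(L * A) $$ (i, j) = (if i = 0 then M 0 j else M i j - M i 0 * M 0 j / M 0 0)"
    if "i < Suc n" "j < Suc n" for i j
  proof -
    have "(L * A) $$ (i, j) = (\<Sum>k\<in>{0..<Suc n}. L $$ (i, k) * A $$ (k, j))"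
      using that A L by (simp add: scalar_prod_def)
    also have "\<dots> = (\<Sum>k\<in>{0..<Suc n}. (if k = i then M i j else 0) + (if k = 0 then (if i = 0 then 0 else - M i 0 / M 0 0 * M 0 j) else 0))"
      using that by (intro sum.cong refl) (auto simp: L_def A_def)
    also have "\<dots> = (if i = 0 then M 0 j else M i j - M i 0 * M 0 j / M 0 0)"
      unfolding sum.distrib using that by simp
    finally show ?thesis .
  qed
  have "det A = det (L * A)" using det_mult[OF L A] \<open>det L = 1\<close> by simp
  also have "\<dots> = (\<Sum>i<Suc n. (L * A) $$ (i, 0) * cofactor (L * A) i 0)"
    by (rule laplace_expansion_column[OF LA]) simp
  also have "\<dots> = (\<Sum>i<Suc n. if i = 0 then M 0 0 * cofactor (L * A) 0 0 else 0)"
    using assms by (intro sum.cong refl) (auto simp: entry)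
  also have "\<dots> = M 0 0 * det (mat_delete (L * A) 0 0)" by (simp add: cofactor_def)
  also have "mat_delete (L * A) 0 0 = mat n n (\<lambda>(i, j). M (Suc i) (Suc j) - M (Suc i) 0 * M 0 (Suc j) / M 0 0)"
    by (intro eq_matI) (simp_all add: mat_delete_def entry carrier_matD[OF L] carrier_matD[OF A] del: index_mult_mat(1))
  finally show ?thesis unfolding A_def .
qed

lemma prod_upper_Suc:
  "(\<Prod>i<Suc n. \<Prod>j\<in>{i<..<Suc n}. f i j) = (\<Prod>i<n. f i n) * (\<Prod>i<n. \<Prod>j\<in>{i<..<n}. f i j)"
proof -
  have "{i<..<Suc n} = insert n {i<..<n}" if "i < n" for i using that by auto
  then have "(\<Prod>j\<in>{i<..<Suc n}. f i j) = f i n * (\<Prod>j\<in>{i<..<n}. f i j)" if "i < n" for i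
    using that by simp
  moreover have "{n<..<Suc n} = {}" by auto
  ultimately show ?thesis by (simp add: prod.distrib)
qed

lemma prod_upper_Suc_shift:
  "(\<Prod>i<Suc n. \<Prod>j\<in>{i<..<Suc n}. f i j) = (\<Prod>j<n. f 0 (Suc j)) * (\<Prod>i<n. \<Prod>j\<in>{i<..<n}. f (Suc i) (Suc j))"
proof -
  have "{Suc i<..<Suc n} = Suc ` {i<..<n}" for i using image_Suc_atLeastLessThan[of "Suc i" n]
    by (simp add: atLeastSucLessThan_greaterThanLessThan)
  moreover have "{0<..<Suc n} = Suc ` {..<n}" using image_Suc_atLeastLessThan[of 0 n]
    by (simp add: atLeastSucLessThan_greaterThanLessThan atLeast0LessThan)
  ultimately show ?thesis unfolding prod.lessThan_Suc_shift by (simp add: prod.reindex)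
qed

text \<open>The Schur complement of a Cauchy matrix is again a Cauchy matrix with rescaled rows and
  columns; the scalars \<open>r\<close> and \<open>c\<close> supply the factors that involve the
  index 0.\<close>

lemma det_cauchy:
  fixes x y :: "nat \<Rightarrow> complex"
  assumes "\<And>i j. i < n \<Longrightarrow> j < n \<Longrightarrow> 1 - x i * y j \<noteq> 0"
  shows "det (mat n n (\<lambda>(i, j). 1 / (1 - x i * y j))) =
    (\<Prod>i<n. \<Prod>j\<in>{i<..<n}. (x i - x j) * (y i - y j)) / (\<Prod>i<n. \<Prod>j<n. 1 - x i * y j)"
  using assms
proof (induction n arbitrary: x y)
  case (Suc n)
  have nz: "1 - x i * y j \<noteq> 0" if "i < Suc n" "j < Suc n" for i j using Suc.prems that by blast
  define r where "r i = (x 0 - x (Suc i)) / (1 - x (Suc i) * y 0)" for i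
  define c where "c j = (y 0 - y (Suc j)) / (1 - x 0 * y (Suc j))" for j
  have e: "1 / (1 - x (Suc i) * y (Suc j)) - 1 / (1 - x (Suc i) * y 0) * (1 / (1 - x 0 * y (Suc j))) / (1 / (1 - x 0 * y 0))
     = r i * c j * (1 / (1 - x (Suc i) * y (Suc j)))" if "i < n" "j < n" for i j
  proof -
    have "1 - x (Suc i) * y (Suc j) \<noteq> 0" "1 - x (Suc i) * y 0 \<noteq> 0" "1 - x 0 * y (Suc j) \<noteq> 0" "1 - x 0 * y 0 \<noteq> 0"
      using nz that by auto
    then show ?thesis unfolding r_def c_def by (simp add: divide_simps) (simp add: algebra_simps)
  qed
  have "det (mat (Suc n) (Suc n) (\<lambda>(i, j). 1 / (1 - x i * y j))) = 1 / (1 - x 0 * y 0) *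
     det (mat n n (\<lambda>(i, j). 1 / (1 - x (Suc i) * y (Suc j)) - 1 / (1 - x (Suc i) * y 0) * (1 / (1 - x 0 * y (Suc j))) / (1 / (1 - x 0 * y 0))))"
    by (rule det_pivot) (use nz[of 0 0] in simp)
  also have "mat n n (\<lambda>(i, j). 1 / (1 - x (Suc i) * y (Suc j)) - 1 / (1 - x (Suc i) * y 0) * (1 / (1 - x 0 * y (Suc j))) / (1 / (1 - x 0 * y 0)))
     = mat n n (\<lambda>(i, j). r i * c j * (1 / (1 - x (Suc i) * y (Suc j))))"
    by (rule eq_matI) (simp_all add: e[simplified])
  also have "det \<dots> = (\<Prod>i<n. r i) * (\<Prod>j<n. c j) * det (mat n n (\<lambda>(i, j). 1 / (1 - x (Suc i) * y (Suc j))))"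
    by (rule det_scale_rows_cols)
  also have "det (mat n n (\<lambda>(i, j). 1 / (1 - x (Suc i) * y (Suc j)))) =
    (\<Prod>i<n. \<Prod>j\<in>{i<..<n}. (x (Suc i) - x (Suc j)) * (y (Suc i) - y (Suc j))) / (\<Prod>i<n. \<Prod>j<n. 1 - x (Suc i) * y (Suc j))"
    by (rule Suc.IH) (use nz in auto)
  finally show ?case
    unfolding prod_upper_Suc_shift prod.lessThan_Suc_shift r_def c_def prod_dividef prod.distrib
    by (simp add: mult_ac)
qed simp

text \<open>Multilinearity in the rows. In the Leibniz formula it is the expansion of a product of
  binomials over the subsets \<open>K\<close>.\<close>

lemma det_row_expansion:
  fixes a b :: "nat \<Rightarrow> complex" and f g :: "nat \<Rightarrow> nat \<Rightarrow> complex"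
  shows "det (mat n n (\<lambda>(i, j). a i * f i j + b i * g i j)) =
    (\<Sum>K\<in>Pow {..<n}. (\<Prod>i\<in>K. a i) * (\<Prod>i\<in>{..<n} - K. b i) * det (mat n n (\<lambda>(i, j). if i \<in> K then f i j else g i j)))"
proof -
  have mt: "(\<Prod>i = 0..<n. mat n n (\<lambda>(i, j). h i j) $$ (i, p i)) = (\<Prod>i<n. h i (p i))"
    if "p permutes {0..<n}" for p and h :: "nat \<Rightarrow> nat \<Rightarrow> complex"
    unfolding atLeast0LessThan[symmetric] by (rule prod.cong) (use permutes_in_image[OF that] in auto)
  have split: "(\<Prod>i<n. if i \<in> K then f i (p i) else g i (p i)) = (\<Prod>i\<in>K. f i (p i)) * (\<Prod>i\<in>{..<n} - K. g i (p i))"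
    if "K \<in> Pow {..<n}" for K p
  proof -
    have K: "K \<subseteq> {..<n}" using that by auto
    show ?thesis unfolding prod.subset_diff[OF K finite_lessThan] by (simp add: mult.commute)
  qed
  have "det (mat n n (\<lambda>(i, j). a i * f i j + b i * g i j)) =
    (\<Sum>p | p permutes {0..<n}. \<Sum>K\<in>Pow {..<n}. of_int (sign p) * ((\<Prod>i\<in>K. a i * f i (p i)) * (\<Prod>i\<in>{..<n} - K. b i * g i (p i))))"
    unfolding det_def'[OF mat_carrier] sum_distrib_left[symmetric]
    by (intro sum.cong refl) (simp add: mt prod_add atLeast0LessThan)
  also have "\<dots> = (\<Sum>K\<in>Pow {..<n}. \<Sum>p | p permutes {0..<n}. of_int (sign p) * ((\<Prod>i\<in>K. a i * f i (p i)) * (\<Prod>i\<in>{..<n} - K. b i * g i (p i))))"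
    by (rule sum.swap)
  also have "\<dots> = (\<Sum>K\<in>Pow {..<n}. (\<Prod>i\<in>K. a i) * (\<Prod>i\<in>{..<n} - K. b i) * det (mat n n (\<lambda>(i, j). if i \<in> K then f i j else g i j)))"
    unfolding det_def'[OF mat_carrier] sum_distrib_left
    by (intro sum.cong refl) (simp add: mt split prod.distrib mult_ac atLeast0LessThan)
  finally show ?thesis .
qed

text \<open>A pair inside \<open>K\<close> contributes 1, a pair outside \<open>K\<close>
  contributes \<open>q\<close>, and a mixed pair gives a factor of \<open>cross\<close> in whichever
  order its indices come. \<open>K\<close> is an arbitrary set so that it can stay fixed in the
  induction on \<open>n\<close>.\<close>

lemma vandermonde_ratio:
  fixes u :: "nat \<Rightarrow> complex" and q :: complex
  assumes "inj_on u {..<n}"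
  defines "x \<equiv> \<lambda>K i. if i \<in> K then u i else q * u i"
  shows "(\<Prod>i<n. \<Prod>j\<in>{i<..<n}. (x K i - x K j) / (u i - u j)) =
    cross q u (K \<inter> {..<n}) ({..<n} - K) * q ^ (card ({..<n} - K) choose 2)"
  using assms(1)
proof (induction n)
  case (Suc n)
  have inj: "inj_on u {..<n}" using Suc.prems by (auto simp: inj_on_def)
  have ne: "u i \<noteq> u n" if "i < n" for i using Suc.prems that by (auto simp: inj_on_def)
  have P: "(\<Prod>i<n. h i) = (\<Prod>i\<in>K \<inter> {..<n}. h i) * (\<Prod>i\<in>{..<n} - K. h i)" for h :: "nat \<Rightarrow> complex"
    by (subst prod.Int_Diff[of _ _ K]) (auto simp: Int_commute)
  have fin: "finite (K \<inter> {..<n})" "finite ({..<n} - K)" and n: "n \<notin> K \<inter> {..<n}" "n \<notin> {..<n} - K" by auto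
  show ?case
  proof (cases "n \<in> K")
    case True
    have 1: "(\<Prod>i\<in>K \<inter> {..<n}. (x K i - x K n) / (u i - u n)) = 1"
      using True ne by (intro prod.neutral) (auto simp: x_def)
    have "(q * u i - u n) / (u i - u n) = (u n - q * u i) / (u n - u i)" for i
      by (metis minus_diff_eq minus_divide_divide)
    then have 2: "(\<Prod>i\<in>{..<n} - K. (x K i - x K n) / (u i - u n)) = (\<Prod>i\<in>{..<n} - K. u n - q * u i) / (\<Prod>i\<in>{..<n} - K. u n - u i)"
      using True unfolding prod_dividef[symmetric] by (intro prod.cong) (auto simp: x_def)
    have s: "K \<inter> {..<Suc n} = insert n (K \<inter> {..<n})" "{..<Suc n} - K = {..<n} - K"
      using True by (auto simp: lessThan_Suc)
    show ?thesis unfolding prod_upper_Suc Suc.IH[OF inj] P[of "\<lambda>i. (x K i - x K n) / (u i - u n)"] 1 2 s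
      cross_insert_left[OF fin(1) n(1)] by simp
  next
    case False
    have "(u i - q * u n) / (u i - u n) = (q * u n - u i) / (u n - u i)" for i
      by (metis minus_diff_eq minus_divide_divide)
    then have 1: "(\<Prod>i\<in>K \<inter> {..<n}. (x K i - x K n) / (u i - u n)) = (\<Prod>i\<in>K \<inter> {..<n}. q * u n - u i) / (\<Prod>i\<in>K \<inter> {..<n}. u n - u i)"
      using False unfolding prod_dividef[symmetric] by (intro prod.cong) (auto simp: x_def)
    have "(q * u i - q * u n) / (u i - u n) = q" if "i < n" for i
      using ne[OF that] by (simp add: right_diff_distrib[symmetric])
    then have 2: "(\<Prod>i\<in>{..<n} - K. (x K i - x K n) / (u i - u n)) = q ^ card ({..<n} - K)"
      using False by (simp add: x_def)
    have s: "K \<inter> {..<Suc n} = K \<inter> {..<n}" "{..<Suc n} - K = insert n ({..<n} - K)"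
      using False by (auto simp: lessThan_Suc)
    show ?thesis unfolding prod_upper_Suc Suc.IH[OF inj] P[of "\<lambda>i. (x K i - x K n) / (u i - u n)"] 1 2 s
      cross_insert_right[OF fin(2) n(2)] card_insert_disjoint[OF fin(2) n(2)] Suc_choose_two power_add by simp
  qed
qed (simp add: cross_def)

lemma vandermonde_nonzero:
  fixes u :: "nat \<Rightarrow> complex"
  assumes "inj_on u {..<n}"
  shows "(\<Prod>i<n. \<Prod>j\<in>{i<..<n}. (u i - u j)) \<noteq> 0"
proof -
  have "u i - u j \<noteq> 0" if "i < n" "j \<in> {i<..<n}" for i j
    using inj_onD[OF assms, of i j] that by auto
  then show ?thesis by (simp add: prod_zero_iff)
qed

text \<open>Both summands of an entry are Cauchy entries, with node u i or q * u i. Each term of the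
  row expansion is thus a Cauchy determinant in mixed nodes, whose Vandermonde product
  \<open>vandermonde_ratio\<close> compares with that of \<open>u\<close>.\<close>

lemma det_eq_Rsum:
  fixes u v :: "nat \<Rightarrow> complex"
  assumes inj: "inj_on u {..<n}" "inj_on v {..<n}"
    and uv: "\<And>i j. i < n \<Longrightarrow> j < n \<Longrightarrow> 1 - u i * v j \<noteq> 0"
    and quv: "\<And>i j. i < n \<Longrightarrow> j < n \<Longrightarrow> 1 - q * u i * v j \<noteq> 0"
  shows "(\<Prod>i<n. \<Prod>j<n. 1 - q * u i * v j) / (\<Prod>i<n. \<Prod>j\<in>{i<..<n}. (u i - u j) * (v i - v j)) *
    det (mat n n (\<lambda>(i, j). a i * (1 / (1 - u i * v j)) + b i * (1 / (1 - q * u i * v j)))) =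
    Rsum q u v a b {..<n} {..<n}"
  unfolding det_row_expansion Rsum_def sum_distrib_left
proof (intro sum.cong refl, goal_cases)
  case (1 K)
  then have K: "K \<subseteq> {..<n}" "K \<inter> {..<n} = K" by auto
  define x where "x i = (if i \<in> K then u i else q * u i)" for i
  have nz: "1 - x i * v j \<noteq> 0" if "i < n" "j < n" for i j
    using that uv quv unfolding x_def by auto
  have m: "mat n n (\<lambda>(i, j). if i \<in> K then 1 / (1 - u i * v j) else 1 / (1 - q * u i * v j)) = mat n n (\<lambda>(i, j). 1 / (1 - x i * v j))"
    by (rule eq_matI) (auto simp: x_def)
  have V: "(\<Prod>i<n. \<Prod>j\<in>{i<..<n}. (x i - x j)) = cross q u K ({..<n} - K) * q ^ (card ({..<n} - K) choose 2) * (\<Prod>i<n. \<Prod>j\<in>{i<..<n}. (u i - u j))"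
  proof -
    show ?thesis using vandermonde_nonzero[OF inj(1)] vandermonde_ratio[OF inj(1), of K q] unfolding x_def[symmetric] K(2)
      by (simp add: prod_dividef field_simps)
  qed
  have "(\<Prod>j<n. (1 - q * u i * v j) / (1 - x i * v j)) = (if i \<in> K then \<Prod>j<n. ratio q (u i) (v j) else 1)" if "i < n" for i
    using that quv by (auto simp: x_def ratio_def)
  then have "(\<Prod>i<n. \<Prod>j<n. (1 - q * u i * v j) / (1 - x i * v j)) = (\<Prod>i<n. if i \<in> K then \<Prod>j<n. ratio q (u i) (v j) else 1)"
    by simp
  also have "\<dots> = (\<Prod>i\<in>K. \<Prod>j<n. ratio q (u i) (v j))"
    using prod.subset_diff[OF K(1) finite_lessThan, of "\<lambda>i. if i \<in> K then \<Prod>j<n. ratio q (u i) (v j) else 1"] by simp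
  finally have R: "(\<Prod>i<n. \<Prod>j<n. 1 - q * u i * v j) / (\<Prod>i<n. \<Prod>j<n. 1 - x i * v j) = (\<Prod>i\<in>K. \<Prod>j<n. ratio q (u i) (v j))"
    by (simp add: prod_dividef)
  have du: "(\<Prod>i<n. \<Prod>j\<in>{i<..<n}. (u i - u j)) \<noteq> 0" "(\<Prod>i<n. \<Prod>j\<in>{i<..<n}. (v i - v j)) \<noteq> 0"
    by (rule vandermonde_nonzero[OF inj(1)], rule vandermonde_nonzero[OF inj(2)])
  have D: "det (mat n n (\<lambda>(i, j). if i \<in> K then 1 / (1 - u i * v j) else 1 / (1 - q * u i * v j))) =
     cross q u K ({..<n} - K) * q ^ (card ({..<n} - K) choose 2) * (\<Prod>i<n. \<Prod>j\<in>{i<..<n}. (u i - u j)) * (\<Prod>i<n. \<Prod>j\<in>{i<..<n}. (v i - v j)) / (\<Prod>i<n. \<Prod>j<n. 1 - x i * v j)"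
  proof -
    have "det (mat n n (\<lambda>(i, j). 1 / (1 - x i * v j))) =
      (\<Prod>i<n. \<Prod>j\<in>{i<..<n}. (x i - x j) * (v i - v j)) / (\<Prod>i<n. \<Prod>j<n. 1 - x i * v j)"
      by (rule det_cauchy[OF nz])
    then show ?thesis unfolding m prod.distrib V .
  qed
  show ?case
    unfolding D prod.distrib R[symmetric] using du by simp
qed

subsection \<open>Removing the genericity assumptions\<close>

lemma isCont_if_const:
  fixes f :: "complex \<Rightarrow> complex"
  shows "(P \<Longrightarrow> isCont f x) \<Longrightarrow> isCont (\<lambda>e. if P then f e else 0) x"
  by (cases P) auto

lemma isCont_cross:
  fixes u :: "complex \<Rightarrow> 'i \<Rightarrow> complex"
  assumes "\<And>i. i \<in> X \<union> Y \<Longrightarrow> isCont (\<lambda>e. u e i) x" "\<And>i j. i \<in> X \<Longrightarrow> j \<in> Y \<Longrightarrow> u x i \<noteq> u x j"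
  shows "isCont (\<lambda>e. cross q (u e) X Y) x"
  unfolding cross_def using assms by (intro continuous_intros) auto

lemma isCont_Rsum:
  fixes u :: "complex \<Rightarrow> 'i \<Rightarrow> complex" and v :: "complex \<Rightarrow> 'j \<Rightarrow> complex"
  assumes "\<And>i. i \<in> A \<Longrightarrow> isCont (\<lambda>e. u e i) x" "\<And>j. j \<in> B \<Longrightarrow> isCont (\<lambda>e. v e j) x"
    "inj_on (u x) A" "\<And>i j. i \<in> A \<Longrightarrow> j \<in> B \<Longrightarrow> 1 - u x i * v x j \<noteq> 0"
  shows "isCont (\<lambda>e. Rsum q (u e) (v e) a b A B) x"
  unfolding Rsum_def ratio_def using assms
  by (intro continuous_intros isCont_cross) (auto simp: inj_on_def subset_iff)

lemma isCont_Esum: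
  fixes u :: "complex \<Rightarrow> 'i \<Rightarrow> complex" and v :: "complex \<Rightarrow> 'j \<Rightarrow> complex"
  assumes u: "\<And>i. i \<in> A \<Longrightarrow> isCont (\<lambda>e. u e i) x" and v: "\<And>j. j \<in> B \<Longrightarrow> isCont (\<lambda>e. v e j) x"
    and s: "isCont s x" and c: "\<And>m. isCont (\<lambda>e. c e m) x"
    and inj: "inj_on (u x) A" "inj_on (v x) B" and uv: "\<And>i j. i \<in> A \<Longrightarrow> j \<in> B \<Longrightarrow> 1 - u x i * v x j \<noteq> 0"
  shows "isCont (\<lambda>e. Esum q (s e) (c e) (u e) (v e) A B) x"
proof -
  have D: "isCont (\<lambda>e. Dsum q (u e) (v e) I J) x" if "I \<subseteq> A" "J \<subseteq> B" for I J
    unfolding Dsum_def by (intro isCont_Rsum) (use that u v inj uv in \<open>blast intro: inj_on_subset\<close>)+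
  have cu: "isCont (\<lambda>e. cross q (u e) I (A - I)) x" if "I \<subseteq> A" for I
    using that u inj by (intro isCont_cross) (auto simp: inj_on_def subset_iff)
  have cv: "isCont (\<lambda>e. cross q (v e) J (B - J)) x" if "J \<subseteq> B" for J
    using that v inj by (intro isCont_cross) (auto simp: inj_on_def subset_iff)
  show ?thesis unfolding Esum_def
    by (intro continuous_sum isCont_if_const continuous_mult continuous_prod continuous_diff c s cu cv D u v) auto
qed

lemma isCont_det:
  fixes M :: "complex \<Rightarrow> nat \<Rightarrow> nat \<Rightarrow> complex"
  assumes "\<And>i j. i < n \<Longrightarrow> j < n \<Longrightarrow> isCont (\<lambda>e. M e i j) x"
  shows "isCont (\<lambda>e. det (mat n n (\<lambda>(i, j). M e i j))) x"
proof -
  have "(\<Prod>i = 0..<n. mat n n (\<lambda>(i, j). h i j) $$ (i, p i)) = (\<Prod>i = 0..<n. h i (p i))"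
    if "p permutes {0..<n}" for p and h :: "nat \<Rightarrow> nat \<Rightarrow> complex"
    using permutes_in_image[OF that] by (intro prod.cong) auto
  then have *: "det (mat n n (\<lambda>(i, j). h i j)) = (\<Sum>p | p permutes {0..<n}. of_int (sign p) * (\<Prod>i = 0..<n. h i (p i)))"
    for h :: "nat \<Rightarrow> nat \<Rightarrow> complex"
    unfolding det_def'[OF mat_carrier] by (intro sum.cong refl) simp
  show ?thesis unfolding *
  proof (intro continuous_sum continuous_mult continuous_const continuous_prod)
    fix p i assume "p \<in> {p. p permutes {0..<n}}" "i \<in> {0..<n}"
    then show "isCont (\<lambda>e. M e i (p i)) x" using assms[of i "p i"] permutes_in_image[of p "{0..<n}" i] by auto
  qed
qed

lemma eventually_poly_nonzero:
  fixes p :: "complex poly"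
  assumes "p \<noteq> 0"
  shows "eventually (\<lambda>e. poly p e \<noteq> 0) (at x)"
proof -
  have "\<not> x islimpt {e. poly p e = 0}"
    using poly_roots_finite[OF assms] by (rule islimpt_finite)
  then show ?thesis unfolding islimpt_iff_eventually by simp
qed

text \<open>Both sides are continuous along \<open>u + e\<close>, \<open>v + e\<close>, \<open>s - e\<close>, and generic for small \<open>e \<noteq> 0\<close>.\<close>

lemma Esum_eq_det:
  fixes u v :: "nat \<Rightarrow> complex"
  assumes q0: "q \<noteq> 0" and qinj: "inj (\<lambda>k. q ^ k)" and g0: "\<gamma> \<noteq> 0"
    and inj: "inj_on u {..<n}" "inj_on v {..<n}"
    and uv: "\<And>i j. i < n \<Longrightarrow> j < n \<Longrightarrow> 1 - u i * v j \<noteq> 0"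
    and quv: "\<And>i j. i < n \<Longrightarrow> j < n \<Longrightarrow> 1 - q * u i * v j \<noteq> 0"
  shows "Esum q s (cweight q s \<gamma>) u v {..<n} {..<n} =
    (\<Prod>i<n. \<Prod>j<n. 1 - q * u i * v j) / (\<Prod>i<n. \<Prod>j\<in>{i<..<n}. (u i - u j) * (v i - v j)) *
    det (mat n n (\<lambda>(i, j). ((1 - \<gamma>) * (q - s\<^sup>2 / \<gamma>) * (1 - u i * v j) + (1 - q) * (1 - s * u i) * (1 - s * v j)) /
       ((1 - u i * v j) * (1 - q * u i * v j))))"
proof -
  define L where "L e = Esum q (s - e) (cweight q (s - e) \<gamma>) (\<lambda>i. u i + e) (\<lambda>j. v j + e) {..<n} {..<n}" for e
  \<comment> \<open>The Vandermonde denominators contain no e: a common translation does not change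
    differences. For the same reason the shifted variables stay distinct.\<close>
  define R where "R e = (\<Prod>i<n. \<Prod>j<n. 1 - q * (u i + e) * (v j + e)) / (\<Prod>i<n. \<Prod>j\<in>{i<..<n}. (u i - u j) * (v i - v j)) *
    det (mat n n (\<lambda>(i, j). ((1 - \<gamma>) * (q - (s - e)\<^sup>2 / \<gamma>) * (1 - (u i + e) * (v j + e)) + (1 - q) * (1 - (s - e) * (u i + e)) * (1 - (s - e) * (v j + e))) /
       ((1 - (u i + e) * (v j + e)) * (1 - q * (u i + e) * (v j + e)))))" for e
  have "isCont L 0"
    unfolding L_def cweight_def qpoch_def
    using inj uv g0 by (intro isCont_Esum continuous_intros) (auto simp: inj_on_def)
  then have Llim: "(L \<longlongrightarrow> L 0) (at 0)" by (simp add: isCont_def)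
  have "isCont (\<lambda>e. ((1 - \<gamma>) * (q - (s - e)\<^sup>2 / \<gamma>) * (1 - (u i + e) * (v j + e)) + (1 - q) * (1 - (s - e) * (u i + e)) * (1 - (s - e) * (v j + e))) /
       ((1 - (u i + e) * (v j + e)) * (1 - q * (u i + e) * (v j + e)))) 0" if "i < n" "j < n" for i j
    using uv[OF that] quv[OF that] g0 by (intro continuous_intros) simp_all
  then have det: "isCont (\<lambda>e. det (mat n n (\<lambda>(i, j). ((1 - \<gamma>) * (q - (s - e)\<^sup>2 / \<gamma>) * (1 - (u i + e) * (v j + e)) + (1 - q) * (1 - (s - e) * (u i + e)) * (1 - (s - e) * (v j + e))) /
       ((1 - (u i + e) * (v j + e)) * (1 - q * (u i + e) * (v j + e)))))) 0"
    by (rule isCont_det)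
  have "isCont (\<lambda>e. (\<Prod>i<n. \<Prod>j<n. 1 - q * (u i + e) * (v j + e)) * inverse (\<Prod>i<n. \<Prod>j\<in>{i<..<n}. (u i - u j) * (v i - v j))) 0"
    by (intro continuous_intros)
  then have "isCont R 0"
    unfolding R_def divide_inverse[of "prod _ _"] by (rule continuous_mult[OF _ det])
  then have Rlim: "(R \<longlongrightarrow> R 0) (at 0)" by (simp add: isCont_def)
  have ev_lin: "eventually (\<lambda>e. c + e \<noteq> 0) (at 0)" for c :: complex
    using eventually_poly_nonzero[of "[:c, 1:]"] by simp
  have 1: "eventually (\<lambda>e. \<forall>i\<in>{..<n}. u i + e \<noteq> 0) (at 0)"
    by (intro eventually_ball_finite) (auto simp: ev_lin)
  have 2: "eventually (\<lambda>e. \<forall>i\<in>{..<n}. v i + e \<noteq> 0) (at 0)"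
    by (intro eventually_ball_finite) (auto simp: ev_lin)
  have 3: "eventually (\<lambda>e. s - e \<noteq> 0) (at 0)"
    using eventually_poly_nonzero[of "[:s, -1:]"] by simp
  \<comment> \<open>The coefficient - c of e ^ 2 is nonzero, so this is not the zero polynomial,
    whatever x and y are.\<close>
  have ev_uv: "eventually (\<lambda>e. 1 - c * (x + e) * (y + e) \<noteq> 0) (at 0)" if "c \<noteq> 0" for c x y :: complex
    using eventually_poly_nonzero[of "[:1 - c * x * y, - c * (x + y), - c:]"] that
    by (simp add: algebra_simps)
  have 4: "eventually (\<lambda>e. \<forall>i\<in>{..<n}. \<forall>j\<in>{..<n}. 1 - (u i + e) * (v j + e) \<noteq> 0) (at 0)"
    using ev_uv[of 1] by (intro eventually_ball_finite ballI) auto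
  have 5: "eventually (\<lambda>e. \<forall>i\<in>{..<n}. \<forall>j\<in>{..<n}. 1 - q * (u i + e) * (v j + e) \<noteq> 0) (at 0)"
    using ev_uv[OF q0] by (intro eventually_ball_finite ballI) auto
  have "eventually (\<lambda>e. 1 - (s - e) * c * (y + e) \<noteq> 0) (at 0)" if "c \<noteq> 0" for c y :: complex
    using eventually_poly_nonzero[of "[:1 - c * s * y, - c * (s - y), c:]"] that
    by (simp add: algebra_simps)
  then have 6: "eventually (\<lambda>e. \<forall>k\<in>{..<n}. \<forall>j\<in>{..<n}. 1 - (s - e) * q ^ k * (v j + e) \<noteq> 0) (at 0)"
    using q0 by (intro eventually_ball_finite ballI) auto
  have "eventually (\<lambda>e. L e = R e) (at 0)"
    using 1 2 3 4 5 6
  proof eventually_elim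
    case (elim e)
    define s' where "s' = s - e"
    define x where "x i = u i + e" for i
    define y where "y i = v i + e" for i
    define \<alpha> where "\<alpha> = (1 - \<gamma>) * (q - s'\<^sup>2 / \<gamma>)"
    have inj': "inj_on x {..<n}" "inj_on y {..<n}" using inj by (auto simp: x_def y_def inj_on_def)
    have xy: "1 - x i * y j \<noteq> 0" "1 - q * x i * y j \<noteq> 0" if "i < n" "j < n" for i j
      using elim that by (auto simp: x_def y_def)
    have "gap q s' (cweight q s' \<gamma>) \<alpha> y {..<n} {..<n} x = 0"
      unfolding \<alpha>_def
      by (rule gap_generic[OF q0 qinj _ g0, where n=n]) (use elim inj' in \<open>auto simp: s'_def x_def y_def\<close>)
    then have "Esum q s' (cweight q s' \<gamma>) x y {..<n} {..<n} =
      Rsum q x y (\<lambda>i. acoef s' (x i)) (\<lambda>i. bcoef q s' \<alpha> (x i)) {..<n} {..<n}"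
      unfolding gap_def by simp
    also have "\<dots> = (\<Prod>i<n. \<Prod>j<n. 1 - q * x i * y j) / (\<Prod>i<n. \<Prod>j\<in>{i<..<n}. (x i - x j) * (y i - y j)) *
      det (mat n n (\<lambda>(i, j). acoef s' (x i) * (1 / (1 - x i * y j)) + bcoef q s' \<alpha> (x i) * (1 / (1 - q * x i * y j))))"
      by (rule det_eq_Rsum[OF inj' xy, symmetric])
    also have "mat n n (\<lambda>(i, j). acoef s' (x i) * (1 / (1 - x i * y j)) + bcoef q s' \<alpha> (x i) * (1 / (1 - q * x i * y j))) =
      mat n n (\<lambda>(i, j). (\<alpha> * (1 - x i * y j) + (1 - q) * (1 - s' * x i) * (1 - s' * y j)) / ((1 - x i * y j) * (1 - q * x i * y j)))"
    proof (rule eq_matI, goal_cases)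
      case (1 i j)
      then have ij: "i < n" "j < n" by auto
      have x0: "x i \<noteq> 0" using elim ij by (simp add: x_def)
      have "acoef s' (x i) * (1 - q * x i * y j) + bcoef q s' \<alpha> (x i) * (1 - x i * y j) =
        \<alpha> * (1 - x i * y j) + (1 - q) * (1 - s' * x i) * (1 - s' * y j)"
        unfolding acoef_def bcoef_def using x0 by (simp add: field_simps)
      then show ?case using ij xy[OF ij] by (simp add: divide_simps)
    qed auto
    finally show "L e = R e"
      unfolding L_def R_def \<alpha>_def x_def y_def s'_def by simp
  qed
  then have "(L \<longlongrightarrow> R 0) (at 0)" using Rlim by (simp add: tendsto_cong)
  then have "L 0 = R 0" using tendsto_unique[OF _ Llim] by simp
  then show ?thesis unfolding L_def R_def by simp
qed

subsection \<open>Relabelling\<close>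

lemma cross_reindex:
  "inj_on e X \<Longrightarrow> inj_on e Y \<Longrightarrow> cross q (\<lambda>i. u (e i)) X Y = cross q u (e ` X) (e ` Y)"
  unfolding cross_def by (simp add: prod.reindex)

lemma sum_Pow_reindex:
  assumes "inj_on e A"
  shows "(\<Sum>K\<in>Pow (e ` A). f K) = (\<Sum>K\<in>Pow A. f (e ` K))"
  unfolding image_Pow_surj[OF refl, of e A, symmetric] by (simp add: sum.reindex[OF inj_on_image_Pow[OF assms]])

lemma Rsum_reindex:
  assumes e: "inj_on e A" and f: "inj_on f B"
  shows "Rsum q (\<lambda>i. u (e i)) (\<lambda>j. v (f j)) (\<lambda>i. a (e i)) (\<lambda>i. b (e i)) A B = Rsum q u v a b (e ` A) (f ` B)"
  unfolding Rsum_def sum_Pow_reindex[OF e]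
proof (intro sum.cong refl, goal_cases)
  case (1 K)
  then have K: "K \<subseteq> A" by auto
  have inj: "inj_on e K" "inj_on e (A - K)" using e K by (auto intro: inj_on_subset)
  have d: "e ` A - e ` K = e ` (A - K)" using inj_on_image_set_diff[OF e _ K, of A] by simp
  show ?case
    unfolding d cross_reindex[OF inj] using inj f by (simp add: prod.reindex card_image)
qed

lemma Dsum_reindex:
  "inj_on e A \<Longrightarrow> inj_on f B \<Longrightarrow> Dsum q (\<lambda>i. u (e i)) (\<lambda>j. v (f j)) A B = Dsum q u v (e ` A) (f ` B)"
  unfolding Dsum_def using Rsum_reindex[of e A f B q u v "\<lambda>_. 1" "\<lambda>_. - q"] by simp

lemma Esum_reindex:
  assumes e: "inj_on e A" and f: "inj_on f B"
  shows "Esum q s c (\<lambda>i. u (e i)) (\<lambda>j. v (f j)) A B = Esum q s c u v (e ` A) (f ` B)"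
  unfolding Esum_def sum_Pow_reindex[OF e] sum_Pow_reindex[OF f]
proof (intro sum.cong refl, goal_cases)
  case (1 I J)
  then have I: "I \<subseteq> A" and J: "J \<subseteq> B" by auto
  have inj: "inj_on e I" "inj_on e (A - I)" "inj_on f J" "inj_on f (B - J)"
    using e f I J by (auto intro: inj_on_subset)
  have d: "e ` A - e ` I = e ` (A - I)" "f ` B - f ` J = f ` (B - J)"
    using inj_on_image_set_diff[OF e _ I, of A] inj_on_image_set_diff[OF f _ J, of B] by simp_all
  show ?case
    unfolding d cross_reindex[OF inj(1,2)] cross_reindex[OF inj(3,4)] Dsum_reindex[OF inj(1,3)]
    using inj by (simp add: prod.reindex card_image)
qed

text \<open>At \<gamma> = 1 the numerator of an entry is (1 - q) * (1 - s * u i) * (1 - s * v j);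
  the last two are a row and a column factor, and the determinant left over is that of
  \<open>Dsum\<close>. General finite index sets are needed since the recursion descends to
  subsets.\<close>

lemma Esum_one:
  fixes u :: "'i \<Rightarrow> complex" and v :: "'j \<Rightarrow> complex"
  assumes q0: "q \<noteq> 0" and qinj: "inj (\<lambda>k. q ^ k)"
    and fin: "finite A" "finite B" and card: "card A = card B"
    and inj: "inj_on u A" "inj_on v B"
    and uv: "\<And>i j. i \<in> A \<Longrightarrow> j \<in> B \<Longrightarrow> 1 - u i * v j \<noteq> 0"
    and quv: "\<And>i j. i \<in> A \<Longrightarrow> j \<in> B \<Longrightarrow> 1 - q * u i * v j \<noteq> 0"
  shows "Esum q s (cweight q s 1) u v A B = (\<Prod>i\<in>A. 1 - s * u i) * (\<Prod>j\<in>B. 1 - s * v j) * Dsum q u v A B"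
proof -
  define n where "n = card A"
  obtain e where e: "bij_betw e {..<n} A"
    using ex_bij_betw_nat_finite[OF fin(1)] unfolding n_def by (auto simp: atLeast0LessThan)
  obtain f where f: "bij_betw f {..<n} B"
    using ex_bij_betw_nat_finite[OF fin(2)] unfolding n_def card by (auto simp: atLeast0LessThan)
  have e': "inj_on e {..<n}" "e ` {..<n} = A" and f': "inj_on f {..<n}" "f ` {..<n} = B"
    using e f unfolding bij_betw_def by auto
  have eA: "\<And>i. i < n \<Longrightarrow> e i \<in> A" and fB: "\<And>i. i < n \<Longrightarrow> f i \<in> B" using e' f' by auto
  define x where "x i = u (e i)" for i
  define y where "y i = v (f i)" for i
  have inj': "inj_on x {..<n}" "inj_on y {..<n}"
    using comp_inj_on[OF e'(1)] comp_inj_on[OF f'(1)] inj unfolding e' f' x_def y_def comp_def by auto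
  have xy: "1 - x i * y j \<noteq> 0" "1 - q * x i * y j \<noteq> 0" if "i < n" "j < n" for i j
    using uv quv eA fB that unfolding x_def y_def by auto
  have "Esum q s (cweight q s 1) u v A B = Esum q s (cweight q s 1) x y {..<n} {..<n}"
    using Esum_reindex[OF e'(1) f'(1), of q s _ u v] unfolding x_def y_def e' f' by simp
  also have "\<dots> = (\<Prod>i<n. \<Prod>j<n. 1 - q * x i * y j) / (\<Prod>i<n. \<Prod>j\<in>{i<..<n}. (x i - x j) * (y i - y j)) *
    det (mat n n (\<lambda>(i, j). ((1 - 1) * (q - s\<^sup>2 / 1) * (1 - x i * y j) + (1 - q) * (1 - s * x i) * (1 - s * y j)) /
       ((1 - x i * y j) * (1 - q * x i * y j))))"
    by (rule Esum_eq_det[OF q0 qinj _ inj' xy]) auto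
  also have "mat n n (\<lambda>(i, j). ((1 - 1) * (q - s\<^sup>2 / 1) * (1 - x i * y j) + (1 - q) * (1 - s * x i) * (1 - s * y j)) /
       ((1 - x i * y j) * (1 - q * x i * y j))) =
    mat n n (\<lambda>(i, j). (1 - s * x i) * (1 - s * y j) * (1 * (1 / (1 - x i * y j)) + (- q) * (1 / (1 - q * x i * y j))))"
  proof (rule eq_matI, goal_cases)
    case (1 i j)
    then have ij: "i < n" "j < n" by auto
    show ?case using ij xy[OF ij] by (simp add: divide_simps) (simp add: algebra_simps)
  qed auto
  also have "det \<dots> = (\<Prod>i<n. 1 - s * x i) * (\<Prod>j<n. 1 - s * y j) *
    det (mat n n (\<lambda>(i, j). 1 * (1 / (1 - x i * y j)) + (- q) * (1 / (1 - q * x i * y j))))"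
    by (rule det_scale_rows_cols)
  also have "(\<Prod>i<n. \<Prod>j<n. 1 - q * x i * y j) / (\<Prod>i<n. \<Prod>j\<in>{i<..<n}. (x i - x j) * (y i - y j)) *
     ((\<Prod>i<n. 1 - s * x i) * (\<Prod>j<n. 1 - s * y j) *
    det (mat n n (\<lambda>(i, j). 1 * (1 / (1 - x i * y j)) + (- q) * (1 / (1 - q * x i * y j))))) =
    (\<Prod>i<n. 1 - s * x i) * (\<Prod>j<n. 1 - s * y j) * Dsum q x y {..<n} {..<n}"
  proof -
    have "(\<Prod>i<n. \<Prod>j<n. 1 - q * x i * y j) / (\<Prod>i<n. \<Prod>j\<in>{i<..<n}. (x i - x j) * (y i - y j)) *
      det (mat n n (\<lambda>(i, j). 1 * (1 / (1 - x i * y j)) + (- q) * (1 / (1 - q * x i * y j)))) = Dsum q x y {..<n} {..<n}"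
      unfolding Dsum_def by (rule det_eq_Rsum[OF inj' xy])
    moreover have "X * d = D \<Longrightarrow> X * (P * Q * d) = P * Q * D" for X d D P Q :: complex
      by (auto simp: mult_ac)
    ultimately show ?thesis by blast
  qed
  also have "Dsum q x y {..<n} {..<n} = Dsum q u v A B"
    using Dsum_reindex[OF e'(1) f'(1), of q u v] unfolding x_def y_def e' f' by simp
  also have "(\<Prod>i<n. 1 - s * x i) = (\<Prod>i\<in>A. 1 - s * u i)"
    unfolding x_def by (rule prod.reindex_bij_betw[OF e])
  also have "(\<Prod>i<n. 1 - s * y i) = (\<Prod>i\<in>B. 1 - s * v i)"
    unfolding y_def by (rule prod.reindex_bij_betw[OF f])
  finally show ?thesis .
qed

subsection \<open>Symmetrization over a finite index set\<close>

text \<open>Symmetrization over an index set other than an initial segment: the variable of the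
  first function is chosen first and brings along its factors with all remaining variables. In this
  form splitting into blocks becomes an induction.\<close>

fun symm :: "complex \<Rightarrow> ('i \<Rightarrow> complex) \<Rightarrow> (complex \<Rightarrow> complex) list \<Rightarrow> 'i set \<Rightarrow> complex" where
  "symm q u [] A = 1"
| "symm q u (f # fs) A = (\<Sum>k\<in>A. f (u k) * (\<Prod>j\<in>A - {k}. (u k - q * u j) / (u k - u j)) * symm q u fs (A - {k}))"

definition pcoef :: "complex \<Rightarrow> ('i \<Rightarrow> complex) \<Rightarrow> 'i list \<Rightarrow> complex" where
  "pcoef q u xs = (\<Prod>i<length xs. \<Prod>j\<in>{i<..<length xs}. (u (xs ! i) - q * u (xs ! j)) / (u (xs ! i) - u (xs ! j)))"

lemma prod_set_distinct: "distinct xs \<Longrightarrow> (\<Prod>x\<in>set xs. f x) = (\<Prod>j<length xs. f (xs ! j))"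
  by (rule prod.reindex_bij_betw[symmetric]) (rule bij_betw_nth; simp)

lemma pcoef_Cons:
  assumes "distinct (x # xs)"
  shows "pcoef q u (x # xs) = (\<Prod>j\<in>set xs. (u x - q * u j) / (u x - u j)) * pcoef q u xs"
  using assms unfolding pcoef_def length_Cons prod_upper_Suc_shift by (simp add: prod_set_distinct)

lemma symm_eq_perms:
  assumes "finite A" "card A = length fs"
  shows "symm q u fs A = (\<Sum>xs\<in>permutations_of_set A. pcoef q u xs * (\<Prod>i<length fs. (fs ! i) (u (xs ! i))))"
  using assms
proof (induction fs arbitrary: A)
  case Nil
  then show ?case by (simp add: pcoef_def)
next
  case (Cons f fs)
  have ne: "A \<noteq> {}" and fin: "finite A" using Cons.prems by auto
  have IH: "symm q u fs (A - {k}) = (\<Sum>xs\<in>permutations_of_set (A - {k}). pcoef q u xs * (\<Prod>i<length fs. (fs ! i) (u (xs ! i))))"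
    if "k \<in> A" for k by (rule Cons.IH) (use Cons.prems that in auto)
  have "(\<Sum>xs\<in>permutations_of_set A. pcoef q u xs * (\<Prod>i<length (f # fs). ((f # fs) ! i) (u (xs ! i)))) =
    (\<Sum>k\<in>A. \<Sum>xs\<in>(#) k ` permutations_of_set (A - {k}). pcoef q u xs * (\<Prod>i<length (f # fs). ((f # fs) ! i) (u (xs ! i))))"
    unfolding permutations_of_set_nonempty[OF ne] using fin by (intro sum.UNION_disjoint) auto
  also have "\<dots> = (\<Sum>k\<in>A. \<Sum>xs\<in>permutations_of_set (A - {k}). pcoef q u (k # xs) * (\<Prod>i<length (f # fs). ((f # fs) ! i) (u ((k # xs) ! i))))"
    by (intro sum.cong refl sum.reindex_cong[where l="(#) _"]) auto
  also have "\<dots> = (\<Sum>k\<in>A. f (u k) * (\<Prod>j\<in>A - {k}. (u k - q * u j) / (u k - u j)) * symm q u fs (A - {k}))"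
  proof (rule sum.cong[OF refl], goal_cases)
    case k: (1 k)
    show ?case
      unfolding IH[OF k] sum_distrib_left
    proof (rule sum.cong[OF refl], goal_cases)
      case (1 xs)
      then have xs: "set xs = A - {k}" "distinct xs" by (auto simp: permutations_of_set_def)
      then show ?case
        by (subst pcoef_Cons) (auto simp: prod.lessThan_Suc_shift simp del: prod.lessThan_Suc)
    qed
  qed
  finally show ?case by simp
qed

lemma bij_betw_permutes_lists:
  "bij_betw (\<lambda>p. map p [0..<n]) {p. p permutes {..<n}} (permutations_of_set {..<n})"
proof (rule bij_betw_imageI)
  show "inj_on (\<lambda>p. map p [0..<n]) {p. p permutes {..<n}}"
  proof (rule inj_onI)
    fix p p' assume p: "p \<in> {p. p permutes {..<n}}" "p' \<in> {p. p permutes {..<n}}" and e: "map p [0..<n] = map p' [0..<n]"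
    have "p i = p' i" for i
      using e p by (cases "i < n") (auto simp: permutes_not_in)
    then show "p = p'" by auto
  qed
  show "(\<lambda>p. map p [0..<n]) ` {p. p permutes {..<n}} = permutations_of_set {..<n}"
  proof (intro equalityI subsetI)
    fix xs assume "xs \<in> (\<lambda>p. map p [0..<n]) ` {p. p permutes {..<n}}"
    then obtain p where p: "p permutes {..<n}" "xs = map p [0..<n]" by auto
    then show "xs \<in> permutations_of_set {..<n}"
      using permutes_image[OF p(1)] permutes_inj_on[OF p(1)]
      by (auto simp: permutations_of_set_def distinct_map atLeast0LessThan)
  next
    fix xs assume "xs \<in> permutations_of_set {..<n}"
    then have xs: "set xs = {..<n}" "distinct xs" by (simp_all add: permutations_of_setD)
    have len: "length xs = n" using distinct_card[OF xs(2)] xs(1) by simp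
    define p where "p i = (if i < n then xs ! i else i)" for i
    have "bij_betw (\<lambda>i. xs ! i) {..<n} {..<n}" by (rule bij_betw_nth[OF xs(2)]) (simp_all add: len xs(1))
    then have "bij_betw p {..<n} {..<n}" by (rule bij_betw_cong[THEN iffD1, rotated]) (auto simp: p_def)
    then have "p permutes {..<n}" by (rule bij_imp_permutes) (auto simp: p_def)
    moreover have "xs = map p [0..<n]" by (rule nth_equalityI) (simp_all add: p_def len)
    ultimately show "xs \<in> (\<lambda>p. map p [0..<n]) ` {p. p permutes {..<n}}" by auto
  qed
qed

lemma symmetrize_eq_symm:
  "symmetrize q n f u = symm (of_real q) u (map f [0..<n]) {..<n}"
proof -
  have "symm (of_real q) u (map f [0..<n]) {..<n} =
    (\<Sum>xs\<in>permutations_of_set {..<n}. pcoef (of_real q) u xs * (\<Prod>i<n. f i (u (xs ! i))))"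
    by (subst symm_eq_perms) auto
  also have "\<dots> = (\<Sum>p | p permutes {..<n}. pcoef (of_real q) u (map p [0..<n]) * (\<Prod>i<n. f i (u (map p [0..<n] ! i))))"
    by (rule sum.reindex_bij_betw[OF bij_betw_permutes_lists, symmetric])
  also have "\<dots> = symmetrize q n f u"
    unfolding symmetrize_def pcoef_def by (intro sum.cong refl arg_cong2[where f="(*)"] prod.cong) auto
  finally show ?thesis by simp
qed

text \<open>Terms are collected by the set \<open>I\<close> of variables that receive the functions
  \<open>fs\<close>; the factors between \<open>I\<close> and its complement are the same for all
  orders within the two blocks.\<close>

lemma symm_append:
  assumes "finite A" "card A = length fs + length gs"
  shows "symm q u (fs @ gs) A =
    (\<Sum>I\<in>Pow A. if card I = length fs then cross q u I (A - I) * symm q u fs I * symm q u gs (A - I) else 0)"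
  using assms
proof (induction fs arbitrary: A)
  case Nil
  have "(\<Sum>I\<in>Pow A. if card I = length ([] :: (complex \<Rightarrow> complex) list) then cross q u I (A - I) * symm q u [] I * symm q u gs (A - I) else 0) =
    (\<Sum>I\<in>Pow A. if I = {} then symm q u gs A else 0)"
    by (rule sum.cong[OF refl]) (use Nil in \<open>auto simp: cross_def dest: finite_subset\<close>)
  then show ?case using Nil by simp
next
  case (Cons f fs)
  note fin = Cons.prems(1)
  let ?P = "\<lambda>k X. \<Prod>j\<in>X. (u k - q * u j) / (u k - u j)"
  \<comment> \<open>The summand in which the variable with index \<open>k\<close> receives
    \<open>f\<close>. Exchanging the sums over I and k puts the choice of k outermost, as in
    \<open>symm\<close>.\<close>
  define G where "G I k = (if card I = length (f # fs) then cross q u I (A - I) * (f (u k) * ?P k (I - {k}) * symm q u fs (I - {k})) * symm q u gs (A - I) else 0)" for I k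
  have "(\<Sum>I\<in>Pow A. if card I = length (f # fs) then cross q u I (A - I) * symm q u (f # fs) I * symm q u gs (A - I) else 0) =
    (\<Sum>I\<in>Pow A. \<Sum>k\<in>I. G I k)"
    by (intro sum.cong refl) (simp add: G_def sum_distrib_left sum_distrib_right)
  also have "\<dots> = (\<Sum>I\<in>Pow A. \<Sum>k\<in>A. if k \<in> I then G I k else 0)"
  proof (rule sum.cong[OF refl])
    fix I assume "I \<in> Pow A"
    then have "A \<inter> I = I" by auto
    then show "(\<Sum>k\<in>I. G I k) = (\<Sum>k\<in>A. if k \<in> I then G I k else 0)"
      using sum.inter_restrict[OF fin, of "G I" I] by simp
  qed
  also have "\<dots> = (\<Sum>k\<in>A. \<Sum>I\<in>Pow A. if k \<in> I then G I k else 0)" by (rule sum.swap)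
  also have "\<dots> = (\<Sum>k\<in>A. f (u k) * ?P k (A - {k}) * symm q u (fs @ gs) (A - {k}))"
  proof (rule sum.cong[OF refl])
    fix k assume k: "k \<in> A"
    define A' where "A' = A - {k}"
    have A: "A = insert k A'" and kA: "k \<notin> A'" and fin': "finite A'" using k fin by (auto simp: A'_def)
    have IH: "symm q u (fs @ gs) A' =
      (\<Sum>I\<in>Pow A'. if card I = length fs then cross q u I (A' - I) * symm q u fs I * symm q u gs (A' - I) else 0)"
      by (rule Cons.IH) (use Cons.prems fin' kA in \<open>auto simp: A\<close>)
    have "(\<Sum>I\<in>Pow A. if k \<in> I then G I k else 0) =
      (\<Sum>I\<in>Pow A'. (if k \<in> insert k I then G (insert k I) k else 0) + (if k \<in> I then G I k else 0))"
      unfolding A by (rule sum_Pow_insert[OF fin' kA])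
    also have "\<dots> = (\<Sum>I\<in>Pow A'. f (u k) * ?P k A' * (if card I = length fs then cross q u I (A' - I) * symm q u fs I * symm q u gs (A' - I) else 0))"
    proof (rule sum.cong[OF refl], goal_cases)
      case (1 I)
      then have I: "I \<subseteq> A'" and finI: "finite I" and kI: "k \<notin> I" using fin' kA by (auto intro: finite_subset)
      have "?P k A' = ?P k (A' - I) * ?P k I" by (rule prod.subset_diff[OF I fin'])
      then show ?case
        unfolding G_def A using insert_Diff_insert[OF kA I] kI finI cross_insert_left[OF finI kI, of q u "A' - I"]
        by (simp add: prod_dividef mult_ac)
    qed
    finally show "(\<Sum>I\<in>Pow A. if k \<in> I then G I k else 0) = f (u k) * ?P k (A - {k}) * symm q u (fs @ gs) (A - {k})"
      unfolding A'_def[symmetric] IH sum_distrib_left .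
  qed
  finally show ?case by simp
qed

lemma symm_factor:
  assumes "finite A" "card A = length fs"
  shows "symm q u (map (\<lambda>f z. g z * f z) fs) A = (\<Prod>i\<in>A. g (u i)) * symm q u fs A"
  using assms
proof (induction fs arbitrary: A)
  case (Cons f fs)
  have "symm q u (map (\<lambda>f z. g z * f z) fs) (A - {k}) = (\<Prod>i\<in>A - {k}. g (u i)) * symm q u fs (A - {k})"
    if "k \<in> A" for k by (rule Cons.IH) (use Cons.prems that in auto)
  moreover have "(\<Prod>i\<in>A. g (u i)) = g (u k) * (\<Prod>i\<in>A - {k}. g (u i))" if "k \<in> A" for k
    using Cons.prems that by (intro prod.remove) auto
  ultimately show ?case
    by (simp add: sum_distrib_left mult_ac cong: sum.cong)
qed auto

section \<open>Symmetrization of constants\<close>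

text \<open>This is the partial fraction expansion in \<open>x\<close> of the product on the right:
  its residue at u k is (1 - q) * u k times the product over j \<noteq> k, and its value at infinity
  is 1.\<close>

lemma interpolation_partial_fractions:
  fixes u :: "'i \<Rightarrow> complex"
  assumes "finite A" "inj_on u A" "x \<notin> u ` A"
  shows "(\<Sum>k\<in>A. (\<Prod>j\<in>A - {k}. (u k - q * u j) / (u k - u j)) * ((1 - q) * u k / (x - u k))) =
    (\<Prod>j\<in>A. (x - q * u j) / (x - u j)) - 1"
  using assms
proof (induction A arbitrary: x rule: finite_induct)
  case (insert b A)
  define y where "y = u b"
  define c where "c k = (\<Prod>j\<in>A - {k}. (u k - q * u j) / (u k - u j))" for k
  define P where "P z = (\<Prod>j\<in>A. (z - q * u j) / (z - u j))" for z
  have inj: "inj_on u A" and yA: "y \<notin> u ` A" using insert by (auto simp: y_def)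
  have xA: "x \<notin> u ` A" and xy: "x - y \<noteq> 0" using insert.prems by (auto simp: y_def)
  have c1: "(\<Prod>j\<in>insert b A - {k}. (u k - q * u j) / (u k - u j)) = c k * ((u k - q * y) / (u k - y))" if "k \<in> A" for k
  proof -
    have "insert b A - {k} = insert b (A - {k})" using that insert.hyps by auto
    then show ?thesis using insert.hyps by (simp add: c_def y_def)
  qed
  have c2: "(\<Prod>j\<in>A. (y - q * u j) / (y - u j)) = P y"
    by (simp add: P_def)
  \<comment> \<open>The rational factor is split by its poles in u k at x and at y, so that the
    induction hypothesis can be used at both points.\<close>
  have split: "c k * ((u k - q * y) / (u k - y)) * ((1 - q) * u k / (x - u k)) =
     (x - q * y) / (x - y) * (c k * ((1 - q) * u k / (x - u k))) - (1 - q) * y / (x - y) * (c k * ((1 - q) * u k / (y - u k)))"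
    if "k \<in> A" for k
  proof -
    have nz: "x - u k \<noteq> 0" "y - u k \<noteq> 0" "u k - y \<noteq> 0" using that xA yA by auto
    have "(u k - q * y) / (u k - y) / (x - u k) = (x - q * y) / (x - y) / (x - u k) - (1 - q) * y / (x - y) / (y - u k)"
      using nz xy by (simp add: divide_simps) (simp add: algebra_simps)
    then have "(c k * ((1 - q) * u k)) * ((u k - q * y) / (u k - y) / (x - u k)) =
      (c k * ((1 - q) * u k)) * ((x - q * y) / (x - y) / (x - u k) - (1 - q) * y / (x - y) / (y - u k))" by (rule arg_cong)
    also have "\<dots> = (x - q * y) / (x - y) * (c k * ((1 - q) * u k / (x - u k))) - (1 - q) * y / (x - y) * (c k * ((1 - q) * u k / (y - u k)))"
      unfolding right_diff_distrib[of "c k * ((1 - q) * u k)"] by (simp add: mult_ac)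
    finally show ?thesis by (simp add: mult_ac)
  qed
  have "(\<Sum>k\<in>insert b A. (\<Prod>j\<in>insert b A - {k}. (u k - q * u j) / (u k - u j)) * ((1 - q) * u k / (x - u k))) =
    P y * ((1 - q) * y / (x - y)) + (\<Sum>k\<in>A. c k * ((u k - q * y) / (u k - y)) * ((1 - q) * u k / (x - u k)))"
    using insert.hyps by (simp add: c1 c2 y_def[symmetric] cong: sum.cong)
  also have "(\<Sum>k\<in>A. c k * ((u k - q * y) / (u k - y)) * ((1 - q) * u k / (x - u k))) =
    (x - q * y) / (x - y) * (\<Sum>k\<in>A. c k * ((1 - q) * u k / (x - u k))) - (1 - q) * y / (x - y) * (\<Sum>k\<in>A. c k * ((1 - q) * u k / (y - u k)))"
    unfolding sum_distrib_left sum_subtractf[symmetric] by (intro sum.cong refl split)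
  also have "(\<Sum>k\<in>A. c k * ((1 - q) * u k / (x - u k))) = P x - 1"
    unfolding c_def P_def by (rule insert.IH[OF inj xA])
  also have "(\<Sum>k\<in>A. c k * ((1 - q) * u k / (y - u k))) = P y - 1"
    unfolding c_def P_def by (rule insert.IH[OF inj yA])
  also have "P y * ((1 - q) * y / (x - y)) + ((x - q * y) / (x - y) * (P x - 1) - (1 - q) * y / (x - y) * (P y - 1)) =
    (x - q * y) / (x - y) * P x - 1"
    using xy by (simp add: divide_simps) (simp add: algebra_simps)
  also have "\<dots> = (\<Prod>j\<in>insert b A. (x - q * u j) / (x - u j)) - 1"
    using insert.hyps by (simp add: P_def y_def)
  finally show ?case .
qed simp

text \<open>A new variable y = u b multiplies the old weights by q - (1 - q) * u k / (y - u k). By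
  \<open>interpolation_partial_fractions\<close> at y the subtracted parts sum to P - 1, and
  \<open>P\<close> is the new weight, so the total becomes q times the old one plus 1: the next
  q-integer.\<close>

lemma sum_interpolation_weights:
  fixes u :: "'i \<Rightarrow> complex"
  assumes "finite A" "inj_on u A" "q \<noteq> 1"
  shows "(\<Sum>k\<in>A. \<Prod>j\<in>A - {k}. (u k - q * u j) / (u k - u j)) = (1 - q ^ card A) / (1 - q)"
  using assms
proof (induction A rule: finite_induct)
  case (insert b A)
  define y where "y = u b"
  define c where "c k = (\<Prod>j\<in>A - {k}. (u k - q * u j) / (u k - u j))" for k
  define P where "P = (\<Prod>j\<in>A. (y - q * u j) / (y - u j))"
  have inj: "inj_on u A" and yA: "y \<notin> u ` A" using insert by (auto simp: y_def)
  have c1: "(\<Prod>j\<in>insert b A - {k}. (u k - q * u j) / (u k - u j)) = q * c k - c k * ((1 - q) * u k / (y - u k))" if "k \<in> A" for k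
  proof -
    have nz: "y - u k \<noteq> 0" "u k - y \<noteq> 0" using that yA by auto
    have "insert b A - {k} = insert b (A - {k})" using that insert.hyps by auto
    then have "(\<Prod>j\<in>insert b A - {k}. (u k - q * u j) / (u k - u j)) = c k * ((u k - q * y) / (u k - y))"
      using insert.hyps by (simp add: c_def y_def)
    also have "(u k - q * y) / (u k - y) = q - (1 - q) * u k / (y - u k)"
      using nz by (simp add: divide_simps) (simp add: algebra_simps)
    finally show ?thesis by (simp add: algebra_simps)
  qed
  have c2: "(\<Prod>j\<in>A. (y - q * u j) / (y - u j)) = P"
    by (simp add: P_def)
  have "(\<Sum>k\<in>insert b A. \<Prod>j\<in>insert b A - {k}. (u k - q * u j) / (u k - u j)) =
    P + (\<Sum>k\<in>A. q * c k - c k * ((1 - q) * u k / (y - u k)))"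
    using insert.hyps by (simp add: c1 c2 y_def[symmetric] cong: sum.cong)
  also have "\<dots> = P + (q * (\<Sum>k\<in>A. c k) - (P - 1))"
    using interpolation_partial_fractions[OF insert.hyps(1) inj yA, of q]
    unfolding sum_subtractf sum_distrib_left c_def P_def by simp
  also have "(\<Sum>k\<in>A. c k) = (1 - q ^ card A) / (1 - q)"
    unfolding c_def by (rule insert.IH[OF inj insert.prems(2)])
  also have "P + (q * ((1 - q ^ card A) / (1 - q)) - (P - 1)) = (1 - q ^ card (insert b A)) / (1 - q)"
    using insert.hyps insert.prems(2) by (simp add: field_simps)
  finally show ?case .
qed simp

text \<open>Each choice of the next variable contributes a q-integer, so the result is a
  q-factorial, whatever the variables are. It evaluates the block of zero parts, where all functions
  agree.\<close>

lemma symm_replicate_one: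
  assumes "finite A" "card A = n" "inj_on u A" "q \<noteq> 1"
  shows "symm q u (replicate n (\<lambda>_. 1)) A = qpoch q q n / (1 - q) ^ n"
  using assms
proof (induction n arbitrary: A)
  case (Suc n)
  have IH: "symm q u (replicate n (\<lambda>_. 1)) (A - {k}) = qpoch q q n / (1 - q) ^ n" if "k \<in> A" for k
    by (rule Suc.IH) (use Suc.prems that in \<open>auto intro: inj_on_subset\<close>)
  have "symm q u (replicate (Suc n) (\<lambda>_. 1)) A =
    (\<Sum>k\<in>A. \<Prod>j\<in>A - {k}. (u k - q * u j) / (u k - u j)) * (qpoch q q n / (1 - q) ^ n)"
    unfolding replicate_Suc symm.simps sum_distrib_right by (intro sum.cong refl) (simp add: IH)
  also have "\<dots> = (1 - q ^ Suc n) / (1 - q) * (qpoch q q n / (1 - q) ^ n)"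
    using sum_interpolation_weights[OF Suc.prems(1,3,4)] Suc.prems(2) by simp
  also have "\<dots> = qpoch q q (Suc n) / (1 - q) ^ Suc n"
    unfolding qpoch_def by (simp add: mult_ac)
  finally show ?case .
qed (auto simp: qpoch_def)

subsection \<open>Removing the first column\<close>

definition sig_wt :: "real \<Rightarrow> (nat \<Rightarrow> complex) \<Rightarrow> nat list \<Rightarrow> complex" where
  "sig_wt q s l = (\<Prod>r\<in>set l. qpoch ((s r)\<^sup>2) (of_real q) (count_list l r) / qpoch (of_real q) (of_real q) (count_list l r))"

text \<open>The summand of the unrefined Cauchy sum. \<open>A\<close> and \<open>B\<close> are
  separate because the recursion combines unrelated subsets of the two sets of variables.\<close>

definition cterm :: "real \<Rightarrow> (nat \<Rightarrow> complex) \<Rightarrow> (nat \<Rightarrow> complex) \<Rightarrow> ('i \<Rightarrow> complex) \<Rightarrow> ('j \<Rightarrow> complex) \<Rightarrow> nat list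
    \<Rightarrow> 'i set \<Rightarrow> 'j set \<Rightarrow> complex" where
  "cterm q s xi u v l A B = sig_wt q s l * symm (of_real q) u (map (phi q s xi) l) A *
     symm (of_real q) v (map (phi q s (\<lambda>x. inverse (xi x))) l) B"

definition ext_sig :: "nat \<Rightarrow> nat list \<Rightarrow> nat list" where
  "ext_sig m l = map Suc l @ replicate m 0"

text \<open>The part of the symmetrization that depends on the column with parameters \<open>s\<close>, \<open>x\<close>, where \<open>I\<close> carries the nonzero parts.\<close>

definition colw :: "complex \<Rightarrow> complex \<Rightarrow> complex \<Rightarrow> ('i \<Rightarrow> complex) \<Rightarrow> 'i set \<Rightarrow> 'i set \<Rightarrow> complex" where
  "colw q s x u A I = cross q u I (A - I) * (\<Prod>i\<in>I. (x * u i - s) / (1 - s * x * u i)) * (\<Prod>i\<in>A - I. 1 / (1 - s * x * u i))"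

lemma spinHL_eq_symm: "spinHL q s xi l u = symm (of_real q) u (map (phi q s xi) l) {..<length l}"
proof -
  have "map (\<lambda>i. phi q s xi (l ! i)) [0..<length l] = map (phi q s xi) (map (\<lambda>i. l ! i) [0..<length l])" by simp
  then show ?thesis unfolding spinHL_def symmetrize_eq_symm map_nth by simp
qed

lemma spinHL_mult_dual:
  "spinHL q s xi l u * spinHL_dual q s xi l v = cterm q s xi u v l {..<length l} {..<length l}"
  using spinHL_eq_symm[of q s xi l u] spinHL_eq_symm[of q s "\<lambda>x. inverse (xi x)" l v]
  unfolding spinHL_dual_def cterm_def sig_wt_def spinHL_def by (simp add: mult_ac)

lemma phi_Suc:
  "phi q s xi (Suc k) z = (xi 0 * z - s 0) / (1 - s 0 * xi 0 * z) * phi q (\<lambda>n. s (Suc n)) (\<lambda>n. xi (Suc n)) k z"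
  unfolding phi_def prod.lessThan_Suc_shift by (simp add: mult_ac)

lemma phi_0: "phi q s xi 0 z = (1 - of_real q) / (1 - s 0 * xi 0 * z)"
  by (simp add: phi_def)

lemma qpoch_q_nonzero:
  assumes "0 < q" "q < (1 :: real)"
  shows "qpoch (of_real q) (of_real q) n \<noteq> 0"
proof -
  have "1 - of_real q * of_real q ^ i \<noteq> (0 :: complex)" for i
  proof -
    have "q * q ^ i < 1" using assms power_Suc_less_one[of q i] by simp
    then have "of_real (1 - q * q ^ i) \<noteq> (0 :: complex)" by (simp only: of_real_eq_0_iff)
    then show ?thesis by simp
  qed
  then show ?thesis unfolding qpoch_def by (simp add: prod_zero_iff)
qed

text \<open>A positive part carries the factor of column 0 in front of the shifted
  \<open>phi\<close>; a zero part is (1 - q) / (1 - s 0 * xi 0 * z). \<open>symm_append\<close>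
  separates the two kinds, and the powers of 1 - q cancel the denominator in
  \<open>symm_replicate_one\<close>.\<close>

lemma symm_ext_sig:
  assumes q: "0 < q" "q < (1 :: real)" and fin: "finite A" and card: "card A = length l + m" and inj: "inj_on u A"
  shows "symm (of_real q) u (map (phi q s xi) (ext_sig m l)) A =
    (\<Sum>I\<in>Pow A. if card I = length l then colw (of_real q) (s 0) (xi 0) u A I * qpoch (of_real q) (of_real q) m *
      symm (of_real q) u (map (phi q (\<lambda>n. s (Suc n)) (\<lambda>n. xi (Suc n))) l) I else 0)"
proof -
  let ?q = "complex_of_real q"
  have q1: "?q \<noteq> 1" using q by (metis less_irrefl of_real_eq_1_iff)
  define p where "p z = (xi 0 * z - s 0) / (1 - s 0 * xi 0 * z)" for z
  define r where "r z = (1 - ?q) / (1 - s 0 * xi 0 * z)" for z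
  define fs where "fs = map (phi q (\<lambda>n. s (Suc n)) (\<lambda>n. xi (Suc n))) l"
  have e: "map (phi q s xi) (ext_sig m l) = map (\<lambda>f z. p z * f z) fs @ map (\<lambda>f z. r z * f z) (replicate m (\<lambda>_. 1))"
    unfolding ext_sig_def fs_def by (auto simp: phi_Suc p_def r_def fun_eq_iff phi_0)
  show ?thesis unfolding e
  proof (subst symm_append, goal_cases)
    case 1
    show ?case by (rule fin)
  next
    case 2
    show ?case by (simp add: card fs_def)
  next
    case 3
    show ?case
    proof (rule sum.cong[OF refl], goal_cases)
      case (1 I)
      then have I: "I \<subseteq> A" and finI: "finite I" and finC: "finite (A - I)" using fin by (auto intro: finite_subset)
      show ?case
      proof (cases "card I = length l")
        case True
        have cC: "card (A - I) = m" using card True I finI by (simp add: card_Diff_subset)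
        have 1: "symm ?q u (map (\<lambda>f z. p z * f z) fs) I = (\<Prod>i\<in>I. p (u i)) * symm ?q u fs I"
          by (rule symm_factor[OF finI]) (simp add: True fs_def)
        have "symm ?q u (map (\<lambda>f z. r z * f z) (replicate m (\<lambda>_. 1))) (A - I) =
          (\<Prod>i\<in>A - I. r (u i)) * symm ?q u (replicate m (\<lambda>_. 1)) (A - I)"
          by (rule symm_factor[OF finC]) (simp add: cC)
        also have "symm ?q u (replicate m (\<lambda>_. 1)) (A - I) = qpoch ?q ?q m / (1 - ?q) ^ m"
          by (rule symm_replicate_one[OF finC cC _ q1]) (use inj in \<open>auto intro: inj_on_subset\<close>)
        also have "(\<Prod>i\<in>A - I. r (u i)) = (1 - ?q) ^ m * (\<Prod>i\<in>A - I. 1 / (1 - s 0 * xi 0 * u i))"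
          unfolding r_def by (simp add: prod_dividef cC)
        finally have 2: "symm ?q u (map (\<lambda>f z. r z * f z) (replicate m (\<lambda>_. 1))) (A - I) =
          (\<Prod>i\<in>A - I. 1 / (1 - s 0 * xi 0 * u i)) * qpoch ?q ?q m" using q1 by simp
        show ?thesis unfolding 1 2 using True
          by (simp add: fs_def p_def colw_def mult_ac)
      next
        case False
        then show ?thesis by (simp add: fs_def)
      qed
    qed
  qed
qed

lemma count_ext_sig: "count_list (ext_sig m l) 0 = m" "count_list (ext_sig m l) (Suc r) = count_list l r"
proof -
  have 1: "count_list (map Suc l) 0 = 0" by (induction l) auto
  have 2: "count_list (replicate m (0 :: nat)) 0 = m" by (induction m) auto
  have 3: "count_list (replicate m (0 :: nat)) (Suc r) = 0" by (induction m) auto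
  show "count_list (ext_sig m l) 0 = m" "count_list (ext_sig m l) (Suc r) = count_list l r"
    unfolding ext_sig_def by (simp_all add: 1 2 3 count_list_map_conv)
qed

lemma sig_wt_ext_sig:
  "sig_wt q s (ext_sig m l) = qpoch ((s 0)\<^sup>2) (of_real q) m / qpoch (of_real q) (of_real q) m * sig_wt q (\<lambda>n. s (Suc n)) l"
proof -
  define g where "g r = qpoch ((s r)\<^sup>2) (of_real q) (count_list (ext_sig m l) r) / qpoch (of_real q) (of_real q) (count_list (ext_sig m l) r)" for r
  have g0: "g 0 = qpoch ((s 0)\<^sup>2) (of_real q) m / qpoch (of_real q) (of_real q) m" by (simp add: g_def count_ext_sig)
  have g1: "(\<Prod>r\<in>Suc ` set l. g r) = sig_wt q (\<lambda>n. s (Suc n)) l"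
    unfolding sig_wt_def by (simp add: prod.reindex g_def count_ext_sig)
  have "sig_wt q s (ext_sig m l) = prod g (set (ext_sig m l))" unfolding sig_wt_def g_def ..
  also have "\<dots> = g 0 * (\<Prod>r\<in>Suc ` set l. g r)"
  \<comment> \<open>If m = 0 then 0 is not a part and has no factor in \<open>sig_wt\<close>, which
    agrees with \<open>g 0 = 1\<close>.\<close>
  proof (cases "m = 0")
    case True
    then show ?thesis using g0 by (simp add: ext_sig_def qpoch_def)
  next
    case False
    then have "set (ext_sig m l) = insert 0 (Suc ` set l)" by (auto simp: ext_sig_def)
    then show ?thesis by (simp add: image_iff)
  qed
  finally show ?thesis unfolding g0 g1 .
qed

text \<open>Each of the two symmetrizations yields a factor (q;q)_m; one of them cancels the
  denominator in \<open>sig_wt_ext_sig\<close>.\<close>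

lemma cterm_ext_sig:
  assumes q: "0 < q" "q < (1 :: real)" and fin: "finite A" "finite B"
    and card: "card A = length l + m" "card B = length l + m" and inj: "inj_on u A" "inj_on v B"
  shows "cterm q s xi u v (ext_sig m l) A B = (\<Sum>I\<in>Pow A. \<Sum>J\<in>Pow B. if card I = length l \<and> card J = length l then
     (qpoch ((s 0)\<^sup>2) (of_real q) m * qpoch (of_real q) (of_real q) m * colw (of_real q) (s 0) (xi 0) u A I * colw (of_real q) (s 0) (inverse (xi 0)) v B J) *
     cterm q (\<lambda>n. s (Suc n)) (\<lambda>n. xi (Suc n)) u v l I J else 0)"
  unfolding cterm_def sig_wt_ext_sig symm_ext_sig[OF q fin(1) card(1) inj(1)] symm_ext_sig[OF q fin(2) card(2) inj(2)]
    mult.assoc sum_product unfolding sum_distrib_left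
  using qpoch_q_nonzero[OF q, of m] by (intro sum.cong refl) (simp add: mult_ac)

lemma sorted_imp_ext_sig:
  assumes "sorted_wrt (\<ge>) (l :: nat list)"
  shows "\<exists>m l'. l = ext_sig m l' \<and> sorted_wrt (\<ge>) l'"
  using assms
proof (induction l)
  case Nil
  then show ?case by (intro exI[of _ 0] exI[of _ "[]"]) (simp add: ext_sig_def)
next
  case (Cons a l)
  then obtain m l' where l: "l = ext_sig m l'" "sorted_wrt (\<ge>) l'" by auto
  have a: "\<And>x. x \<in> set l \<Longrightarrow> x \<le> a" using Cons.prems by auto
  show ?case
  proof (cases a)
    case 0
    then have "l = replicate (length l) 0" using a by (intro replicate_eqI) auto
    then have "a # l = ext_sig (Suc (length l)) []" using 0 by (simp add: ext_sig_def)
    then show ?thesis by (metis sorted_wrt.simps(1))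
  next
    case (Suc b)
    have "a # l = ext_sig m (b # l')" using l Suc by (simp add: ext_sig_def)
    moreover have "sorted_wrt (\<ge>) (b # l')" using l a Suc by (auto simp: ext_sig_def)
    ultimately show ?thesis by blast
  qed
qed

lemma sorted_wrt_replicate_zero: "sorted_wrt (\<ge>) (replicate m (0 :: nat))"
  by (induction m) auto

lemma Sign_eq_UN: "Sign n = (\<Union>m\<in>{..n}. ext_sig m ` Sign (n - m))"
proof (intro equalityI subsetI)
  fix l assume "l \<in> Sign n"
  then have l: "length l = n" "sorted_wrt (\<ge>) l" by (auto simp: Sign_def)
  obtain m l' where m: "l = ext_sig m l'" "sorted_wrt (\<ge>) l'" using sorted_imp_ext_sig[OF l(2)] by blast
  then have "m \<le> n" "l' \<in> Sign (n - m)" using l(1) by (auto simp: Sign_def ext_sig_def)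
  then show "l \<in> (\<Union>m\<in>{..n}. ext_sig m ` Sign (n - m))" using m by auto
next
  fix l assume "l \<in> (\<Union>m\<in>{..n}. ext_sig m ` Sign (n - m))"
  then show "l \<in> Sign n"
    using sorted_wrt_replicate_zero by (auto simp: Sign_def ext_sig_def sorted_wrt_append sorted_wrt_map)
qed

lemma has_sum_finite_UN:
  fixes f :: "'a \<Rightarrow> complex"
  assumes "finite M" "\<And>m. m \<in> M \<Longrightarrow> (f has_sum g m) (S m)"
    "\<And>m m'. m \<in> M \<Longrightarrow> m' \<in> M \<Longrightarrow> m \<noteq> m' \<Longrightarrow> S m \<inter> S m' = {}"
  shows "(f has_sum (\<Sum>m\<in>M. g m)) (\<Union>m\<in>M. S m)"
  using assms
proof (induction M rule: finite_induct)
  case (insert m M)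
  have "(f has_sum g m + (\<Sum>m\<in>M. g m)) (S m \<union> (\<Union>m\<in>M. S m))"
  proof (rule has_sum_Un_disjoint)
    show "(f has_sum (\<Sum>m\<in>M. g m)) (\<Union>m\<in>M. S m)" using insert by auto
    show "(f has_sum g m) (S m)" using insert by auto
    have "S m \<inter> S m' = {}" if "m' \<in> M" for m' using insert.prems(2)[of m m'] insert.hyps that by auto
    then show "S m \<inter> (\<Union>m\<in>M. S m) = {}" by blast
  qed
  then show ?case using insert.hyps by simp
qed simp

lemma has_sum_sum_finite:
  fixes f :: "'b \<Rightarrow> 'a \<Rightarrow> complex"
  assumes "finite M" "\<And>m. m \<in> M \<Longrightarrow> (f m has_sum g m) S"
  shows "((\<lambda>x. \<Sum>m\<in>M. f m x) has_sum (\<Sum>m\<in>M. g m)) S"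
  using assms by (induction M rule: finite_induct) (auto intro: has_sum_add)

lemma inj_ext_sig: "inj_on (ext_sig m) X"
  by (auto simp: inj_on_def ext_sig_def dest: map_injective)

text \<open>The weight \<open>w\<close> is arbitrary so as to cover the refined sum and, with w = 1,
  the unrefined one. The inner sums \<open>Z\<close> are abstract because one of them, that with all
  variables, is the unknown in the proof of \<open>has_sum_cterm\<close>.\<close>

lemma has_sum_first_column:
  fixes u :: "'i \<Rightarrow> complex" and v :: "'j \<Rightarrow> complex"
  assumes q: "0 < q" "q < (1 :: real)" and fin: "finite A" "finite B"
    and card: "card A = n" "card B = n" and inj: "inj_on u A" "inj_on v B"
    and Z: "\<And>I J. I \<subseteq> A \<Longrightarrow> J \<subseteq> B \<Longrightarrow> card J = card I \<Longrightarrow>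
      ((\<lambda>l. cterm q (\<lambda>n. s (Suc n)) (\<lambda>n. xi (Suc n)) u v l I J) has_sum Z I J) (Sign (card I))"
  shows "((\<lambda>l. w (count_list l 0) * cterm q s xi u v l A B) has_sum
    (\<Sum>I\<in>Pow A. \<Sum>J\<in>Pow B. if card J = card I then
      (w (card (A - I)) * qpoch ((s 0)\<^sup>2) (of_real q) (card (A - I)) * qpoch (of_real q) (of_real q) (card (A - I)) *
       colw (of_real q) (s 0) (xi 0) u A I * colw (of_real q) (s 0) (inverse (xi 0)) v B J) * Z I J else 0)) (Sign n)"
proof -
  define K where "K m I J = w m * qpoch ((s 0)\<^sup>2) (of_real q) m * qpoch (of_real q) (of_real q) m *
       colw (of_real q) (s 0) (xi 0) u A I * colw (of_real q) (s 0) (inverse (xi 0)) v B J" for m I J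
  define g where "g m = (\<Sum>I\<in>Pow A. \<Sum>J\<in>Pow B. if card I = n - m \<and> card J = n - m then K m I J * Z I J else 0)" for m
  have part: "((\<lambda>l. w (count_list l 0) * cterm q s xi u v l A B) has_sum g m) (ext_sig m ` Sign (n - m))" if m: "m \<in> {..n}" for m
  proof -
    have "((\<lambda>l. \<Sum>I\<in>Pow A. \<Sum>J\<in>Pow B. if card I = n - m \<and> card J = n - m then
        K m I J * cterm q (\<lambda>n. s (Suc n)) (\<lambda>n. xi (Suc n)) u v l I J else 0) has_sum g m) (Sign (n - m))"
      unfolding g_def
    proof (intro has_sum_sum_finite)
      fix I J assume IJ: "I \<in> Pow A" "J \<in> Pow B"
      show "((\<lambda>l. if card I = n - m \<and> card J = n - m then K m I J * cterm q (\<lambda>n. s (Suc n)) (\<lambda>n. xi (Suc n)) u v l I J else 0)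
        has_sum (if card I = n - m \<and> card J = n - m then K m I J * Z I J else 0)) (Sign (n - m))"
        using Z[of I J] IJ by (auto intro: has_sum_cmult_right)
    qed (use fin in auto)
    also have "?this \<longleftrightarrow> (((\<lambda>l. w (count_list l 0) * cterm q s xi u v l A B) \<circ> ext_sig m) has_sum g m) (Sign (n - m))"
    proof (rule has_sum_cong)
      fix l assume "l \<in> Sign (n - m)"
      then have l: "length l = n - m" by (simp add: Sign_def)
      have "cterm q s xi u v (ext_sig m l) A B = (\<Sum>I\<in>Pow A. \<Sum>J\<in>Pow B. if card I = length l \<and> card J = length l then
     (qpoch ((s 0)\<^sup>2) (of_real q) m * qpoch (of_real q) (of_real q) m * colw (of_real q) (s 0) (xi 0) u A I * colw (of_real q) (s 0) (inverse (xi 0)) v B J) *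
     cterm q (\<lambda>n. s (Suc n)) (\<lambda>n. xi (Suc n)) u v l I J else 0)"
        by (rule cterm_ext_sig[OF q fin _ _ inj]) (use card l m in auto)
      then show "(\<Sum>I\<in>Pow A. \<Sum>J\<in>Pow B. if card I = n - m \<and> card J = n - m then
        K m I J * cterm q (\<lambda>n. s (Suc n)) (\<lambda>n. xi (Suc n)) u v l I J else 0) =
        ((\<lambda>l. w (count_list l 0) * cterm q s xi u v l A B) \<circ> ext_sig m) l"
        unfolding comp_def count_ext_sig l
        by (simp only: sum_distrib_left) (intro sum.cong refl, simp add: K_def mult_ac)
    qed
    finally show ?thesis by (simp add: has_sum_reindex[OF inj_ext_sig])
  qed
  have "((\<lambda>l. w (count_list l 0) * cterm q s xi u v l A B) has_sum (\<Sum>m\<in>{..n}. g m)) (\<Union>m\<in>{..n}. ext_sig m ` Sign (n - m))"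
  proof (rule has_sum_finite_UN)
    show "ext_sig m ` Sign (n - m) \<inter> ext_sig m' ` Sign (n - m') = {}" if "m \<noteq> m'" for m m'
      using that count_ext_sig(1) by (metis (no_types, lifting) disjoint_iff imageE)
  qed (use part in auto)
  moreover have "(\<Sum>m\<in>{..n}. g m) = (\<Sum>I\<in>Pow A. \<Sum>J\<in>Pow B. if card J = card I then K (card (A - I)) I J * Z I J else 0)"
  proof -
    have "(\<Sum>m\<in>{..n}. g m) = (\<Sum>I\<in>Pow A. \<Sum>m\<in>{..n}. \<Sum>J\<in>Pow B. if card I = n - m \<and> card J = n - m then K m I J * Z I J else 0)"
      unfolding g_def by (rule sum.swap)
    also have "\<dots> = (\<Sum>I\<in>Pow A. \<Sum>J\<in>Pow B. \<Sum>m\<in>{..n}. if card I = n - m \<and> card J = n - m then K m I J * Z I J else 0)"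
      by (intro sum.cong refl) (rule sum.swap)
    also have "\<dots> = (\<Sum>I\<in>Pow A. \<Sum>J\<in>Pow B. if card J = card I then K (card (A - I)) I J * Z I J else 0)"
    proof (intro sum.cong refl)
      fix I J assume IJ: "I \<in> Pow A" "J \<in> Pow B"
      have cI: "card I \<le> n" "card (A - I) = n - card I"
        using IJ fin card by (auto simp: card_Diff_subset finite_subset intro: card_mono)
      have "(\<Sum>m\<in>{..n}. if card I = n - m \<and> card J = n - m then K m I J * Z I J else 0) =
        (\<Sum>m\<in>{..n}. if m = n - card I then (if card J = card I then K m I J * Z I J else 0) else 0)"
        using cI by (intro sum.cong refl) auto
      also have "\<dots> = (if card J = card I then K (card (A - I)) I J * Z I J else 0)" using cI by simp
      finally show "(\<Sum>m\<in>{..n}. if card I = n - m \<and> card J = n - m then K m I J * Z I J else 0) =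
        (if card J = card I then K (card (A - I)) I J * Z I J else 0)" .
    qed
    finally show ?thesis .
  qed
  ultimately show ?thesis unfolding Sign_eq_UN[of n] K_def by simp
qed

subsection \<open>A geometric bound for the summands\<close>

lemma finite_pos_lower_bound:
  assumes "finite S" "\<And>x. x \<in> S \<Longrightarrow> x > (0 :: real)"
  obtains c where "c > 0" "\<And>x. x \<in> S \<Longrightarrow> c \<le> x"
proof
  \<comment> \<open>Inserting 1 covers the case of an empty \<open>S\<close>.\<close>
  show "Min (insert 1 S) > 0" using assms by simp
  show "\<And>x. x \<in> S \<Longrightarrow> Min (insert 1 S) \<le> x" using assms by simp
qed

text \<open>If both norms were small, then so would be \<open>x - y = x * (1 - t * y) - y * (1 - t * x)\<close>.\<close>

lemma separated_nodes:
  fixes U :: "complex set"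
  assumes "finite U"
  obtains c where "c > 0" "\<And>t x y. x \<in> U \<Longrightarrow> y \<in> U \<Longrightarrow> x \<noteq> y \<Longrightarrow> c \<le> cmod (1 - t * x) \<or> c \<le> cmod (1 - t * y)"
proof -
  define S where "S = (\<lambda>(x, y). cmod (x - y) / (cmod x + cmod y + 1)) ` {(x, y) \<in> U \<times> U. x \<noteq> y}"
  have "finite {(x, y) \<in> U \<times> U. x \<noteq> y}" by (rule finite_subset[of _ "U \<times> U"]) (use assms in auto)
  then have finS: "finite S" by (simp add: S_def)
  have pos: "x > 0" if "x \<in> S" for x
    using that unfolding S_def by (auto intro!: divide_pos_pos add_nonneg_pos)
  obtain c where c: "c > 0" "\<And>x. x \<in> S \<Longrightarrow> c \<le> x" using finite_pos_lower_bound[OF finS pos] by blast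
  show thesis
  proof (rule that[OF c(1)])
    fix t x y assume xy: "x \<in> U" "y \<in> U" "x \<noteq> y"
    show "c \<le> cmod (1 - t * x) \<or> c \<le> cmod (1 - t * y)"
    proof (rule ccontr)
      assume "\<not> ?thesis"
      then have lt: "cmod (1 - t * x) \<le> c" "cmod (1 - t * y) \<le> c" by auto
      have "x - y = x * (1 - t * y) - y * (1 - t * x)" by (simp add: algebra_simps)
      then have "cmod (x - y) \<le> cmod x * cmod (1 - t * y) + cmod y * cmod (1 - t * x)"
        by (metis norm_mult norm_triangle_ineq4)
      also have "\<dots> \<le> cmod x * c + cmod y * c" by (intro add_mono mult_left_mono lt) auto
      finally have 1: "cmod (x - y) \<le> c * (cmod x + cmod y)" by (simp add: algebra_simps)
      have "cmod (x - y) / (cmod x + cmod y + 1) \<in> S" using xy unfolding S_def by force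
      then have "c \<le> cmod (x - y) / (cmod x + cmod y + 1)" by (rule c(2))
      then have "c * (cmod x + cmod y + 1) \<le> cmod (x - y)"
        by (subst (asm) pos_le_divide_eq) (auto intro: add_nonneg_pos)
      then show False using 1 c(1) by (simp add: algebra_simps)
    qed
  qed
qed

text \<open>The inequalities are multiplied along an arbitrary pairing of \<open>X\<close> with
  \<open>Y\<close>. In \<open>column_product_bound\<close> the two sets may differ, since
  \<open>f\<close> and \<open>g\<close> need not attain their minima at the same index.\<close>

lemma power_le_prod_pairs:
  fixes f :: "'a \<Rightarrow> real" and g :: "'b \<Rightarrow> real"
  assumes "finite X" "finite Y" "card X = card Y" "0 \<le> d" "0 \<le> M"
    "\<And>x. x \<in> X \<Longrightarrow> 0 \<le> f x" "\<And>y. y \<in> Y \<Longrightarrow> 0 \<le> g y"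
    "\<And>x y. x \<in> X \<Longrightarrow> y \<in> Y \<Longrightarrow> d \<le> M * (f x * g y)"
  shows "d ^ card X \<le> M ^ card X * ((\<Prod>x\<in>X. f x) * (\<Prod>y\<in>Y. g y))"
  using assms
proof (induction X arbitrary: Y rule: finite_induct)
  case (insert x X)
  then obtain y where y: "y \<in> Y" by (metis card.empty card_insert_disjoint ex_in_conv nat.distinct(1))
  define Y' where "Y' = Y - {y}"
  have Y: "Y = insert y Y'" "y \<notin> Y'" "finite Y'" using y insert.prems by (auto simp: Y'_def)
  have c: "card X = card Y'" using insert.prems(2) insert.hyps Y by simp
  have IH: "d ^ card X \<le> M ^ card X * ((\<Prod>x\<in>X. f x) * (\<Prod>y\<in>Y'. g y))"
    by (rule insert.IH[OF Y(3) c]) (use insert.prems in \<open>auto simp: Y\<close>)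
  have "d * d ^ card X \<le> (M * (f x * g y)) * (M ^ card X * ((\<Prod>x\<in>X. f x) * (\<Prod>y\<in>Y'. g y)))"
    by (rule mult_mono[OF _ IH]) (use insert.prems in \<open>auto simp: Y\<close>)
  then show ?case using insert.hyps Y by (simp add: mult_ac)
qed auto

text \<open>At most one f i lies below \<open>c\<close> and at most one g j below \<open>c'\<close>,
  so only the minima may be small. The pair they form absorbs the factor \<open>d\<close>; every
  other pair used satisfies both d \<le> K * (f i * g j) and c * c' \<le> f i * g j, which pays for
  \<open>d + 1\<close>.\<close>

lemma column_product_bound:
  fixes f g :: "nat \<Rightarrow> real"
  assumes Z: "finite Z" "Z \<noteq> {}" and pos: "\<And>i. i \<in> Z \<Longrightarrow> 0 < f i" "\<And>i. i \<in> Z \<Longrightarrow> 0 < g i"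
    and d: "0 \<le> d" "\<And>i j. i \<in> Z \<Longrightarrow> j \<in> Z \<Longrightarrow> d \<le> K * (f i * g j)" and K: "0 \<le> K" and c: "0 < c" "0 < c'"
    and sep: "\<And>i j. i \<in> Z \<Longrightarrow> j \<in> Z \<Longrightarrow> i \<noteq> j \<Longrightarrow> c \<le> f i \<or> c \<le> f j"
      "\<And>i j. i \<in> Z \<Longrightarrow> j \<in> Z \<Longrightarrow> i \<noteq> j \<Longrightarrow> c' \<le> g i \<or> c' \<le> g j"
  shows "d * (d + 1) ^ (card Z - 1) \<le> K * (K + 1 / (c * c')) ^ (card Z - 1) * ((\<Prod>i\<in>Z. f i) * (\<Prod>i\<in>Z. g i))"
proof -
  obtain i0 where i0: "i0 \<in> Z" "\<And>i. i \<in> Z \<Longrightarrow> f i0 \<le> f i"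
    using arg_min_if_finite[OF Z, of f] by (metis linorder_not_less)
  obtain j0 where j0: "j0 \<in> Z" "\<And>i. i \<in> Z \<Longrightarrow> g j0 \<le> g i"
    using arg_min_if_finite[OF Z, of g] by (metis linorder_not_less)
  define M where "M = K + 1 / (c * c')"
  have f: "c \<le> f i" if "i \<in> Z - {i0}" for i using sep(1)[of i i0] i0 that by force
  have g: "c' \<le> g i" if "i \<in> Z - {j0}" for i using sep(2)[of i j0] j0 that by force
  have "(d + 1) ^ card (Z - {i0}) \<le> M ^ card (Z - {i0}) * ((\<Prod>i\<in>Z - {i0}. f i) * (\<Prod>i\<in>Z - {j0}. g i))"
  proof (rule power_le_prod_pairs)
    show "finite (Z - {i0})" "finite (Z - {j0})" "card (Z - {i0}) = card (Z - {j0})" using Z i0 j0 by auto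
    show "0 \<le> d + 1" "0 \<le> M" using d K c by (auto simp: M_def)
    show "\<And>x. x \<in> Z - {i0} \<Longrightarrow> 0 \<le> f x" "\<And>x. x \<in> Z - {j0} \<Longrightarrow> 0 \<le> g x" using pos by (auto intro: less_imp_le)
    fix i j assume ij: "i \<in> Z - {i0}" "j \<in> Z - {j0}"
    have "c * c' \<le> f i * g j" using f[OF ij(1)] g[OF ij(2)] c by (intro mult_mono) auto
    then have "1 \<le> f i * g j / (c * c')" using c by (simp add: le_divide_eq)
    moreover have "d \<le> K * (f i * g j)" using d ij by auto
    ultimately show "d + 1 \<le> M * (f i * g j)" unfolding M_def by (simp add: algebra_simps)
  qed
  moreover have "d \<le> K * (f i0 * g j0)" using d i0 j0 by auto
  moreover have "0 \<le> K * (f i0 * g j0)" using K pos(1)[OF i0(1)] pos(2)[OF j0(1)] by simp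
  ultimately have "d * (d + 1) ^ card (Z - {i0}) \<le> (K * (f i0 * g j0)) * (M ^ card (Z - {i0}) * ((\<Prod>i\<in>Z - {i0}. f i) * (\<Prod>i\<in>Z - {j0}. g i)))"
    using d(1) by (intro mult_mono) simp_all
  also have "\<dots> = K * M ^ card (Z - {i0}) * ((f i0 * (\<Prod>i\<in>Z - {i0}. f i)) * (g j0 * (\<Prod>i\<in>Z - {j0}. g i)))"
    by (simp add: mult_ac)
  also have "f i0 * (\<Prod>i\<in>Z - {i0}. f i) = (\<Prod>i\<in>Z. f i)" using Z i0 by (simp add: prod.remove)
  also have "g j0 * (\<Prod>i\<in>Z - {j0}. g i) = (\<Prod>i\<in>Z. g i)" using Z j0 by (simp add: prod.remove)
  finally show ?thesis using Z i0 by (simp add: M_def)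
qed

text \<open>Each factor 1 - S * q ^ j is a convex combination of 1 - S and 1. The one with j = 0 is
  kept exactly, because \<open>column_bound\<close> needs its smallness.\<close>

lemma cmod_qpoch_le:
  assumes "0 < q" "q < (1 :: real)" "m > 0"
  shows "cmod (qpoch S (of_real q) m) \<le> cmod (1 - S) * (cmod (1 - S) + 1) ^ (m - 1)"
proof -
  obtain k where k: "m = Suc k" using assms(3) by (cases m) auto
  have le: "cmod (1 - S * of_real q ^ j) \<le> cmod (1 - S) + 1" for j
  proof -
    have qj: "0 \<le> q ^ j" "q ^ j \<le> 1" using assms by (auto intro: power_le_one)
    have "1 - S * of_real q ^ j = of_real (q ^ j) * (1 - S) + of_real (1 - q ^ j)" by (simp add: algebra_simps)
    then have "cmod (1 - S * of_real q ^ j) \<le> cmod (of_real (q ^ j) * (1 - S)) + cmod (of_real (1 - q ^ j))"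
      by (metis norm_triangle_ineq)
    also have "\<dots> = q ^ j * cmod (1 - S) + (1 - q ^ j)"
      using qj by (simp only: norm_mult norm_of_real)
    also have "\<dots> \<le> 1 * cmod (1 - S) + 1" using qj by (intro add_mono mult_right_mono) auto
    finally show ?thesis by simp
  qed
  have "cmod (qpoch S (of_real q) m) = cmod (1 - S) * (\<Prod>i<k. cmod (1 - S * of_real q ^ Suc i))"
    unfolding qpoch_def k prod.lessThan_Suc_shift by (simp add: norm_mult prod_norm)
  also have "(\<Prod>i<k. cmod (1 - S * of_real q ^ Suc i)) \<le> (\<Prod>i<k. cmod (1 - S) + 1)"
    by (rule prod_mono) (use le in \<open>blast intro: norm_ge_zero\<close>)
  finally show ?thesis using k by (simp add: mult_left_mono)
qed

text \<open>The power of 1 - q lost here is regained from the factors (1 - q)^2 in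
  \<open>column_bound\<close>.\<close>

lemma cmod_qpoch_q_ge:
  assumes "0 < q" "q < (1 :: real)"
  shows "(1 - q) ^ m \<le> cmod (qpoch (of_real q) (of_real q) m)"
proof -
  have "1 - q \<le> cmod (1 - of_real q * of_real q ^ i)" for i
  proof -
    have 1: "q * q ^ i \<le> q * 1" using assms by (intro mult_left_mono power_le_one) auto
    have "1 - of_real q * of_real q ^ i = (of_real (1 - q * q ^ i) :: complex)" by simp
    then have "cmod (1 - of_real q * of_real q ^ i) = \<bar>1 - q * q ^ i\<bar>" by (metis norm_of_real)
    then show ?thesis using 1 assms by simp
  qed
  then have "(\<Prod>i<m. 1 - q) \<le> (\<Prod>i<m. cmod (1 - of_real q * of_real q ^ i))"
    using assms by (intro prod_mono) auto
  then show ?thesis unfolding qpoch_def by (simp add: prod_norm)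
qed

text \<open>
  The weights \<open>1 / (1 - s * x * i)\<close> are not bounded uniformly in \<open>s\<close> and \<open>x\<close>. With \<open>P\<close> the product in the
  admissibility condition one has \<open>(1 - P) * (1 - s * x * i) * (1 - s * j / x) = (1 - s\<^sup>2) * (1 - i * j)\<close>, so the factor
  \<open>1 - s\<^sup>2\<close> of \<open>qpoch (s\<^sup>2) q m\<close> compensates the smallest pair of denominators; by \<open>separated_nodes\<close> the
  others are bounded below.
\<close>

lemma column_bound:
  fixes U V :: "complex set"
  assumes fin: "finite U" "finite V" and uv: "\<And>x y. x \<in> U \<Longrightarrow> y \<in> V \<Longrightarrow> 1 - x * y \<noteq> 0"
    and q: "0 < q" "q < (1 :: real)"
  obtains M where "M \<ge> 1" "\<And>s x Z a b. x \<noteq> 0 \<Longrightarrow> (\<And>i. i \<in> U \<Longrightarrow> 1 - s * x * i \<noteq> 0) \<Longrightarrow> (\<And>j. j \<in> V \<Longrightarrow> 1 - s * j / x \<noteq> 0) \<Longrightarrow>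
     (\<And>i j. i \<in> U \<Longrightarrow> j \<in> V \<Longrightarrow> cmod ((x * i - s) / (1 - s * x * i) * ((j / x - s) / (1 - s * j / x))) \<le> 1) \<Longrightarrow>
     finite (Z :: nat set) \<Longrightarrow> inj_on a Z \<Longrightarrow> inj_on b Z \<Longrightarrow> a ` Z \<subseteq> U \<Longrightarrow> b ` Z \<subseteq> V \<Longrightarrow>
     cmod (qpoch (s\<^sup>2) (of_real q) (card Z) / qpoch (of_real q) (of_real q) (card Z) *
       (\<Prod>k\<in>Z. (1 - of_real q)\<^sup>2 / ((1 - s * x * a k) * (1 - s * b k / x)))) \<le> M"
proof -
  obtain c where c: "c > 0" "\<And>t x y. x \<in> U \<Longrightarrow> y \<in> U \<Longrightarrow> x \<noteq> y \<Longrightarrow> c \<le> cmod (1 - t * x) \<or> c \<le> cmod (1 - t * y)"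
    using separated_nodes[OF fin(1)] by metis
  obtain c' where c': "c' > 0" "\<And>t x y. x \<in> V \<Longrightarrow> y \<in> V \<Longrightarrow> x \<noteq> y \<Longrightarrow> c' \<le> cmod (1 - t * x) \<or> c' \<le> cmod (1 - t * y)"
    using separated_nodes[OF fin(2)] by metis
  have "finite ((\<lambda>(x, y). cmod (1 - x * y)) ` (U \<times> V))" using fin by simp
  moreover have "r > 0" if "r \<in> (\<lambda>(x, y). cmod (1 - x * y)) ` (U \<times> V)" for r using that uv by auto
  ultimately obtain e where e: "e > 0" "\<And>r. r \<in> (\<lambda>(x, y). cmod (1 - x * y)) ` (U \<times> V) \<Longrightarrow> e \<le> r"
    using finite_pos_lower_bound by metis
  have e': "e \<le> cmod (1 - x * y)" if "x \<in> U" "y \<in> V" for x y using e(2) that by force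
  \<comment> \<open>2 bounds the modulus of 1 - P, and \<open>e\<close> bounds that of 1 - x * y
    from below. \<open>L\<close> is the second constant of \<open>column_product_bound\<close>, and
    the exponent \<open>card U\<close> in \<open>M\<close> dominates every
    \<open>card Z\<close>.\<close>
  define K where "K = 2 / e"
  define L where "L = K + 1 / (c * c')"
  define M where "M = (1 + K + L) ^ card U"
  have K0: "K \<ge> 0" and L0: "L \<ge> 0" using e(1) c(1) c'(1) by (simp_all add: K_def L_def)
  show thesis
  proof (rule that)
    show "M \<ge> 1" unfolding M_def using K0 L0 by (intro one_le_power) simp
    fix s x Z a b
    assume x: "x \<noteq> 0" and nu: "\<And>i. i \<in> U \<Longrightarrow> 1 - s * x * i \<noteq> 0" and nv: "\<And>j. j \<in> V \<Longrightarrow> 1 - s * j / x \<noteq> 0"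
      and ad: "\<And>i j. i \<in> U \<Longrightarrow> j \<in> V \<Longrightarrow> cmod ((x * i - s) / (1 - s * x * i) * ((j / x - s) / (1 - s * j / x))) \<le> 1"
      and finZ: "finite (Z :: nat set)" and inj: "inj_on a Z" "inj_on b Z" and img: "a ` Z \<subseteq> U" "b ` Z \<subseteq> V"
    define d where "d = cmod (1 - s\<^sup>2)"
    define f where "f k = cmod (1 - s * x * a k)" for k
    define g where "g k = cmod (1 - s * b k / x)" for k
    have d_le: "d \<le> K * (f i * g j)" if ij: "i \<in> Z" "j \<in> Z" for i j
    proof -
      have aU: "a i \<in> U" and bV: "b j \<in> V" using img ij by auto
      define X where "X = 1 - s * x * a i"
      define Y where "Y = 1 - s * b j / x"
      define P where "P = (x * a i - s) / X * ((b j / x - s) / Y)"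
      have nz: "X \<noteq> 0" "Y \<noteq> 0" using nu[OF aU] nv[OF bV] by (simp_all add: X_def Y_def)
      have "P * (X * Y) = (x * a i - s) * (b j / x - s)" using nz by (simp add: P_def)
      then have "(1 - P) * (X * Y) = X * Y - (x * a i - s) * (b j / x - s)" by (simp only: left_diff_distrib mult_1)
      also have "\<dots> = (1 - s\<^sup>2) * (1 - a i * b j)"
        unfolding X_def Y_def using x by (simp add: field_simps power2_eq_square)
      finally have "d * cmod (1 - a i * b j) = cmod (1 - P) * (f i * g j)"
        unfolding d_def f_def g_def X_def[symmetric] Y_def[symmetric] by (metis norm_mult)
      moreover have "cmod (1 - P) \<le> 2"
        using norm_triangle_ineq4[of 1 P] ad[OF aU bV] unfolding P_def X_def Y_def by simp
      ultimately have "d * cmod (1 - a i * b j) \<le> 2 * (f i * g j)"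
        by (simp add: f_def g_def mult_right_mono)
      moreover have "d * e \<le> d * cmod (1 - a i * b j)" using e'[OF aU bV] by (intro mult_left_mono) (auto simp: d_def)
      ultimately show ?thesis using e(1) unfolding K_def by (simp add: field_simps)
    qed
    have fpos: "0 < f i" "0 < g i" if "i \<in> Z" for i
      using nu[of "a i"] nv[of "b i"] img that by (auto simp: f_def g_def)
    have sepf: "c \<le> f i \<or> c \<le> f j" if "i \<in> Z" "j \<in> Z" "i \<noteq> j" for i j
      using c(2)[of "a i" "a j" "s * x"] inj_onD[OF inj(1), of i j] img that unfolding f_def by auto
    have sepg: "c' \<le> g i \<or> c' \<le> g j" if "i \<in> Z" "j \<in> Z" "i \<noteq> j" for i j
      using c'(2)[of "b i" "b j" "s / x"] inj_onD[OF inj(2), of i j] img that unfolding g_def by auto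
    have cardZ: "card Z \<le> card U" using card_inj_on_le[OF inj(1) img(1) fin(1)] .
    show "cmod (qpoch (s\<^sup>2) (of_real q) (card Z) / qpoch (of_real q) (of_real q) (card Z) *
       (\<Prod>k\<in>Z. (1 - of_real q)\<^sup>2 / ((1 - s * x * a k) * (1 - s * b k / x)))) \<le> M"
    proof (cases "Z = {}")
      case True
      then show ?thesis using \<open>M \<ge> 1\<close> by (simp add: qpoch_def)
    next
      case False
      define m where "m = card Z"
      have m: "m > 0" using False finZ by (simp add: m_def card_gt_0_iff)
      have num: "cmod (qpoch (s\<^sup>2) (of_real q) m) \<le> K * L ^ (m - 1) * ((\<Prod>i\<in>Z. f i) * (\<Prod>i\<in>Z. g i))"
      proof -
        have "d \<ge> 0" by (simp add: d_def)
        then have "d * (d + 1) ^ (card Z - 1) \<le> K * (K + 1 / (c * c')) ^ (card Z - 1) * ((\<Prod>i\<in>Z. f i) * (\<Prod>i\<in>Z. g i))"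
          by (intro column_product_bound[OF finZ False _ _ _ _ K0 c(1) c'(1)]) (use fpos d_le sepf sepg in blast)+
        then show ?thesis using cmod_qpoch_le[OF q m, of "s\<^sup>2"]
          unfolding d_def[symmetric] L_def[symmetric] m_def[symmetric] by linarith
      qed
      define F where "F = (\<Prod>i\<in>Z. f i) * (\<Prod>i\<in>Z. g i)"
      have F: "F > 0" unfolding F_def using fpos by (intro mult_pos_pos prod_pos) auto
      have "cmod (\<Prod>k\<in>Z. (1 - of_real q)\<^sup>2 / ((1 - s * x * a k) * (1 - s * b k / x))) = ((1 - q)\<^sup>2) ^ m / F"
      proof -
        have "cmod ((1 - of_real q)\<^sup>2 / ((1 - s * x * a k) * (1 - s * b k / x))) = (1 - q)\<^sup>2 / (f k * g k)" for k
        proof -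
          have "cmod (1 - of_real q) = 1 - q" using q by (metis abs_of_nonneg diff_ge_0_iff_ge less_imp_le norm_of_real of_real_1 of_real_diff)
          then show ?thesis by (simp add: norm_divide norm_mult norm_power f_def g_def)
        qed
        then show ?thesis unfolding prod_norm[symmetric] by (simp add: prod_dividef prod.distrib F_def m_def)
      qed
      then have "cmod (qpoch (s\<^sup>2) (of_real q) (card Z) / qpoch (of_real q) (of_real q) (card Z) *
         (\<Prod>k\<in>Z. (1 - of_real q)\<^sup>2 / ((1 - s * x * a k) * (1 - s * b k / x)))) =
         cmod (qpoch (s\<^sup>2) (of_real q) m) / cmod (qpoch (of_real q) (of_real q) m) * (((1 - q)\<^sup>2) ^ m / F)"
        unfolding m_def by (simp add: norm_mult norm_divide)
      also have "\<dots> \<le> (K * L ^ (m - 1) * F) / (1 - q) ^ m * (((1 - q)\<^sup>2) ^ m / F)"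
        using num cmod_qpoch_q_ge[OF q, of m] q F K0 L0 unfolding F_def[symmetric]
        by (intro mult_right_mono frac_le) auto
      also have "\<dots> = K * L ^ (m - 1) * (1 - q) ^ m"
        using F q by (simp add: power2_eq_square power_mult_distrib)
      also have "\<dots> \<le> K * L ^ (m - 1) * 1"
        using K0 L0 q by (intro mult_left_mono power_le_one) auto
      also have "\<dots> \<le> (1 + K + L) * (1 + K + L) ^ (m - 1)"
        using K0 L0 by (simp, intro mult_mono power_mono) auto
      also have "\<dots> = (1 + K + L) ^ m" using m by (cases m) auto
      also have "\<dots> \<le> M" unfolding M_def using K0 L0 cardZ by (intro power_increasing) (auto simp: m_def)
      finally show ?thesis .
    qed
  qed
qed

text \<open>Admissibility is bundled with the nonvanishing of the denominators; both pass to shifted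
  parameters and to subsets of the variables.\<close>

definition adm :: "real \<Rightarrow> (nat \<Rightarrow> complex) \<Rightarrow> (nat \<Rightarrow> complex) \<Rightarrow> ('i \<Rightarrow> complex) \<Rightarrow> ('j \<Rightarrow> complex) \<Rightarrow> 'i set \<Rightarrow> 'j set \<Rightarrow> bool" where
  "adm \<rho> s xi u v A B \<longleftrightarrow> (\<forall>x. xi x \<noteq> 0 \<and> (\<forall>i\<in>A. 1 - s x * xi x * u i \<noteq> 0) \<and> (\<forall>j\<in>B. 1 - s x * v j / xi x \<noteq> 0) \<and>
     (\<forall>i\<in>A. \<forall>j\<in>B. cmod ((xi x * u i - s x) / (1 - s x * xi x * u i) * ((v j / xi x - s x) / (1 - s x * v j / xi x))) \<le> \<rho>))"

lemma adm_shift: "adm \<rho> s xi u v A B \<Longrightarrow> adm \<rho> (\<lambda>n. s (Suc n)) (\<lambda>n. xi (Suc n)) u v A B"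
  unfolding adm_def by blast

lemma adm_subset: "adm \<rho> s xi u v A B \<Longrightarrow> I \<subseteq> A \<Longrightarrow> J \<subseteq> B \<Longrightarrow> adm \<rho> s xi u v I J"
  unfolding adm_def by blast

lemma phi_mult_hat:
  "phi q s xi k z * phi q s (\<lambda>x. inverse (xi x)) k w =
    (1 - of_real q)\<^sup>2 / ((1 - s k * xi k * z) * (1 - s k * w / xi k)) *
    (\<Prod>j<k. (xi j * z - s j) / (1 - s j * xi j * z) * ((w / xi j - s j) / (1 - s j * w / xi j)))"
  unfolding phi_def prod.distrib by (simp add: power2_eq_square divide_inverse mult_ac)

text \<open>\<open>C\<close> is chosen before \<open>s\<close> and \<open>xi\<close>, so the bound
  is uniform along the shifts. For each pair of orderings \<open>phi\<close> is multiplied by its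
  hatted version at the same part: the columns before the part give powers of \<open>\<rho>\<close>,
  and the factors at the part itself, grouped by its value, are controlled by
  \<open>column_bound\<close>.\<close>

lemma cterm_bound:
  fixes u :: "'i \<Rightarrow> complex" and v :: "'j \<Rightarrow> complex"
  assumes q: "0 < q" "q < (1 :: real)" and fin: "finite A" "finite B" and card: "card A = n" "card B = n"
    and inj: "inj_on u A" "inj_on v B" and uv: "\<And>i j. i \<in> A \<Longrightarrow> j \<in> B \<Longrightarrow> 1 - u i * v j \<noteq> 0"
    and rho: "0 \<le> \<rho>" "\<rho> \<le> 1"
  obtains C where "C \<ge> 0" "\<And>s xi l. adm \<rho> s xi u v A B \<Longrightarrow> length l = n \<Longrightarrow> cmod (cterm q s xi u v l A B) \<le> C * \<rho> ^ sum_list l"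
proof -
  have "finite (u ` A)" "finite (v ` B)" using fin by auto
  then obtain M where M: "M \<ge> 1" "\<And>s x Z a b. x \<noteq> 0 \<Longrightarrow> (\<And>i. i \<in> u ` A \<Longrightarrow> 1 - s * x * i \<noteq> 0) \<Longrightarrow> (\<And>j. j \<in> v ` B \<Longrightarrow> 1 - s * j / x \<noteq> 0) \<Longrightarrow>
     (\<And>i j. i \<in> u ` A \<Longrightarrow> j \<in> v ` B \<Longrightarrow> cmod ((x * i - s) / (1 - s * x * i) * ((j / x - s) / (1 - s * j / x))) \<le> 1) \<Longrightarrow>
     finite (Z :: nat set) \<Longrightarrow> inj_on a Z \<Longrightarrow> inj_on b Z \<Longrightarrow> a ` Z \<subseteq> u ` A \<Longrightarrow> b ` Z \<subseteq> v ` B \<Longrightarrow>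
     cmod (qpoch (s\<^sup>2) (of_real q) (card Z) / qpoch (of_real q) (of_real q) (card Z) *
       (\<Prod>k\<in>Z. (1 - of_real q)\<^sup>2 / ((1 - s * x * a k) * (1 - s * b k / x)))) \<le> M"
  proof (rule column_bound[OF _ _ _ q])
    show "1 - x * y \<noteq> 0" if "x \<in> u ` A" "y \<in> v ` B" for x y using that uv by auto
  qed blast
  let ?q = "complex_of_real q"
  define C where "C = (\<Sum>xs\<in>permutations_of_set A. \<Sum>ys\<in>permutations_of_set B. cmod (pcoef ?q u xs) * cmod (pcoef ?q v ys) * M ^ n)"
  show thesis
  proof (rule that)
    show "C \<ge> 0" unfolding C_def using M(1) by (intro sum_nonneg mult_nonneg_nonneg) auto
    fix s xi :: "nat \<Rightarrow> complex" and l :: "nat list" assume ad: "adm \<rho> s xi u v A B" and l: "length l = n"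
    have ad': "xi x \<noteq> 0" "\<And>i. i \<in> A \<Longrightarrow> 1 - s x * xi x * u i \<noteq> 0" "\<And>j. j \<in> B \<Longrightarrow> 1 - s x * v j / xi x \<noteq> 0"
      "\<And>i j. i \<in> A \<Longrightarrow> j \<in> B \<Longrightarrow> cmod ((xi x * u i - s x) / (1 - s x * xi x * u i) * ((v j / xi x - s x) / (1 - s x * v j / xi x))) \<le> \<rho>" for x
      using ad unfolding adm_def by blast+
    have main: "cmod (sig_wt q s l * (\<Prod>i<n. phi q s xi (l ! i) (u (xs ! i)) * phi q s (\<lambda>x. inverse (xi x)) (l ! i) (v (ys ! i)))) \<le> M ^ n * \<rho> ^ sum_list l"
      if xs: "xs \<in> permutations_of_set A" and ys: "ys \<in> permutations_of_set B" for xs ys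
    proof -
      have xs': "set xs = A" "distinct xs" and ys': "set ys = B" "distinct ys" using xs ys by (simp_all add: permutations_of_setD)
      have len: "length xs = n" "length ys = n"
        using distinct_card[OF xs'(2)] distinct_card[OF ys'(2)] xs' ys' card by simp_all
      define a where "a i = u (xs ! i)" for i
      define b where "b i = v (ys ! i)" for i
      have mem: "xs ! i \<in> A" "ys ! i \<in> B" if "i < n" for i using that len xs' ys' nth_mem by metis+
      have inj': "inj_on a {..<n}" "inj_on b {..<n}"
      proof -
        have "inj_on (\<lambda>i. xs ! i) {..<n}" "inj_on (\<lambda>i. ys ! i) {..<n}"
          using xs' ys' len by (simp_all add: inj_on_nth)
        moreover have "(\<lambda>i. xs ! i) ` {..<n} \<subseteq> A" "(\<lambda>i. ys ! i) ` {..<n} \<subseteq> B" using mem by auto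
        ultimately show "inj_on a {..<n}" "inj_on b {..<n}"
          unfolding a_def b_def
          by (auto intro: comp_inj_on[unfolded comp_def] inj_on_subset[OF inj(1)] inj_on_subset[OF inj(2)])
      qed
      define h where "h r i = (1 - ?q)\<^sup>2 / ((1 - s r * xi r * a i) * (1 - s r * b i / xi r))" for r i
      define P where "P i = (\<Prod>j<l ! i. (xi j * a i - s j) / (1 - s j * xi j * a i) * ((b i / xi j - s j) / (1 - s j * b i / xi j)))" for i
      define Zr where "Zr r = {i \<in> {..<n}. l ! i = r}" for r
      have cnt: "count_list l r = card (Zr r)" for r
        unfolding Zr_def count_list_eq_length_filter length_filter_conv_card l by (rule arg_cong[where f=card]) auto
      have Pb: "cmod (P i) \<le> \<rho> ^ (l ! i)" if "i < n" for i
      proof -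
        have "cmod (P i) \<le> (\<Prod>j<l ! i. \<rho>)"
          unfolding P_def prod_norm[symmetric] using ad'(4)[OF mem[OF that]]
          by (intro prod_mono) (auto simp: a_def b_def)
        then show ?thesis by simp
      qed
      have "(\<Prod>i<n. cmod (P i)) \<le> (\<Prod>i<n. \<rho> ^ (l ! i))" using Pb by (intro prod_mono) auto
      also have "\<dots> = \<rho> ^ sum_list l" by (simp add: power_sum[symmetric] sum_list_sum_nth l atLeast0LessThan)
      finally have Pall: "(\<Prod>i<n. cmod (P i)) \<le> \<rho> ^ sum_list l" .
      have "sig_wt q s l * (\<Prod>i<n. h (l ! i) i) = (\<Prod>r\<in>set l. qpoch ((s r)\<^sup>2) ?q (card (Zr r)) / qpoch ?q ?q (card (Zr r)) * (\<Prod>i\<in>Zr r. h r i))"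
      proof -
        have "(\<Prod>i<n. h (l ! i) i) = (\<Prod>r\<in>set l. \<Prod>i\<in>{i \<in> {..<n}. l ! i = r}. h (l ! i) i)"
          by (rule prod.group[symmetric]) (use l in auto)
        also have "\<dots> = (\<Prod>r\<in>set l. \<Prod>i\<in>Zr r. h r i)"
          unfolding Zr_def by (intro prod.cong) auto
        finally show ?thesis unfolding sig_wt_def cnt by (simp only: prod.distrib)
      qed
      moreover have "cmod (\<Prod>r\<in>set l. qpoch ((s r)\<^sup>2) ?q (card (Zr r)) / qpoch ?q ?q (card (Zr r)) * (\<Prod>i\<in>Zr r. h r i)) \<le> (\<Prod>r\<in>set l. M)"
        unfolding prod_norm[symmetric]
      proof (intro prod_mono conjI norm_ge_zero)
        fix r
        show "cmod (qpoch ((s r)\<^sup>2) ?q (card (Zr r)) / qpoch ?q ?q (card (Zr r)) * (\<Prod>i\<in>Zr r. h r i)) \<le> M"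
          unfolding h_def
        proof (rule M(2))
          show "xi r \<noteq> 0" by (rule ad')
          show "\<And>i. i \<in> u ` A \<Longrightarrow> 1 - s r * xi r * i \<noteq> 0" using ad'(2) by auto
          show "\<And>j. j \<in> v ` B \<Longrightarrow> 1 - s r * j / xi r \<noteq> 0" using ad'(3) by auto
          show "cmod ((xi r * i - s r) / (1 - s r * xi r * i) * ((j / xi r - s r) / (1 - s r * j / xi r))) \<le> 1"
            if "i \<in> u ` A" "j \<in> v ` B" for i j using that ad'(4)[of _ _ r] rho(2) by (force intro: order.trans)
          show "finite (Zr r)" by (simp add: Zr_def)
          show "inj_on a (Zr r)" "inj_on b (Zr r)" using inj' by (auto simp: Zr_def intro: inj_on_subset)
          show "a ` Zr r \<subseteq> u ` A" "b ` Zr r \<subseteq> v ` B" using mem by (auto simp: Zr_def a_def b_def)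
        qed
      qed
      \<comment> \<open>At most n different parts occur, and \<open>M\<close> is at least 1.\<close>
      moreover have "(\<Prod>r\<in>set l. M) \<le> M ^ n" using M(1) card_length[of l] l by (simp add: power_increasing)
      ultimately have hb: "cmod (sig_wt q s l * (\<Prod>i<n. h (l ! i) i)) \<le> M ^ n" by simp
      have "(\<Prod>i<n. phi q s xi (l ! i) (u (xs ! i)) * phi q s (\<lambda>x. inverse (xi x)) (l ! i) (v (ys ! i))) = (\<Prod>i<n. h (l ! i) i) * (\<Prod>i<n. P i)"
        unfolding phi_mult_hat h_def P_def a_def b_def by (simp only: prod.distrib)
      then have "cmod (sig_wt q s l * (\<Prod>i<n. phi q s xi (l ! i) (u (xs ! i)) * phi q s (\<lambda>x. inverse (xi x)) (l ! i) (v (ys ! i)))) =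
        cmod (sig_wt q s l * (\<Prod>i<n. h (l ! i) i)) * (\<Prod>i<n. cmod (P i))"
        by (simp only: norm_mult prod_norm[symmetric] mult.assoc)
      also have "\<dots> \<le> M ^ n * \<rho> ^ sum_list l"
        using hb Pall M(1) by (intro mult_mono) (auto intro: prod_nonneg)
      finally show ?thesis .
    qed
    have s1: "symm ?q u (map (phi q s xi) l) A = (\<Sum>xs\<in>permutations_of_set A. pcoef ?q u xs * (\<Prod>i<n. phi q s xi (l ! i) (u (xs ! i))))"
      by (subst symm_eq_perms) (use fin card l in auto)
    have s2: "symm ?q v (map (phi q s (\<lambda>x. inverse (xi x))) l) B = (\<Sum>ys\<in>permutations_of_set B. pcoef ?q v ys * (\<Prod>i<n. phi q s (\<lambda>x. inverse (xi x)) (l ! i) (v (ys ! i))))"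
      by (subst symm_eq_perms) (use fin card l in auto)
    have "cterm q s xi u v l A B = (\<Sum>xs\<in>permutations_of_set A. \<Sum>ys\<in>permutations_of_set B. pcoef ?q u xs * pcoef ?q v ys *
      (sig_wt q s l * (\<Prod>i<n. phi q s xi (l ! i) (u (xs ! i)) * phi q s (\<lambda>x. inverse (xi x)) (l ! i) (v (ys ! i)))))"
      unfolding cterm_def s1 s2 mult.assoc sum_product unfolding sum_distrib_left
      by (intro sum.cong refl) (simp add: prod.distrib mult_ac)
    also have "cmod \<dots> \<le> (\<Sum>xs\<in>permutations_of_set A. \<Sum>ys\<in>permutations_of_set B. cmod (pcoef ?q u xs) * cmod (pcoef ?q v ys) * (M ^ n * \<rho> ^ sum_list l))"
      by (intro order.trans[OF norm_sum] sum_mono) (use main in \<open>auto simp: norm_mult intro!: mult_left_mono\<close>)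
    also have "\<dots> = C * \<rho> ^ sum_list l"
      unfolding C_def sum_distrib_right by (intro sum.cong refl) (simp add: mult_ac)
    finally show "cmod (cterm q s xi u v l A B) \<le> C * \<rho> ^ sum_list l" .
  qed
qed

lemma summable_on_power_sum_list:
  assumes "0 \<le> \<rho>" "\<rho> < (1 :: real)"
  shows "(\<lambda>l :: nat list. \<rho> ^ sum_list l) summable_on {l. length l = n}"
proof (induction n)
  case 0
  then show ?case by simp
next
  case (Suc n)
  define S where "S = infsum (\<lambda>l :: nat list. \<rho> ^ sum_list l) {l. length l = n}"
  have "(\<lambda>(k, l :: nat list). \<rho> ^ k * \<rho> ^ sum_list l) summable_on (UNIV \<times> {l. length l = n})"
  proof (rule summable_on_SigmaI)
    show "((\<lambda>l. case (k, l) of (k, l) \<Rightarrow> \<rho> ^ k * \<rho> ^ sum_list l) has_sum \<rho> ^ k * S) {l. length l = n}" for k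
      using has_sum_cmult_right[OF has_sum_infsum[OF Suc.IH]] unfolding S_def by simp
    have "(\<lambda>k. \<rho> ^ k) summable_on UNIV"
      by (rule summable_nonneg_imp_summable_on) (use assms in \<open>auto intro: summable_geometric\<close>)
    then show "(\<lambda>k. \<rho> ^ k * S) summable_on UNIV" by (rule summable_on_cmult_left)
  qed (use assms in auto)
  moreover have "inj_on (\<lambda>(k, l). k # l) (UNIV \<times> {l. length l = n})" by (auto simp: inj_on_def)
  moreover have "(\<lambda>(k, l). k # l) ` (UNIV \<times> {l :: nat list. length l = n}) = {l. length l = Suc n}"
    by (auto simp: length_Suc_conv image_iff)
  ultimately show ?case
    using summable_on_reindex[of "\<lambda>(k, l). k # l" "UNIV \<times> {l :: nat list. length l = n}" "\<lambda>l. \<rho> ^ sum_list l"]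
    by (simp add: comp_def case_prod_unfold power_add)
qed

section \<open>Rescaling the variables by \<xi>\<close>

lemma cross_scale:
  assumes "x \<noteq> 0"
  shows "cross q (\<lambda>i. x * u i) X Y = cross q u X Y"
proof -
  have "(x * u i - q * (x * u j)) / (x * u i - x * u j) = (u i - q * u j) / (u i - u j)" for i j
  proof -
    have "x * u i - q * (x * u j) = x * (u i - q * u j)" "x * u i - x * u j = x * (u i - u j)" by (simp_all add: algebra_simps)
    then show ?thesis using assms by simp
  qed
  then show ?thesis unfolding cross_def by simp
qed

text \<open>\<open>Dsum\<close> depends only on the quotients of the u i and on the products u i * v
  j. This invariance is why \<xi> can drop out of the unrefined sum.\<close>

lemma Dsum_scale:
  assumes "x \<noteq> 0"
  shows "Dsum q (\<lambda>i. x * u i) (\<lambda>j. inverse x * v j) A B = Dsum q u v A B"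
proof -
  have "x * u i * (inverse x * v j) = u i * v j" for i j using assms by simp
  then have "ratio q (x * u i) (inverse x * v j) = ratio q (u i) (v j)" for i j
    unfolding ratio_def by (simp only: mult.assoc[of q])
  then show ?thesis unfolding Dsum_def Rsum_def cross_scale[OF assms] by simp
qed

text \<open>The denominators of \<open>colw\<close> over \<open>I\<close> and over its complement
  combine to a product over the whole index set, the same for all terms.\<close>

lemma sum_columns_eq_Esum:
  assumes x: "x \<noteq> 0" and fin: "finite A" "finite B"
    and nu: "\<And>i. i \<in> A \<Longrightarrow> 1 - s * x * u i \<noteq> 0" and nv: "\<And>j. j \<in> B \<Longrightarrow> 1 - s * inverse x * v j \<noteq> 0"
  shows "(\<Sum>I\<in>Pow A. \<Sum>J\<in>Pow B. if card J = card I then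
      (c (card (A - I)) * colw q s x u A I * colw q s (inverse x) v B J) * Dsum q u v I J else 0) =
    Esum q s c (\<lambda>i. x * u i) (\<lambda>j. inverse x * v j) A B / ((\<Prod>i\<in>A. 1 - s * x * u i) * (\<Prod>j\<in>B. 1 - s * inverse x * v j))"
proof -
  have col: "colw q s y w X I = cross q (\<lambda>i. y * w i) I (X - I) * (\<Prod>i\<in>I. y * w i - s) / (\<Prod>i\<in>X. 1 - s * y * w i)"
    if "finite X" "I \<subseteq> X" "y \<noteq> 0" for y I X and w :: "'c \<Rightarrow> complex"
    unfolding colw_def cross_scale[OF that(3)] prod.subset_diff[OF that(2,1)] by (simp add: prod_dividef mult_ac)
  show ?thesis unfolding Esum_def sum_divide_distrib
  proof (intro sum.cong refl, goal_cases)
    case (1 I J)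

    then show ?case
      using col[of A I x u] col[of B J "inverse x" v] fin x unfolding Dsum_scale[OF x] by simp
  qed
qed

subsection \<open>The Cauchy sums\<close>

lemma inj_power_of_real:
  assumes "0 < q" "q < (1 :: real)"
  shows "inj (\<lambda>k. complex_of_real q ^ k)"
proof (rule injI)
  fix k m assume "complex_of_real q ^ k = complex_of_real q ^ m"
  then have "q ^ k = q ^ m" by (metis of_real_eq_iff of_real_power)
  then show "k = m" using power_inject_exp'[of q k m] assms by simp
qed

text \<open>The denominators of the column cancel the row and column factors in
  \<open>Esum_one\<close>. Thus \<open>Dsum\<close> solves the recursion that
  \<open>has_sum_first_column\<close> gives for the unrefined sum.\<close>

lemma Esum_one_columns:
  fixes u :: "'i \<Rightarrow> complex" and v :: "'j \<Rightarrow> complex"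
  assumes q: "0 < q" "q < (1 :: real)" and fin: "finite A" "finite B" and card: "card A = card B"
    and inj: "inj_on u A" "inj_on v B" and uv: "\<And>i j. i \<in> A \<Longrightarrow> j \<in> B \<Longrightarrow> 1 - u i * v j \<noteq> 0"
    and quv: "\<And>i j. i \<in> A \<Longrightarrow> j \<in> B \<Longrightarrow> 1 - of_real q * u i * v j \<noteq> 0"
    and x: "x \<noteq> 0" and nu: "\<And>i. i \<in> A \<Longrightarrow> 1 - s * x * u i \<noteq> 0" and nv: "\<And>j. j \<in> B \<Longrightarrow> 1 - s * inverse x * v j \<noteq> 0"
  shows "(\<Sum>I\<in>Pow A. \<Sum>J\<in>Pow B. if card J = card I then
      (cweight (of_real q) s 1 (card (A - I)) * colw (of_real q) s x u A I * colw (of_real q) s (inverse x) v B J) * Dsum (of_real q) u v I J else 0) =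
    Dsum (of_real q) u v A B"
proof -
  let ?q = "complex_of_real q"
  have xx: "x * a * (inverse x * b) = a * b" for a b using x by simp
  have "Esum ?q s (cweight ?q s 1) (\<lambda>i. x * u i) (\<lambda>j. inverse x * v j) A B =
    (\<Prod>i\<in>A. 1 - s * (x * u i)) * (\<Prod>j\<in>B. 1 - s * (inverse x * v j)) * Dsum ?q (\<lambda>i. x * u i) (\<lambda>j. inverse x * v j) A B"
  proof (rule Esum_one[OF _ inj_power_of_real[OF q] fin card])
    show "?q \<noteq> 0" using q by simp
    show "inj_on (\<lambda>i. x * u i) A" "inj_on (\<lambda>j. inverse x * v j) B" using inj x by (auto simp: inj_on_def)
    show "\<And>i j. i \<in> A \<Longrightarrow> j \<in> B \<Longrightarrow> 1 - x * u i * (inverse x * v j) \<noteq> 0" unfolding xx by (rule uv)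
    show "\<And>i j. i \<in> A \<Longrightarrow> j \<in> B \<Longrightarrow> 1 - ?q * (x * u i) * (inverse x * v j) \<noteq> 0"
      unfolding mult.assoc[of ?q] xx using quv by (simp add: mult.assoc)
  qed
  moreover have "(\<Prod>i\<in>A. 1 - s * x * u i) \<noteq> 0" "(\<Prod>j\<in>B. 1 - s * inverse x * v j) \<noteq> 0"
    using nu nv fin by (simp_all add: prod_zero_iff)
  moreover have "(\<Prod>i\<in>A. 1 - s * (x * u i)) = (\<Prod>i\<in>A. 1 - s * x * u i)"
    "(\<Prod>j\<in>B. 1 - s * (inverse x * v j)) = (\<Prod>j\<in>B. 1 - s * inverse x * v j)" by (simp_all add: mult.assoc)
  moreover have "(\<Sum>I\<in>Pow A. \<Sum>J\<in>Pow B. if card J = card I then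
      (cweight ?q s 1 (card (A - I)) * colw ?q s x u A I * colw ?q s (inverse x) v B J) * Dsum ?q u v I J else 0) =
    Esum ?q s (cweight ?q s 1) (\<lambda>i. x * u i) (\<lambda>j. inverse x * v j) A B / ((\<Prod>i\<in>A. 1 - s * x * u i) * (\<Prod>j\<in>B. 1 - s * inverse x * v j))"
    by (rule sum_columns_eq_Esum[OF x fin]) (use nu nv in blast)+
  ultimately show ?thesis unfolding Dsum_scale[OF x] by simp
qed

lemma geometric_forces_zero:
  fixes e C \<rho> :: real
  assumes "\<And>k :: nat. e \<le> \<rho> ^ k * C" "0 \<le> \<rho>" "\<rho> < 1"
  shows "e \<le> 0"
proof -
  have "(\<lambda>k. \<rho> ^ k * C) \<longlonglongrightarrow> 0 * C" using assms by (intro tendsto_intros LIMSEQ_realpow_zero) auto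
  then show ?thesis using LIMSEQ_le_const[of "\<lambda>k. \<rho> ^ k * C" 0 e] assms(1) by auto
qed

text \<open>The parameters vary in the induction because the inner sums have shifted ones.
  Convergence is taken from \<open>cterm_bound\<close> beforehand, so that the recursion may be
  applied to the values of the sums.\<close>

lemma has_sum_cterm:
  fixes u :: "'i \<Rightarrow> complex" and v :: "'j \<Rightarrow> complex"
  assumes q: "0 < q" "q < (1 :: real)" and rho: "0 \<le> \<rho>" "\<rho> < 1"
  shows "finite A \<Longrightarrow> finite B \<Longrightarrow> card A = n \<Longrightarrow> card B = n \<Longrightarrow> inj_on u A \<Longrightarrow> inj_on v B \<Longrightarrow>
    (\<And>i j. i \<in> A \<Longrightarrow> j \<in> B \<Longrightarrow> 1 - u i * v j \<noteq> 0) \<Longrightarrow>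
    (\<And>i j. i \<in> A \<Longrightarrow> j \<in> B \<Longrightarrow> 1 - of_real q * u i * v j \<noteq> 0) \<Longrightarrow>
    adm \<rho> s xi u v A B \<Longrightarrow>
    ((\<lambda>l. cterm q s xi u v l A B) has_sum Dsum (of_real q) u v A B) (Sign n)"
proof (induction n arbitrary: A B s xi rule: less_induct)
  case (less n)
  note fin = less.prems(1,2) and card = less.prems(3,4) and inj = less.prems(5,6) and uv = less.prems(7) and quv = less.prems(8)
  let ?q = "complex_of_real q"
  let ?D = "Dsum ?q u v A B"
  show ?case
  proof (cases "n = 0")
    case True
    then have "A = {}" "B = {}" "Sign n = {[]}" using fin card by (auto simp: Sign_def)
    then show ?thesis by (simp add: cterm_def sig_wt_def has_sum_finite_iff)
  next
    case False
    obtain C where C: "C \<ge> 0" "\<And>s xi l. adm \<rho> s xi u v A B \<Longrightarrow> length l = n \<Longrightarrow> cmod (cterm q s xi u v l A B) \<le> C * \<rho> ^ sum_list l"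
      using cterm_bound[OF q fin card inj uv rho(1) less_imp_le[OF rho(2)]] by metis
    have "(\<lambda>l :: nat list. \<rho> ^ sum_list l) summable_on Sign n"
      by (rule summable_on_subset_banach[OF summable_on_power_sum_list[OF rho, of n]]) (auto simp: Sign_def)
    then have gs: "(\<lambda>l :: nat list. C * \<rho> ^ sum_list l) summable_on Sign n" by (rule summable_on_cmult_right)
    \<comment> \<open>Bounds the sums for all admissible parameters at once, since \<open>C\<close>
      does not depend on them.\<close>
    define G where "G = infsum (\<lambda>l :: nat list. C * \<rho> ^ sum_list l) (Sign n)"
    define Zs where "Zs s xi = infsum (\<lambda>l. cterm q s xi u v l A B) (Sign n)" for s xi
    have bound: "cmod (cterm q s xi u v l A B) \<le> C * \<rho> ^ sum_list l" if "adm \<rho> s xi u v A B" "l \<in> Sign n" for s xi l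
      using C(2)[OF that(1)] that(2) by (simp add: Sign_def)
    have hs: "((\<lambda>l. cterm q s xi u v l A B) has_sum Zs s xi) (Sign n)" if "adm \<rho> s xi u v A B" for s xi
      unfolding Zs_def using abs_summable_on_comparison_test'[OF gs bound[OF that]]
      by (intro has_sum_infsum) (rule abs_summable_summable)
    have Zb: "cmod (Zs s xi) \<le> G" if "adm \<rho> s xi u v A B" for s xi
      by (rule norm_infsum_le[OF hs[OF that] has_sum_infsum[OF gs, folded G_def] bound[OF that]])
    have rec: "cmod (Zs s xi - ?D) \<le> \<rho> * cmod (Zs (\<lambda>n. s (Suc n)) (\<lambda>n. xi (Suc n)) - ?D)" if ad: "adm \<rho> s xi u v A B" for s xi
    proof -
      define s' where "s' = (\<lambda>n. s (Suc n))"
      define xi' where "xi' = (\<lambda>n. xi (Suc n))"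
      have ad': "adm \<rho> s' xi' u v A B" unfolding s'_def xi'_def by (rule adm_shift[OF ad])
      \<comment> \<open>At \<open>I = A\<close>, \<open>J = B\<close> this is the unknown sum
        itself, written as \<open>Dsum\<close> plus the difference. By linearity the difference then
        appears with the coefficient \<open>K A B\<close>.\<close>
      define Z where "Z I J = Dsum ?q u v I J + (if I = A \<and> J = B then Zs s' xi' - ?D else 0)" for I J
      define K where "K I J = cweight ?q (s 0) 1 (card (A - I)) * colw ?q (s 0) (xi 0) u A I * colw ?q (s 0) (inverse (xi 0)) v B J" for I J
      have x0: "xi 0 \<noteq> 0" and nu: "\<And>i. i \<in> A \<Longrightarrow> 1 - s 0 * xi 0 * u i \<noteq> 0" and nv: "\<And>j. j \<in> B \<Longrightarrow> 1 - s 0 * inverse (xi 0) * v j \<noteq> 0"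
        and P: "\<And>i j. i \<in> A \<Longrightarrow> j \<in> B \<Longrightarrow> cmod ((xi 0 * u i - s 0) / (1 - s 0 * xi 0 * u i) * ((v j / xi 0 - s 0) / (1 - s 0 * v j / xi 0))) \<le> \<rho>"
        using ad unfolding adm_def by (auto simp: divide_inverse mult_ac)
      have JB: "J = B" if "J \<subseteq> B" "card J = card A" for J using card_subset_eq[OF fin(2) that(1)] that card by simp
      have "((\<lambda>l. 1 * cterm q s xi u v l A B) has_sum
        (\<Sum>I\<in>Pow A. \<Sum>J\<in>Pow B. if card J = card I then
        (1 * qpoch ((s 0)\<^sup>2) ?q (card (A - I)) * qpoch ?q ?q (card (A - I)) *
         colw ?q (s 0) (xi 0) u A I * colw ?q (s 0) (inverse (xi 0)) v B J) * Z I J else 0)) (Sign n)"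
      proof (rule has_sum_first_column[where w="\<lambda>_. 1", OF q fin card inj])
        fix I J assume IJ: "I \<subseteq> A" "J \<subseteq> B" "card J = card I"
        show "((\<lambda>l. cterm q (\<lambda>n. s (Suc n)) (\<lambda>n. xi (Suc n)) u v l I J) has_sum Z I J) (Sign (card I))"
        proof (cases "I = A")
          case True
          then have "J = B" using JB IJ by simp
          then show ?thesis using hs[OF ad'] True card unfolding Z_def s'_def xi'_def by simp
        next
          case False
          then have lt: "card I < n" using psubset_card_mono[OF fin(1), of I] IJ card by auto
          have fI: "finite I" "finite J" using IJ fin by (auto intro: finite_subset)
          have iI: "inj_on u I" "inj_on v J" using IJ inj by (auto intro: inj_on_subset)
          have "((\<lambda>l. cterm q s' xi' u v l I J) has_sum Dsum ?q u v I J) (Sign (card I))"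
            by (rule less.IH[OF lt fI refl IJ(3) iI _ _ adm_subset[OF ad' IJ(1,2)]]) (use uv quv IJ in blast)+
          then show ?thesis using False unfolding Z_def s'_def xi'_def by simp
        qed
      qed
      moreover have "1 * qpoch ((s 0)\<^sup>2) ?q (card (A - I)) * qpoch ?q ?q (card (A - I)) *
         colw ?q (s 0) (xi 0) u A I * colw ?q (s 0) (inverse (xi 0)) v B J = K I J" for I J
        unfolding K_def cweight_def by simp
      ultimately have "((\<lambda>l. cterm q s xi u v l A B) has_sum (\<Sum>I\<in>Pow A. \<Sum>J\<in>Pow B. if card J = card I then K I J * Z I J else 0)) (Sign n)"
        by (simp only: mult_1)
      then have "Zs s xi = (\<Sum>I\<in>Pow A. \<Sum>J\<in>Pow B. if card J = card I then K I J * Z I J else 0)"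
        using has_sum_unique[OF hs[OF ad]] by blast
      also have "\<dots> = (\<Sum>I\<in>Pow A. \<Sum>J\<in>Pow B. if card J = card I then K I J * Dsum ?q u v I J else 0) +
         (\<Sum>I\<in>Pow A. \<Sum>J\<in>Pow B. if I = A then (if J = B then K A B * (Zs s' xi' - ?D) else 0) else 0)"
        unfolding sum.distrib[symmetric]
      proof (intro sum.cong refl, goal_cases)
        case (1 I J)

        show ?case
        proof (cases "I = A \<and> J = B")
          case True
          then show ?thesis using card by (simp add: Z_def distrib_left right_diff_distrib)
        next
          case False
          then have "Z I J = Dsum ?q u v I J" unfolding Z_def by (simp only: if_False add_0_right)
          moreover have "(if I = A then (if J = B then K A B * (Zs s' xi' - ?D) else 0) else 0) = 0"
            using False by (cases "I = A") simp_all
          ultimately show ?thesis by (simp only: add_0_right)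
        qed
      qed
      also have "(\<Sum>I\<in>Pow A. \<Sum>J\<in>Pow B. if card J = card I then K I J * Dsum ?q u v I J else 0) = ?D"
        unfolding K_def by (rule Esum_one_columns[OF q fin _ inj _ _ x0]) (use card uv quv nu nv in simp_all)
      also have "(\<Sum>I\<in>Pow A. \<Sum>J\<in>Pow B. if I = A then (if J = B then K A B * (Zs s' xi' - ?D) else 0) else 0) = K A B * (Zs s' xi' - ?D)"
      proof -
        have "(\<Sum>I\<in>Pow A. \<Sum>J\<in>Pow B. if I = A then (if J = B then K A B * (Zs s' xi' - ?D) else 0) else 0) =
          (\<Sum>I\<in>Pow A. if I = A then K A B * (Zs s' xi' - ?D) else 0)"
          using fin by (intro sum.cong refl) auto
        then show ?thesis using fin by simp
      qed
      finally have eq: "Zs s xi - ?D = K A B * (Zs s' xi' - ?D)" by simp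
      have "cmod (K A B) \<le> \<rho>"
      proof -
        \<comment> \<open>Any pairing of the two sets will do, since admissibility bounds the
          product of a u-factor and a v-factor for all pairs of indices.\<close>
        obtain e where e: "bij_betw e A B" using finite_same_card_bij[OF fin] card by auto
        have "K A B = (\<Prod>i\<in>A. (xi 0 * u i - s 0) / (1 - s 0 * xi 0 * u i)) * (\<Prod>j\<in>B. (v j / xi 0 - s 0) / (1 - s 0 * v j / xi 0))"
          unfolding K_def colw_def cweight_def qpoch_def cross_def by (simp add: divide_inverse mult_ac)
        also have "(\<Prod>j\<in>B. (v j / xi 0 - s 0) / (1 - s 0 * v j / xi 0)) = (\<Prod>i\<in>A. (v (e i) / xi 0 - s 0) / (1 - s 0 * v (e i) / xi 0))"
          by (rule prod.reindex_bij_betw[OF e, symmetric])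
        finally have "cmod (K A B) = (\<Prod>i\<in>A. cmod ((xi 0 * u i - s 0) / (1 - s 0 * xi 0 * u i) * ((v (e i) / xi 0 - s 0) / (1 - s 0 * v (e i) / xi 0))))"
          unfolding prod_norm by (simp only: prod.distrib)
        also have "\<dots> \<le> (\<Prod>i\<in>A. \<rho>)"
          by (intro prod_mono conjI norm_ge_zero P) (use e in \<open>auto simp: bij_betw_def\<close>)
        also have "\<dots> = \<rho> ^ n" using card by simp
        \<comment> \<open>Here n \<noteq> 0 enters: a contraction needs at least one factor
          \<open>\<rho>\<close>.\<close>
        also have "\<dots> \<le> \<rho> ^ 1" using False rho by (intro power_decreasing) auto
        finally show ?thesis by simp
      qed
      then show ?thesis unfolding eq norm_mult s'_def xi'_def by (intro mult_right_mono) auto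
    qed
    have iter: "cmod (Zs s xi - ?D) \<le> \<rho> ^ k * (G + cmod ?D)" if "adm \<rho> s xi u v A B" for s xi k
      using that
    proof (induction k arbitrary: s xi)
      case 0
      then show ?case using Zb[OF 0] norm_triangle_ineq4[of "Zs s xi" ?D] by simp
    next
      case (Suc k)
      have "cmod (Zs s xi - ?D) \<le> \<rho> * (\<rho> ^ k * (G + cmod ?D))"
        by (rule order.trans[OF rec[OF Suc.prems] mult_left_mono[OF Suc.IH[OF adm_shift[OF Suc.prems]] rho(1)]])
      then show ?case by (simp add: mult_ac)
    qed
    have "cmod (Zs s xi - ?D) \<le> 0" by (rule geometric_forces_zero[OF iter[OF less.prems(9)] rho])
    then show ?thesis using hs[OF less.prems(9)] by simp
  qed
qed

theorem theorem1p1: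
  fixes q :: real and s xi :: "nat \<Rightarrow> complex" and \<gamma> :: complex and N :: nat
    and u v :: "nat \<Rightarrow> complex"
  assumes q_pos: "0 < q" and q_lt1: "q < 1"
    and xi_nz: "\<forall>x. xi x \<noteq> 0"
    and N_ge1: "N \<ge> 1"
    and gamma_nz: "\<gamma> \<noteq> 0"
    and gen_u: "\<forall>x. \<forall>i<N. 1 - s x * xi x * u i \<noteq> 0"
    and gen_v: "\<forall>x. \<forall>j<N. 1 - s x * v j / xi x \<noteq> 0"
    and gen_u_dist: "\<forall>i<N. \<forall>j<N. i \<noteq> j \<longrightarrow> u i \<noteq> u j"
    and gen_v_dist: "\<forall>i<N. \<forall>j<N. i \<noteq> j \<longrightarrow> v i \<noteq> v j"
    and gen_uv: "\<forall>i<N. \<forall>j<N. 1 - u i * v j \<noteq> 0 \<and> 1 - of_real q * u i * v j \<noteq> 0"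
    and gen_s0: "\<forall>k. qpoch ((s 0)\<^sup>2) (of_real q) k \<noteq> 0"
    and admissible: "\<exists>\<epsilon>>0. \<forall>i<N. \<forall>j<N. \<forall>x.
        cmod ((xi x * u i - s x) / (1 - s x * xi x * u i) *
              ((v j / xi x - s x) / (1 - s x * v j / xi x))) \<le> 1 - \<epsilon>"
  shows "((\<lambda>l. qpoch (\<gamma> * of_real q) (of_real q) (count_list l 0) *
               qpoch ((s 0)\<^sup>2 / \<gamma>) (of_real q) (count_list l 0) /
               (qpoch (of_real q) (of_real q) (count_list l 0) *
                qpoch ((s 0)\<^sup>2) (of_real q) (count_list l 0)) *
               spinHL q s xi l u * spinHL_dual q s xi l v)
         has_sum
           ((\<Prod>j<N. 1 / ((1 - s 0 * xi 0 * u j) * (1 - s 0 * v j / xi 0))) *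
            (\<Prod>i<N. \<Prod>j<N. 1 - of_real q * u i * v j) /
            (\<Prod>i<N. \<Prod>j\<in>{i<..<N}. (u i - u j) * (v i - v j)) *
            det (mat N N (\<lambda>(i, j).
              ((1 - \<gamma>) * (of_real q - (s 0)\<^sup>2 / \<gamma>) * (1 - u i * v j) +
               (1 - of_real q) * (1 - xi 0 * s 0 * u i) * (1 - s 0 * v j / xi 0)) /
              ((1 - u i * v j) * (1 - of_real q * u i * v j)))))) (Sign N)"
proof -
  let ?q = "complex_of_real q"
  let ?A = "{..<N}"
  note q = q_pos q_lt1
  \<comment> \<open>\<open>Esum_eq_det\<close> contains no \<xi>; it is applied to the variables x *
    u i and v j / x.\<close>
  define x where "x = xi 0"
  define w where "w m = qpoch (\<gamma> * ?q) ?q m * qpoch ((s 0)\<^sup>2 / \<gamma>) ?q m / (qpoch ?q ?q m * qpoch ((s 0)\<^sup>2) ?q m)" for m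
  have x0: "x \<noteq> 0" using xi_nz by (simp add: x_def)
  have xx: "x * a * (inverse x * b) = a * b" for a b using x0 by simp
  have qxx: "?q * (x * a) * (inverse x * b) = ?q * a * b" for a b using xx[of a b] by (simp only: mult.assoc)
  have inj: "inj_on u ?A" "inj_on v ?A" using gen_u_dist gen_v_dist by (auto simp: inj_on_def)
  have uv: "1 - u i * v j \<noteq> 0" "1 - ?q * u i * v j \<noteq> 0" if "i \<in> ?A" "j \<in> ?A" for i j using gen_uv that by auto
  obtain \<epsilon> where eps: "\<epsilon> > 0" "\<forall>i<N. \<forall>j<N. \<forall>x. cmod ((xi x * u i - s x) / (1 - s x * xi x * u i) *
              ((v j / xi x - s x) / (1 - s x * v j / xi x))) \<le> 1 - \<epsilon>" using admissible by blast
  have N0: "0 < N" using N_ge1 by simp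
  have "0 \<le> 1 - \<epsilon>" by (rule order.trans[OF norm_ge_zero eps(2)[rule_format, OF N0 N0, of 0]])
  then have rho: "0 \<le> 1 - \<epsilon>" "1 - \<epsilon> < 1" using eps(1) by auto
  have ad: "adm (1 - \<epsilon>) s xi u v ?A ?A" unfolding adm_def using xi_nz gen_u gen_v eps(2) by (simp only: lessThan_iff Ball_def) blast
  have nu: "1 - s 0 * x * u i \<noteq> 0" if "i \<in> ?A" for i using gen_u that by (auto simp: x_def)
  have nv: "1 - s 0 * inverse x * v j \<noteq> 0" if "j \<in> ?A" for j
    using gen_v that by (auto simp: x_def divide_inverse mult_ac)
  \<comment> \<open>The denominators of the refined weight cancel against the factors of the removed
    column; this uses the genericity of s 0.\<close>
  have cw: "w m * qpoch ((s 0)\<^sup>2) ?q m * qpoch ?q ?q m = cweight ?q (s 0) \<gamma> m" for m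
    unfolding w_def cweight_def using gen_s0 qpoch_q_nonzero[OF q, of m] by simp
  have "((\<lambda>l. w (count_list l 0) * cterm q s xi u v l ?A ?A) has_sum
    (\<Sum>I\<in>Pow ?A. \<Sum>J\<in>Pow ?A. if card J = card I then
      (w (card (?A - I)) * qpoch ((s 0)\<^sup>2) ?q (card (?A - I)) * qpoch ?q ?q (card (?A - I)) *
       colw ?q (s 0) (xi 0) u ?A I * colw ?q (s 0) (inverse (xi 0)) v ?A J) * Dsum ?q u v I J else 0)) (Sign N)"
  proof (rule has_sum_first_column[OF q _ _ _ _ inj])
    fix I J assume IJ: "I \<subseteq> ?A" "J \<subseteq> ?A" "card J = card I"
    have fI: "finite I" "finite J" using IJ by (auto intro: finite_subset)
    have iI: "inj_on u I" "inj_on v J" using IJ inj by (auto intro: inj_on_subset)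
    \<comment> \<open>The refinement is gone after the first column, so the inner sums are
      unrefined, with parameters that start at index 1.\<close>
    show "((\<lambda>l. cterm q (\<lambda>n. s (Suc n)) (\<lambda>n. xi (Suc n)) u v l I J) has_sum Dsum ?q u v I J) (Sign (card I))"
      by (rule has_sum_cterm[OF q rho fI refl IJ(3) iI _ _ adm_shift[OF adm_subset[OF ad IJ(1,2)]]]) (use uv IJ in blast)+
  qed auto
  also have "(\<Sum>I\<in>Pow ?A. \<Sum>J\<in>Pow ?A. if card J = card I then
      (w (card (?A - I)) * qpoch ((s 0)\<^sup>2) ?q (card (?A - I)) * qpoch ?q ?q (card (?A - I)) *
       colw ?q (s 0) (xi 0) u ?A I * colw ?q (s 0) (inverse (xi 0)) v ?A J) * Dsum ?q u v I J else 0) =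
    Esum ?q (s 0) (cweight ?q (s 0) \<gamma>) (\<lambda>i. x * u i) (\<lambda>j. inverse x * v j) ?A ?A /
      ((\<Prod>i\<in>?A. 1 - s 0 * x * u i) * (\<Prod>j\<in>?A. 1 - s 0 * inverse x * v j))"
    unfolding cw x_def[symmetric] by (rule sum_columns_eq_Esum[OF x0 _ _ nu nv]) auto
  also have "Esum ?q (s 0) (cweight ?q (s 0) \<gamma>) (\<lambda>i. x * u i) (\<lambda>j. inverse x * v j) ?A ?A =
    (\<Prod>i<N. \<Prod>j<N. 1 - ?q * (x * u i) * (inverse x * v j)) / (\<Prod>i<N. \<Prod>j\<in>{i<..<N}. (x * u i - x * u j) * (inverse x * v i - inverse x * v j)) *
    det (mat N N (\<lambda>(i, j). ((1 - \<gamma>) * (?q - (s 0)\<^sup>2 / \<gamma>) * (1 - x * u i * (inverse x * v j)) + (1 - ?q) * (1 - s 0 * (x * u i)) * (1 - s 0 * (inverse x * v j))) /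
       ((1 - x * u i * (inverse x * v j)) * (1 - ?q * (x * u i) * (inverse x * v j)))))"
  proof (rule Esum_eq_det[OF _ inj_power_of_real[OF q] gamma_nz])
    show "?q \<noteq> 0" using q by simp
    show "inj_on (\<lambda>i. x * u i) ?A" "inj_on (\<lambda>j. inverse x * v j) ?A" using inj x0 by (auto simp: inj_on_def)
    show "1 - x * u i * (inverse x * v j) \<noteq> 0" if "i < N" "j < N" for i j unfolding xx using gen_uv that by blast
    show "1 - ?q * (x * u i) * (inverse x * v j) \<noteq> 0" if "i < N" "j < N" for i j unfolding qxx using gen_uv that by blast
  qed
  also have "(\<Prod>i<N. \<Prod>j<N. 1 - ?q * (x * u i) * (inverse x * v j)) = (\<Prod>i<N. \<Prod>j<N. 1 - ?q * u i * v j)"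
    unfolding qxx ..
  also have "(\<Prod>i<N. \<Prod>j\<in>{i<..<N}. (x * u i - x * u j) * (inverse x * v i - inverse x * v j)) = (\<Prod>i<N. \<Prod>j\<in>{i<..<N}. (u i - u j) * (v i - v j))"
  proof (intro prod.cong refl)
    fix i j
    have "(x * u i - x * u j) * (inverse x * v i - inverse x * v j) = x * inverse x * ((u i - u j) * (v i - v j))" by (simp add: algebra_simps)
    then show "(x * u i - x * u j) * (inverse x * v i - inverse x * v j) = (u i - u j) * (v i - v j)" using x0 by simp
  qed
  also have "mat N N (\<lambda>(i, j). ((1 - \<gamma>) * (?q - (s 0)\<^sup>2 / \<gamma>) * (1 - x * u i * (inverse x * v j)) + (1 - ?q) * (1 - s 0 * (x * u i)) * (1 - s 0 * (inverse x * v j))) /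
       ((1 - x * u i * (inverse x * v j)) * (1 - ?q * (x * u i) * (inverse x * v j)))) =
    mat N N (\<lambda>(i, j). ((1 - \<gamma>) * (?q - (s 0)\<^sup>2 / \<gamma>) * (1 - u i * v j) + (1 - ?q) * (1 - xi 0 * s 0 * u i) * (1 - s 0 * v j / xi 0)) /
              ((1 - u i * v j) * (1 - ?q * u i * v j)))"
  proof (rule eq_matI, goal_cases)
    case (1 i j)
    have "s 0 * (x * u i) = xi 0 * s 0 * u i" "s 0 * (inverse x * v j) = s 0 * v j / xi 0"
      by (simp_all add: x_def divide_inverse)
    then show ?case using 1 unfolding xx qxx by simp
  qed auto
  finally have "((\<lambda>l. w (count_list l 0) * cterm q s xi u v l ?A ?A) has_sum
    (\<Prod>i<N. \<Prod>j<N. 1 - ?q * u i * v j) / (\<Prod>i<N. \<Prod>j\<in>{i<..<N}. (u i - u j) * (v i - v j)) *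
     det (mat N N (\<lambda>(i, j). ((1 - \<gamma>) * (?q - (s 0)\<^sup>2 / \<gamma>) * (1 - u i * v j) + (1 - ?q) * (1 - xi 0 * s 0 * u i) * (1 - s 0 * v j / xi 0)) /
              ((1 - u i * v j) * (1 - ?q * u i * v j)))) /
     ((\<Prod>i\<in>?A. 1 - s 0 * x * u i) * (\<Prod>j\<in>?A. 1 - s 0 * inverse x * v j))) (Sign N)" .
  also have "(\<Prod>i\<in>?A. 1 - s 0 * x * u i) * (\<Prod>j\<in>?A. 1 - s 0 * inverse x * v j) = inverse (\<Prod>j<N. 1 / ((1 - s 0 * xi 0 * u j) * (1 - s 0 * v j / xi 0)))"
  proof -
    have "1 - s 0 * inverse x * v j = 1 - s 0 * v j / xi 0" for j by (simp add: x_def divide_inverse mult_ac)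
    then show ?thesis unfolding x_def[symmetric] by (simp add: prod_dividef prod.distrib)
  qed
  finally have hs: "((\<lambda>l. w (count_list l 0) * cterm q s xi u v l ?A ?A) has_sum
     ((\<Prod>j<N. 1 / ((1 - s 0 * xi 0 * u j) * (1 - s 0 * v j / xi 0))) *
            (\<Prod>i<N. \<Prod>j<N. 1 - of_real q * u i * v j) /
            (\<Prod>i<N. \<Prod>j\<in>{i<..<N}. (u i - u j) * (v i - v j)) *
            det (mat N N (\<lambda>(i, j).
              ((1 - \<gamma>) * (of_real q - (s 0)\<^sup>2 / \<gamma>) * (1 - u i * v j) +
               (1 - of_real q) * (1 - xi 0 * s 0 * u i) * (1 - s 0 * v j / xi 0)) /
              ((1 - u i * v j) * (1 - of_real q * u i * v j)))))) (Sign N)"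
    by (simp only: divide_inverse inverse_inverse_eq mult_ac)
  show ?thesis
  proof (rule has_sum_cong[THEN iffD1, OF _ hs])
    fix l assume "l \<in> Sign N"
    then have "length l = N" by (simp add: Sign_def)
    then show "w (count_list l 0) * cterm q s xi u v l ?A ?A = qpoch (\<gamma> * of_real q) (of_real q) (count_list l 0) *
               qpoch ((s 0)\<^sup>2 / \<gamma>) (of_real q) (count_list l 0) /
               (qpoch (of_real q) (of_real q) (count_list l 0) *
                qpoch ((s 0)\<^sup>2) (of_real q) (count_list l 0)) *
               spinHL q s xi l u * spinHL_dual q s xi l v"
      using spinHL_mult_dual[of q s xi l u v] unfolding w_def by (simp add: mult.assoc)
  qed
qed

end
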